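(* Let $N\ge 1$, let $Q=(q_{ij})_{i,j=1}^N$ be a real symmetric matrix with $q_{ij}\in(-1,1)$ for all $i,j$, and let $H_{\mathbb{R}}$ be a real Hilbert space with orthonormal basis $e_1,\ldots,e_N$. Let $\Gamma_Q(H_{\mathbb{R}})$ be the associated mixed $q$-Gaussian von Neumann algebra, generated by the self-adjoint operators $s_j=l_j+l_j^*$, $1\le j\le N$. Then for each $1\leq i\leq N$, the von Neumann subalgebra generated by $s_i$ is maximal abelian in $\Gamma_Q(H_{\mathbb{R}})$. In particular, $\Gamma_Q(H_{\mathbb{R}})$ is a factor if $N\geq 2$.
   Context: Let $H=H_{\mathbb{R}}+\mathrm{i}H_{\mathbb{R}}$ be the complexification of $H_{\mathbb{R}}$, and let $T:H\otimes H\to H\otimes H$ be the linear operator $T(e_i\otimes e_j)=q_{ij}\,e_j\otimes e_i$; it is a self-adjoint strict contraction satisfying the Yang-Baxter (braid) relation. For $n\ge 1$ and $1\le k\le n-1$ let $T_k$ act on $H^{\otimes n}$ as $T$ on the $k$-th and $(k+1)$-st tensor factors and as the identity on the others. For a permutation $\sigma\in S_n$ with reduced expression $\sigma=\pi_{k_1}\cdots\pi_{k_m}$ in the adjacent transpositions $\pi_k=(k\ k+1)$, set $T_\sigma=T_{k_1}\cdots T_{k_m}$ (well defined), and let $P^{(n)}=\sum_{\sigma\in S_n}T_\sigma$, a strictly positive operator on $H^{\otimes n}$. The $Q$-Fock space $\mathcal{F}_Q(H)$ is the Hilbert space completion of the algebraic direct sum $\mathbb{C}\Omega\oplus\bigoplus_{n\ge1}H^{\otimes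 n}$ for the inner product (linear in the first variable) in which different $n$ are orthogonal, the vacuum vector $\Omega$ has norm one, and $\langle\xi,\eta\rangle=\langle \xi,P^{(n)}\eta\rangle_{H^{\otimes n}}$ for $\xi,\eta\in H^{\otimes n}$, where $\langle\cdot,\cdot\rangle_{H^{\otimes n}}$ is the usual tensor inner product. The left creation operators are the bounded operators $l_i\xi=e_i\otimes\xi$ (with $l_i\Omega=e_i$); their adjoints (left annihilation operators) are given by $l_i^*\Omega=0$ and $$l_i^*(e_{j_1}\otimes\cdots\otimes e_{j_n})=\sum_{k=1}^n\delta_{i,j_k}q_{ij_1}\cdots q_{ij_{k-1}}\,e_{j_1}\otimes\cdots\otimes e_{j_{k-1}}\otimes e_{j_{k+1}}\otimes\cdots\otimes e_{j_n}.$$ The mixed $q$-Gaussian algebra $\Gamma_Q(H_{\mathbb{R}})$ is the von Neumann subalgebra of $B(\mathcal{F}_Q(H))$ generated by $s_j=l_j+l_j^*$, $1\le j\le N$. *)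

theory Defs
  imports "HOL-Analysis.Analysis" "HOL-Combinatorics.Transposition"
begin

section \<open>Operator algebras on a Hilbert space of functions\<close>

text \<open>
  A complex inner product space whose vectors are complex functions on \<open>'a\<close>, with the
  pointwise vector space operations. The inner product is linear in the first variable.
\<close>

record 'a inner_space =
  vectors :: "('a \<Rightarrow> complex) set"
  ip :: "('a \<Rightarrow> complex) \<Rightarrow> ('a \<Rightarrow> complex) \<Rightarrow> complex"

type_synonym 'a operator = "('a \<Rightarrow> complex) \<Rightarrow> ('a \<Rightarrow> complex)"

definition vnorm :: "'a inner_space \<Rightarrow> ('a \<Rightarrow> complex) \<Rightarrow> real" where
  "vnorm H f = sqrt (Re (ip H f f))"

text \<open>
  Operators are extensional functions on \<open>vectors H\<close>, so that equality of operators is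
  equality on the space.
\<close>

definition bounded_operators :: "'a inner_space \<Rightarrow> 'a operator set" where
  "bounded_operators H = {A \<in> vectors H \<rightarrow>\<^sub>E vectors H.
     (\<forall>f\<in>vectors H. \<forall>g\<in>vectors H. A (\<lambda>w. f w + g w) = (\<lambda>w. A f w + A g w)) \<and>
     (\<forall>c. \<forall>f\<in>vectors H. A (\<lambda>w. c * f w) = (\<lambda>w. c * A f w)) \<and>
     (\<exists>C. \<forall>f\<in>vectors H. vnorm H (A f) \<le> C * vnorm H f)}"

definition op_plus :: "'a inner_space \<Rightarrow> 'a operator \<Rightarrow> 'a operator \<Rightarrow> 'a operator" where
  "op_plus H A B = (\<lambda>f\<in>vectors H. (\<lambda>w. A f w + B f w))"

definition op_scale :: "'a inner_space \<Rightarrow> complex \<Rightarrow> 'a operator \<Rightarrow> 'a operator" where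
  "op_scale H c A = (\<lambda>f\<in>vectors H. (\<lambda>w. c * A f w))"

definition op_mult :: "'a inner_space \<Rightarrow> 'a operator \<Rightarrow> 'a operator \<Rightarrow> 'a operator" where
  "op_mult H A B = compose (vectors H) A B"

definition op_one :: "'a inner_space \<Rightarrow> 'a operator" where
  "op_one H = (\<lambda>f\<in>vectors H. f)"

definition op_adjoint :: "'a inner_space \<Rightarrow> 'a operator \<Rightarrow> 'a operator" where
  "op_adjoint H A = (THE B. B \<in> bounded_operators H \<and>
     (\<forall>f\<in>vectors H. \<forall>g\<in>vectors H. ip H (A f) g = ip H f (B g)))"

definition star_subalgebra :: "'a inner_space \<Rightarrow> 'a operator set \<Rightarrow> bool" where
  "star_subalgebra H M \<longleftrightarrow> M \<subseteq> bounded_operators H \<and> M \<noteq> {} \<and>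
     (\<forall>A\<in>M. \<forall>B\<in>M. op_plus H A B \<in> M \<and> op_mult H A B \<in> M) \<and>
     (\<forall>A\<in>M. (\<forall>c. op_scale H c A \<in> M) \<and> op_adjoint H A \<in> M)"

definition commutant :: "'a inner_space \<Rightarrow> 'a operator set \<Rightarrow> 'a operator set" where
  "commutant H S = {A \<in> bounded_operators H. \<forall>B\<in>S. op_mult H A B = op_mult H B A}"

definition von_neumann_algebra :: "'a inner_space \<Rightarrow> 'a operator set \<Rightarrow> bool" where
  "von_neumann_algebra H M \<longleftrightarrow> star_subalgebra H M \<and> commutant H (commutant H M) = M"

definition vn_generated :: "'a inner_space \<Rightarrow> 'a operator set \<Rightarrow> 'a operator set" where
  "vn_generated H S = \<Inter>{M. von_neumann_algebra H M \<and> S \<subseteq> M}"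

definition abelian :: "'a inner_space \<Rightarrow> 'a operator set \<Rightarrow> bool" where
  "abelian H M \<longleftrightarrow> (\<forall>A\<in>M. \<forall>B\<in>M. op_mult H A B = op_mult H B A)"

definition maximal_abelian_in ::
    "'a inner_space \<Rightarrow> 'a operator set \<Rightarrow> 'a operator set \<Rightarrow> bool" where
  "maximal_abelian_in H A M \<longleftrightarrow> star_subalgebra H A \<and> abelian H A \<and> A \<subseteq> M \<and>
     (\<forall>B. star_subalgebra H B \<and> abelian H B \<and> A \<subseteq> B \<and> B \<subseteq> M \<longrightarrow> B = A)"

definition factor :: "'a inner_space \<Rightarrow> 'a operator set \<Rightarrow> bool" where
  "factor H M \<longleftrightarrow> von_neumann_algebra H M \<and>
     M \<inter> commutant H M = range (\<lambda>c. op_scale H c (op_one H))"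


section \<open>The \<open>Q\<close>-Fock space\<close>

text \<open>
  The index set of the basis \<open>e\<^sub>1, \<dots>, e\<^sub>N\<close> is a finite type \<open>'n\<close>, so \<open>N = CARD('n)\<close>. An
  element of the tensor power of order \<open>n\<close> is given by its coefficients with respect to the
  orthonormal basis of elementary tensors of basis vectors, i.e. by a function on the words
  of length \<open>n\<close> in \<open>'n list\<close>. Thus the algebraic direct sum of all tensor powers consists of
  the finitely supported functions on \<open>'n list\<close>, and the vacuum is the indicator function
  of \<open>[]\<close>.
\<close>

definition tensor_ip ::
    "nat \<Rightarrow> ('n::finite list \<Rightarrow> complex) \<Rightarrow> ('n list \<Rightarrow> complex) \<Rightarrow> complex" where
  "tensor_ip n f g = (\<Sum>w | length w = n. f w * cnj (g w))"

definition swap_at :: "nat \<Rightarrow> 'a list \<Rightarrow> 'a list" where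
  "swap_at k w = w[k := w ! Suc k, Suc k := w ! k]"

text \<open>
  The operator \<open>T\<close> acting on the tensor factors \<open>k\<close> and \<open>k + 1\<close>, counted from \<open>0\<close>. It maps
  the basis tensor of a word \<open>v\<close> to \<open>q\<^sub>i\<^sub>j\<close> times that of \<open>swap_at k v\<close>, where \<open>i = v ! k\<close> and
  \<open>j = v ! Suc k\<close>; hence the coefficient of the image at \<open>w\<close> comes from \<open>v = swap_at k w\<close>.
\<close>

definition braid :: "real^'n^'n \<Rightarrow> nat \<Rightarrow> ('n::finite list \<Rightarrow> complex) \<Rightarrow> ('n list \<Rightarrow> complex)" where
  "braid Q k f = (\<lambda>w. of_real (Q $ (w ! Suc k) $ (w ! k)) * f (swap_at k w))"

definition perm_expression :: "nat \<Rightarrow> (nat \<Rightarrow> nat) \<Rightarrow> nat list \<Rightarrow> bool" where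
  "perm_expression n \<sigma> ks \<longleftrightarrow> (\<forall>k\<in>set ks. Suc k < n) \<and>
     foldr (\<lambda>k \<tau>. Transposition.transpose k (Suc k) \<circ> \<tau>) ks id = \<sigma>"

definition reduced_expression :: "nat \<Rightarrow> (nat \<Rightarrow> nat) \<Rightarrow> nat list \<Rightarrow> bool" where
  "reduced_expression n \<sigma> ks \<longleftrightarrow> perm_expression n \<sigma> ks \<and>
     (\<forall>ks'. perm_expression n \<sigma> ks' \<longrightarrow> length ks \<le> length ks')"

text \<open>Well defined: by the braid relation all reduced expressions give the same operator.\<close>

definition braid_perm ::
    "real^'n^'n \<Rightarrow> nat \<Rightarrow> (nat \<Rightarrow> nat) \<Rightarrow> ('n::finite list \<Rightarrow> complex) \<Rightarrow> ('n list \<Rightarrow> complex)" where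
  "braid_perm Q n \<sigma> = foldr (\<lambda>k A. braid Q k \<circ> A) (SOME ks. reduced_expression n \<sigma> ks) id"

definition symmetrizer ::
    "real^'n^'n \<Rightarrow> nat \<Rightarrow> ('n::finite list \<Rightarrow> complex) \<Rightarrow> ('n list \<Rightarrow> complex)" where
  "symmetrizer Q n f = (\<lambda>w. \<Sum>\<sigma> | \<sigma> permutes {..<n}. braid_perm Q n \<sigma> f w)"

text \<open>
  \<open>level_ip Q n f g\<close> only depends on the components of \<open>f\<close> and \<open>g\<close> in the tensor power of
  order \<open>n\<close>, because \<open>swap_at\<close> preserves the length of words.
\<close>

definition level_ip ::
    "real^'n^'n \<Rightarrow> nat \<Rightarrow> ('n::finite list \<Rightarrow> complex) \<Rightarrow> ('n list \<Rightarrow> complex) \<Rightarrow> complex" where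
  "level_ip Q n f g = tensor_ip n f (symmetrizer Q n g)"

text \<open>
  The tensor powers are finite-dimensional, hence complete for the inner products
  \<open>level_ip Q n\<close> (the symmetrizers are strictly positive when \<open>Q\<close> is symmetric with entries
  in \<open>(-1, 1)\<close>). The completion of their orthogonal algebraic direct sum is therefore the space
  of all sequences of components whose squared norms are summable.
\<close>

definition Q_Fock :: "real^'n^'n \<Rightarrow> ('n::finite list) inner_space" where
  "Q_Fock Q = \<lparr> vectors = {f. summable (\<lambda>n. Re (level_ip Q n f f))},
                ip = (\<lambda>f g. \<Sum>n. level_ip Q n f g) \<rparr>"

definition creation :: "real^'n^'n \<Rightarrow> 'n \<Rightarrow> ('n::finite list) operator" where
  "creation Q i = (\<lambda>f\<in>vectors (Q_Fock Q).
     (\<lambda>w. case w of [] \<Rightarrow> 0 | j # v \<Rightarrow> if j = i then f v else 0))"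

definition q_gaussian :: "real^'n^'n \<Rightarrow> 'n \<Rightarrow> ('n::finite list) operator" where
  "q_gaussian Q i = op_plus (Q_Fock Q) (creation Q i) (op_adjoint (Q_Fock Q) (creation Q i))"

definition mixed_q_gaussian_algebra :: "real^'n^'n \<Rightarrow> ('n::finite list) operator set" where
  "mixed_q_gaussian_algebra Q = vn_generated (Q_Fock Q) (range (q_gaussian Q))"

end

(*
  Let x in the algebra commute with s_i. The vector \<xi> = x \<Omega> satisfies s_i \<xi> = r_i \<xi>, where
  r_i is the right field operator, which commutes with the algebra. Put
  d(m,k) = <\<xi>, e_i^m w e_i^k> for a word w with a letter other than i, and assume that \<xi> is
  orthogonal to all words e_i^m v e_i^k for which v is w with some letters i removed. Then
  comparing the two sides gives a recurrence for d in which the coefficients of w enter only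
  through the product c of the q_{ij} over the letters j of w, and |c| < 1. Pairing the numbers
  d(m,k) with m + k = 2M with the Fourier coefficients of the orthogonality weight of the
  continuous q-Hermite polynomials gives a quantity that the recurrence expresses as
  (1 - c)(1 - c q)...(1 - c q^(M-1)) d(0,0) up to a factor, while the normalised d(m,k) tend to 0.
  Hence d(0,0) = 0, and \<xi> lies in the closed span of the words in i alone, that is, in the
  closure of the vacuum orbit of the algebra generated by s_i. This gives both
  the maximality and, for two different i, the triviality of the centre.

  Positivity of the symmetrizers comes from writing the inner product as a sum over pairs of
  arrangements of n labels, with the kernel that has one factor 1 or q for every pair of labels,
  according to whether the arrangements order the pair in the same way.
*)

theory Submission imports Defs begin

section \<open>Operators on Hilbert spaces of functions\<close>

text \<open>Elements of the algebra commute with the right field operators, and the left and right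
  field operators for \<open>i\<close> both send the vacuum to \<open>e_i\<close>. This is why
  commutation with \<open>s_i\<close> becomes an equation for the vector x \<Omega> alone.

  The recurrence yields only d(0,0) = 0. The other d(m,k) follow because s_i \<xi> satisfies the
  same equation as \<xi>: a padding letter can be moved from the word into the vector, which lowers
  m + k. The assumption on words with letters \<open>i\<close> removed comes from an induction on
  the length of w, since such a removal keeps the letters other than \<open>i\<close>.

  The empty word has c = 1, so the factor 1 - c vanishes and nothing follows. This is as it should
  be, because the vacuum orbit of \<open>s_i\<close> consists of solutions.

  The limit needs the exact growth of the norms of e_i^m w e_i^k. An operator norm bound for the
  creation operator can lose an exponential factor, so the norm of its m-th power is compared with
  the product of the numbers 1 - q^j for j from 1 to m.\<close>

locale positive_form =
  fixes V :: "('a \<Rightarrow> complex) set"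
    and B :: "('a \<Rightarrow> complex) \<Rightarrow> ('a \<Rightarrow> complex) \<Rightarrow> complex"
  assumes zero_mem: "(\<lambda>_. 0) \<in> V"
    and add_mem: "\<lbrakk>f \<in> V; g \<in> V\<rbrakk> \<Longrightarrow> (\<lambda>w. f w + g w) \<in> V"
    and scale_mem: "f \<in> V \<Longrightarrow> (\<lambda>w. c * f w) \<in> V"
    and form_add: "\<lbrakk>f \<in> V; g \<in> V; h \<in> V\<rbrakk> \<Longrightarrow> B (\<lambda>w. f w + g w) h = B f h + B g h"
    and form_scale: "\<lbrakk>f \<in> V; g \<in> V\<rbrakk> \<Longrightarrow> B (\<lambda>w. c * f w) g = c * B f g"
    and form_cnj: "\<lbrakk>f \<in> V; g \<in> V\<rbrakk> \<Longrightarrow> B g f = cnj (B f g)"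
    and form_pos: "f \<in> V \<Longrightarrow> 0 \<le> Re (B f f)"
begin

lemma diff_mem: "\<lbrakk>f \<in> V; g \<in> V\<rbrakk> \<Longrightarrow> (\<lambda>w. f w - g w) \<in> V"
  using add_mem[of f "\<lambda>w. (-1) * g w"] scale_mem[of g "-1"] by simp

lemma form_diff:
  assumes "f \<in> V" "g \<in> V" "h \<in> V"
  shows "B (\<lambda>w. f w - g w) h = B f h - B g h"
  using form_add[of f "\<lambda>w. (-1) * g w" h] form_scale[of g h "-1"] scale_mem[of g "-1"] assms
  by simp

lemma form_zero: "f \<in> V \<Longrightarrow> B (\<lambda>_. 0) f = 0"
  using form_scale[of f f 0] by simp

lemma form_add_right:
  assumes "f \<in> V" "g \<in> V" "h \<in> V"
  shows "B h (\<lambda>w. f w + g w) = B h f + B h g"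
  using assms form_cnj[of "\<lambda>w. f w + g w" h] form_add form_cnj[of h] add_mem by simp

lemma form_diff_right:
  assumes "f \<in> V" "g \<in> V" "h \<in> V"
  shows "B h (\<lambda>w. f w - g w) = B h f - B h g"
  using assms form_cnj[of "\<lambda>w. f w - g w" h] form_diff form_cnj[of h] diff_mem by simp

lemma form_scale_right:
  assumes "f \<in> V" "g \<in> V"
  shows "B g (\<lambda>w. c * f w) = cnj c * B g f"
  using assms form_cnj[of "\<lambda>w. c * f w" g] form_scale form_cnj[of g f] scale_mem by simp

lemma form_self: "f \<in> V \<Longrightarrow> B f f = of_real (Re (B f f))"
  using form_cnj[of f f] by (simp add: complex_eq_iff)

lemma form_diff_self:
  assumes "f \<in> V" "g \<in> V"
  shows "Re (B (\<lambda>w. f w - g w) (\<lambda>w. f w - g w)) = Re (B f f) + Re (B g g) - 2 * Re (B f g)"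
  using assms form_cnj[of g f] by (simp add: form_diff form_diff_right diff_mem)

lemma form_add_self:
  assumes "f \<in> V" "g \<in> V"
  shows "Re (B (\<lambda>w. f w + g w) (\<lambda>w. f w + g w)) = Re (B f f) + Re (B g g) + 2 * Re (B f g)"
  using assms form_cnj[of g f] by (simp add: form_add form_add_right add_mem)

lemma form_scale_self:
  assumes "f \<in> V"
  shows "Re (B (\<lambda>w. c * f w) (\<lambda>w. c * f w)) = (cmod c)\<^sup>2 * Re (B f f)"
proof -
  have "B (\<lambda>w. c * f w) (\<lambda>w. c * f w) = of_real ((cmod c)\<^sup>2) * B f f"
    using assms by (simp add: form_scale form_scale_right scale_mem flip: complex_norm_square)
  then show ?thesis by simp
qed

lemma cauchy_schwarz:
  assumes f: "f \<in> V" and g: "g \<in> V"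
  shows "(cmod (B f g))\<^sup>2 \<le> Re (B f f) * Re (B g g)"
proof -
  let ?a = "Re (B f f)" and ?b = "Re (B g g)" and ?c = "B f g"
  \<comment> \<open>Nonnegativity of the form at \<open>f - t ?c g\<close>. The factor
    \<open>?c\<close> makes the cross term real, so one real parameter is enough.\<close>
  have key: "0 \<le> ?a + t\<^sup>2 * (cmod ?c)\<^sup>2 * ?b - 2 * t * (cmod ?c)\<^sup>2" for t :: real
  proof -
    have "Re (B f (\<lambda>w. (of_real t * ?c) * g w)) = t * (cmod ?c)\<^sup>2"
      using f g by (simp add: form_scale_right) (simp only: cmod_power2, simp add: power2_eq_square algebra_simps)
    then show ?thesis
      using form_pos[OF diff_mem[OF f scale_mem[OF g, of "of_real t * ?c"]]]
        form_diff_self[OF f scale_mem[OF g, of "of_real t * ?c"]]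
        form_scale_self[OF g, of "of_real t * ?c"]
      by (simp add: norm_mult power_mult_distrib)
  qed
  show ?thesis
  proof (cases "?b = 0")
    case True
    have "(cmod ?c)\<^sup>2 = 0"
    proof (rule ccontr)
      assume "(cmod ?c)\<^sup>2 \<noteq> 0"
      \<comment> \<open>With \<open>?b = 0\<close> the inequality \<open>key\<close> is affine in
        \<open>t\<close>, and this value of \<open>t\<close> turns its right-hand side into
        -1.\<close>
      then have "2 * ((?a + 1) / (2 * (cmod ?c)\<^sup>2)) * (cmod ?c)\<^sup>2 = ?a + 1" by simp
      then show False using key[of "(?a + 1) / (2 * (cmod ?c)\<^sup>2)"] True by simp
    qed
    then show ?thesis using True by simp
  next
    case False
    then have b: "?b > 0" using form_pos[OF g] by simp
    have "(1 / ?b)\<^sup>2 * (cmod ?c)\<^sup>2 * ?b = (1 / ?b) * (cmod ?c)\<^sup>2"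
      using b by (simp add: power2_eq_square)
    then have "0 \<le> ?a - (1 / ?b) * (cmod ?c)\<^sup>2" using key[of "1 / ?b"] by simp
    then show ?thesis using b by (simp add: field_simps)
  qed
qed

end

text \<open>Completeness enters as the representation of bounded functionals, the form in which
  adjoints use it. On the Fock space it can be verified level by level.\<close>

locale hilbert_functions = positive_form "vectors H" "ip H" for H :: "'a inner_space" +
  assumes definite: "\<lbrakk>f \<in> vectors H; ip H f f = 0\<rbrakk> \<Longrightarrow> f = (\<lambda>_. 0)"
    and riesz: "\<lbrakk>\<And>f g. f \<in> vectors H \<Longrightarrow> g \<in> vectors H \<Longrightarrow> \<phi> (\<lambda>w. f w + g w) = \<phi> f + \<phi> g;
        \<And>c f. f \<in> vectors H \<Longrightarrow> \<phi> (\<lambda>w. c * f w) = c * \<phi> f;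
        \<And>f. f \<in> vectors H \<Longrightarrow> cmod (\<phi> f) \<le> C * vnorm H f\<rbrakk>
        \<Longrightarrow> \<exists>h\<in>vectors H. \<forall>f\<in>vectors H. \<phi> f = ip H f h"
begin

abbreviation "V \<equiv> vectors H"
abbreviation "BO \<equiv> bounded_operators H"

lemma vnorm_nonneg [simp]: "f \<in> V \<Longrightarrow> 0 \<le> vnorm H f"
  by (simp add: vnorm_def form_pos)

lemma vnorm_sq: "f \<in> V \<Longrightarrow> (vnorm H f)\<^sup>2 = Re (ip H f f)"
  by (simp add: vnorm_def form_pos)

lemma vnorm_scale: "f \<in> V \<Longrightarrow> vnorm H (\<lambda>w. c * f w) = cmod c * vnorm H f"
  by (simp add: vnorm_def form_scale_self real_sqrt_mult)

lemma ip_le: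
  assumes "f \<in> V" "g \<in> V"
  shows "cmod (ip H f g) \<le> vnorm H f * vnorm H g"
proof (rule power2_le_imp_le)
  show "(cmod (ip H f g))\<^sup>2 \<le> (vnorm H f * vnorm H g)\<^sup>2"
    using cauchy_schwarz[OF assms] assms by (simp add: power_mult_distrib vnorm_sq)
qed (use assms in auto)

lemma vnorm_triangle:
  assumes "f \<in> V" "g \<in> V"
  shows "vnorm H (\<lambda>w. f w + g w) \<le> vnorm H f + vnorm H g"
proof (rule power2_le_imp_le)
  have "Re (ip H f g) \<le> vnorm H f * vnorm H g"
    using ip_le[OF assms] complex_Re_le_cmod[of "ip H f g"] by linarith
  then show "(vnorm H (\<lambda>w. f w + g w))\<^sup>2 \<le> (vnorm H f + vnorm H g)\<^sup>2"
    using assms by (simp add: vnorm_sq add_mem form_add_self power2_sum)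
qed (use assms in auto)

lemma vec_eqI:
  assumes "f \<in> V" "g \<in> V" "\<And>h. h \<in> V \<Longrightarrow> ip H f h = ip H g h"
  shows "f = g"
proof -
  have "ip H (\<lambda>w. f w - g w) (\<lambda>w. f w - g w) = 0"
    using assms(1,2) assms(3)[OF diff_mem[OF assms(1,2)]] diff_mem[OF assms(1,2)]
    by (simp add: form_diff)
  then have "(\<lambda>w. f w - g w) = (\<lambda>_. 0)" by (intro definite diff_mem assms)
  then show ?thesis by (auto simp: fun_eq_iff)
qed

lemma bo_mem: "\<lbrakk>A \<in> BO; f \<in> V\<rbrakk> \<Longrightarrow> A f \<in> V"
  by (auto simp: bounded_operators_def)

lemma bo_add: "\<lbrakk>A \<in> BO; f \<in> V; g \<in> V\<rbrakk> \<Longrightarrow> A (\<lambda>w. f w + g w) = (\<lambda>w. A f w + A g w)"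
  by (auto simp: bounded_operators_def)

lemma bo_scale: "\<lbrakk>A \<in> BO; f \<in> V\<rbrakk> \<Longrightarrow> A (\<lambda>w. c * f w) = (\<lambda>w. c * A f w)"
  by (auto simp: bounded_operators_def)

lemma bo_ext: "A \<in> BO \<Longrightarrow> A \<in> extensional V"
  by (auto simp: bounded_operators_def PiE_def)

lemma bo_bound:
  assumes "A \<in> BO"
  obtains C where "C \<ge> 0" "\<And>f. f \<in> V \<Longrightarrow> vnorm H (A f) \<le> C * vnorm H f"
proof -
  obtain C where C: "\<And>f. f \<in> V \<Longrightarrow> vnorm H (A f) \<le> C * vnorm H f"
    using assms unfolding bounded_operators_def by blast
  have "vnorm H (A f) \<le> max C 0 * vnorm H f" if "f \<in> V" for f
    using C[OF that] mult_right_mono[of C "max C 0" "vnorm H f"] that by simp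
  then show ?thesis by (intro that[of "max C 0"]) auto
qed

lemma boI:
  assumes "\<And>f. f \<in> V \<Longrightarrow> A f \<in> V" "A \<in> extensional V"
    "\<And>f g. \<lbrakk>f \<in> V; g \<in> V\<rbrakk> \<Longrightarrow> A (\<lambda>w. f w + g w) = (\<lambda>w. A f w + A g w)"
    "\<And>c f. f \<in> V \<Longrightarrow> A (\<lambda>w. c * f w) = (\<lambda>w. c * A f w)"
    "\<And>f. f \<in> V \<Longrightarrow> vnorm H (A f) \<le> C * vnorm H f"
  shows "A \<in> BO"
  using assms unfolding bounded_operators_def PiE_def by blast

lemma op_eqI:
  assumes "A \<in> BO" "B \<in> BO" "\<And>f. f \<in> V \<Longrightarrow> A f = B f"
  shows "A = B"
  using assms by (intro extensionalityI[of A V B]) (auto simp: bo_ext)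

lemma op_eqI_ip:
  assumes "A \<in> BO" "B \<in> BO" "\<And>f g. \<lbrakk>f \<in> V; g \<in> V\<rbrakk> \<Longrightarrow> ip H (A f) g = ip H (B f) g"
  shows "A = B"
  using assms by (intro op_eqI vec_eqI) (auto simp: bo_mem)

section \<open>Bounded operators and adjoints\<close>

lemma op_plus_apply: "f \<in> V \<Longrightarrow> op_plus H A B f = (\<lambda>w. A f w + B f w)"
  by (simp add: op_plus_def)

lemma op_scale_apply: "f \<in> V \<Longrightarrow> op_scale H c A f = (\<lambda>w. c * A f w)"
  by (simp add: op_scale_def)

lemma op_mult_apply: "f \<in> V \<Longrightarrow> op_mult H A B f = A (B f)"
  by (simp add: op_mult_def compose_eq)

lemma op_one_apply: "f \<in> V \<Longrightarrow> op_one H f = f"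
  by (simp add: op_one_def)

lemmas op_apply = op_plus_apply op_scale_apply op_mult_apply op_one_apply

lemma op_one_bo: "op_one H \<in> BO"
  by (rule boI[where C = 1]) (auto simp: op_one_def add_mem scale_mem)

lemma op_plus_bo:
  assumes A: "A \<in> BO" and B: "B \<in> BO" shows "op_plus H A B \<in> BO"
proof -
  obtain C D where C: "\<And>f. f \<in> V \<Longrightarrow> vnorm H (A f) \<le> C * vnorm H f"
    and D: "\<And>f. f \<in> V \<Longrightarrow> vnorm H (B f) \<le> D * vnorm H f"
    using bo_bound[OF A] bo_bound[OF B] by metis
  show ?thesis
  proof (rule boI[where C = "C + D"])
    show "vnorm H (op_plus H A B f) \<le> (C + D) * vnorm H f" if "f \<in> V" for f
      using vnorm_triangle[OF bo_mem[OF A that] bo_mem[OF B that]] C[OF that] D[OF that] that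
      by (simp add: op_apply distrib_right)
  qed (use A B in \<open>auto simp: op_apply bo_mem bo_add bo_scale add_mem scale_mem op_plus_def
      algebra_simps\<close>)
qed

lemma op_scale_bo:
  assumes A: "A \<in> BO" shows "op_scale H c A \<in> BO"
proof -
  obtain C where C: "\<And>f. f \<in> V \<Longrightarrow> vnorm H (A f) \<le> C * vnorm H f"
    using bo_bound[OF A] by metis
  show ?thesis
  proof (rule boI[where C = "cmod c * C"])
    show "vnorm H (op_scale H c A f) \<le> (cmod c * C) * vnorm H f" if "f \<in> V" for f
      using mult_left_mono[OF C[OF that], of "cmod c"] that
      by (simp add: op_apply vnorm_scale bo_mem[OF A] mult.assoc)
  qed (use A in \<open>auto simp: op_apply bo_mem bo_add bo_scale add_mem scale_mem op_scale_def
      algebra_simps\<close>)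
qed

lemma op_mult_bo:
  assumes A: "A \<in> BO" and B: "B \<in> BO" shows "op_mult H A B \<in> BO"
proof -
  obtain C D where C0: "C \<ge> 0" and C: "\<And>f. f \<in> V \<Longrightarrow> vnorm H (A f) \<le> C * vnorm H f"
    and D: "\<And>f. f \<in> V \<Longrightarrow> vnorm H (B f) \<le> D * vnorm H f"
    using bo_bound[OF A] bo_bound[OF B] by metis
  show ?thesis
  proof (rule boI[where C = "C * D"])
    show "vnorm H (op_mult H A B f) \<le> (C * D) * vnorm H f" if "f \<in> V" for f
      using C[OF bo_mem[OF B that]] mult_left_mono[OF D[OF that] C0] that
      by (simp add: op_apply mult.assoc)
    show "op_mult H A B \<in> extensional V" by (simp add: op_mult_def)
  qed (use A B in \<open>auto simp: op_apply bo_mem bo_add bo_scale add_mem scale_mem\<close>)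
qed

lemma adjoint_exists:
  assumes A: "A \<in> BO"
  shows "\<exists>B\<in>BO. \<forall>f\<in>V. \<forall>g\<in>V. ip H (A f) g = ip H f (B g)"
proof -
  obtain C where C0: "C \<ge> 0" and C: "\<And>f. f \<in> V \<Longrightarrow> vnorm H (A f) \<le> C * vnorm H f"
    using bo_bound[OF A] by metis
  have "\<exists>h\<in>V. \<forall>f\<in>V. ip H (A f) g = ip H f h" if g: "g \<in> V" for g
  proof (rule riesz[where C = "C * vnorm H g"])
    show "cmod (ip H (A f) g) \<le> C * vnorm H g * vnorm H f" if f: "f \<in> V" for f
      using ip_le[OF bo_mem[OF A f] g] mult_right_mono[OF C[OF f], of "vnorm H g"] g
      by (simp add: mult_ac)
  qed (use g A in \<open>auto simp: bo_add bo_scale form_add form_scale bo_mem\<close>)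
  then obtain b where b: "\<And>g. g \<in> V \<Longrightarrow> b g \<in> V"
    and ipb: "\<And>f g. \<lbrakk>f \<in> V; g \<in> V\<rbrakk> \<Longrightarrow> ip H (A f) g = ip H f (b g)" by metis
  have ipb': "ip H (b g) f = ip H g (A f)" if "f \<in> V" "g \<in> V" for f g
    using that form_cnj[of f "b g"] form_cnj[of "A f" g] ipb b bo_mem[OF A] by simp
  \<comment> \<open>The constant of \<open>A\<close> serves again: the squared norm of
    \<open>b g\<close> is the inner product of \<open>A (b g)\<close> with \<open>g\<close>, and one
    factor of the norm of \<open>b g\<close> cancels.\<close>
  have "restrict b V \<in> BO"
  proof (rule boI[where C = C])
    show "vnorm H (restrict b V g) \<le> C * vnorm H g" if g: "g \<in> V" for g
    proof (cases "vnorm H (b g) = 0")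
      case False
      have "(vnorm H (b g))\<^sup>2 = Re (ip H (A (b g)) g)"
        using g b ipb by (simp add: vnorm_sq)
      also have "\<dots> \<le> vnorm H (A (b g)) * vnorm H g"
        using ip_le[OF bo_mem[OF A b[OF g]] g] complex_Re_le_cmod[of "ip H (A (b g)) g"]
        by linarith
      also have "\<dots> \<le> C * vnorm H (b g) * vnorm H g"
        using C[OF b[OF g]] g by (intro mult_right_mono) auto
      finally have "vnorm H (b g) * vnorm H (b g) \<le> vnorm H (b g) * (C * vnorm H g)"
        by (simp add: power2_eq_square mult_ac)
      moreover have "vnorm H (b g) > 0" using False b[OF g] vnorm_nonneg[of "b g"] by linarith
      ultimately show ?thesis using g by simp
    qed (use g C0 in simp)
    show "restrict b V (\<lambda>w. f w + g w) = (\<lambda>w. restrict b V f w + restrict b V g w)"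
      if "f \<in> V" "g \<in> V" for f g
      using that by (simp add: add_mem, intro vec_eqI)
        (auto simp: ipb' b add_mem form_add bo_mem[OF A])
    show "restrict b V (\<lambda>w. c * f w) = (\<lambda>w. c * restrict b V f w)" if "f \<in> V" for c f
      using that by (simp add: scale_mem, intro vec_eqI)
        (auto simp: ipb' b scale_mem form_scale bo_mem[OF A])
  qed (auto simp: b)
  then show ?thesis using ipb by (intro bexI[of _ "restrict b V"]) auto
qed

lemma adjoint_unique:
  assumes "B \<in> BO" "B' \<in> BO"
    "\<And>f g. \<lbrakk>f \<in> V; g \<in> V\<rbrakk> \<Longrightarrow> ip H (A f) g = ip H f (B g)"
    "\<And>f g. \<lbrakk>f \<in> V; g \<in> V\<rbrakk> \<Longrightarrow> ip H (A f) g = ip H f (B' g)"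
  shows "B = B'"
proof (rule op_eqI_ip[OF assms(1,2)])
  fix f g assume "f \<in> V" "g \<in> V"
  then show "ip H (B f) g = ip H (B' f) g"
    using assms(3,4)[of g f] form_cnj[of g "B f"] form_cnj[of g "B' f"] bo_mem assms(1,2) by simp
qed

lemma op_adjoint_eqI:
  assumes "B \<in> BO" "\<And>f g. \<lbrakk>f \<in> V; g \<in> V\<rbrakk> \<Longrightarrow> ip H (A f) g = ip H f (B g)"
  shows "op_adjoint H A = B"
  unfolding op_adjoint_def
proof (rule the_equality)
  fix B' assume "B' \<in> BO \<and> (\<forall>f\<in>V. \<forall>g\<in>V. ip H (A f) g = ip H f (B' g))"
  then show "B' = B" by (intro adjoint_unique[of B' B A]) (auto simp: assms)
qed (use assms in auto)

lemma
  assumes "A \<in> BO"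
  shows op_adjoint_bo: "op_adjoint H A \<in> BO"
    and op_adjoint_ip: "\<lbrakk>f \<in> V; g \<in> V\<rbrakk> \<Longrightarrow> ip H (A f) g = ip H f (op_adjoint H A g)"
proof -
  obtain B where "B \<in> BO" "\<forall>f\<in>V. \<forall>g\<in>V. ip H (A f) g = ip H f (B g)"
    using adjoint_exists[OF assms] by auto
  moreover from this have "op_adjoint H A = B" by (intro op_adjoint_eqI) auto
  ultimately show "op_adjoint H A \<in> BO"
    "\<lbrakk>f \<in> V; g \<in> V\<rbrakk> \<Longrightarrow> ip H (A f) g = ip H f (op_adjoint H A g)" by auto
qed

lemma op_adjoint_ip':
  assumes "A \<in> BO" "f \<in> V" "g \<in> V"
  shows "ip H (op_adjoint H A f) g = ip H f (A g)"
  using assms op_adjoint_ip[of A g f] form_cnj[of "A g" f] form_cnj[of g "op_adjoint H A f"]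
    bo_mem op_adjoint_bo by simp

section \<open>Commutants and generated von Neumann algebras\<close>

lemma commutant_bo: "commutant H S \<subseteq> BO"
  by (auto simp: commutant_def)

lemma commutantD:
  assumes "A \<in> commutant H S" "B \<in> S" "f \<in> V"
  shows "A (B f) = B (A f)"
proof -
  have "op_mult H A B f = op_mult H B A f" using assms by (simp add: commutant_def)
  then show ?thesis using assms(3) by (simp add: op_mult_apply)
qed

lemma commutantI:
  assumes "A \<in> BO" "S \<subseteq> BO" "\<And>B f. \<lbrakk>B \<in> S; f \<in> V\<rbrakk> \<Longrightarrow> A (B f) = B (A f)"
  shows "A \<in> commutant H S"
proof -
  have "op_mult H A B = op_mult H B A" if "B \<in> S" for B
    using that assms by (intro op_eqI op_mult_bo) (auto simp: op_mult_apply)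
  then show ?thesis using assms(1) by (simp add: commutant_def)
qed

lemma commutant_antimono: "S \<subseteq> T \<Longrightarrow> commutant H T \<subseteq> commutant H S"
  by (auto simp: commutant_def)

lemma subset_double_commutant: "S \<subseteq> BO \<Longrightarrow> S \<subseteq> commutant H (commutant H S)"
  by (auto simp: commutant_def)

lemma triple_commutant:
  assumes "S \<subseteq> BO"
  shows "commutant H (commutant H (commutant H S)) = commutant H S"
  by (intro equalityI commutant_antimono subset_double_commutant assms commutant_bo)

lemma star_subalgebra_commutant:
  assumes S: "S \<subseteq> BO" and adj: "\<And>A. A \<in> S \<Longrightarrow> op_adjoint H A \<in> S"
  shows "star_subalgebra H (commutant H S)"
proof -
  have SB: "B f \<in> V" if "B \<in> S" "f \<in> V" for B f using S that bo_mem by auto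
  have SA: "B (\<lambda>w. f w + g w) = (\<lambda>w. B f w + B g w)" if "B \<in> S" "f \<in> V" "g \<in> V" for B f g
    using S that bo_add by auto
  have SS: "B (\<lambda>w. c * f w) = (\<lambda>w. c * B f w)" if "B \<in> S" "f \<in> V" for B c f
    using S that bo_scale by auto
  have CB: "A \<in> BO" if "A \<in> commutant H S" for A using that commutant_bo by auto
  have "op_adjoint H A \<in> commutant H S" if A: "A \<in> commutant H S" for A
  proof (rule commutantI[OF op_adjoint_bo[OF CB[OF A]] S])
    fix B f assume B: "B \<in> S" and f: "f \<in> V"
    note A' = op_adjoint_bo[OF CB[OF A]]
    have B': "B \<in> BO" using B S by auto
    show "op_adjoint H A (B f) = B (op_adjoint H A f)"
    proof (rule vec_eqI)
      fix h assume h: "h \<in> V"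
      have "ip H (op_adjoint H A (B f)) h = ip H (B f) (A h)"
        using CB[OF A] SB[OF B f] h by (simp add: op_adjoint_ip')
      also have "\<dots> = ip H f (op_adjoint H B (A h))"
        using B' f h bo_mem[OF CB[OF A]] by (simp add: op_adjoint_ip)
      also have "\<dots> = ip H f (A (op_adjoint H B h))"
        using commutantD[OF A adj[OF B] h] by simp
      also have "\<dots> = ip H (op_adjoint H A f) (op_adjoint H B h)"
        using CB[OF A] f h bo_mem[OF op_adjoint_bo[OF B']] by (simp add: op_adjoint_ip')
      also have "\<dots> = ip H (B (op_adjoint H A f)) h"
        using B' bo_mem[OF A' f] h by (simp add: op_adjoint_ip)
      finally show "ip H (op_adjoint H A (B f)) h = ip H (B (op_adjoint H A f)) h" .
    qed (use A' B' f in \<open>auto simp: bo_mem\<close>)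
  qed
  moreover have "op_plus H A B \<in> commutant H S" "op_mult H A B \<in> commutant H S"
    "op_scale H c A \<in> commutant H S" if A: "A \<in> commutant H S" and B: "B \<in> commutant H S"
    for A B c
  proof (safe intro!: commutantI S)
    fix D f assume D: "D \<in> S" and f: "f \<in> V"
    note [simp] = bo_mem[OF CB[OF A]] bo_mem[OF CB[OF B]] SB[OF D]
    show "op_plus H A B (D f) = D (op_plus H A B f)"
      using commutantD[OF A D f] commutantD[OF B D f] f by (simp add: op_apply SA[OF D])
    show "op_mult H A B (D f) = D (op_mult H A B f)"
      using commutantD[OF A D bo_mem[OF CB[OF B] f]] commutantD[OF B D f] f by (simp add: op_apply)
    show "op_scale H c A (D f) = D (op_scale H c A f)"
      using commutantD[OF A D f] f by (simp add: op_apply SS[OF D])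
  qed (simp_all add: CB A B op_plus_bo op_mult_bo op_scale_bo)
  moreover have "op_one H \<in> commutant H S"
    by (rule commutantI) (auto simp: op_one_bo op_one_apply SB S)
  ultimately show ?thesis using commutant_bo by (auto simp: star_subalgebra_def)
qed

lemma von_neumann_commutant:
  assumes "S \<subseteq> BO" "\<And>A. A \<in> S \<Longrightarrow> op_adjoint H A \<in> S"
  shows "von_neumann_algebra H (commutant H S)"
  using star_subalgebra_commutant[OF assms] triple_commutant[OF assms(1)]
  by (simp add: von_neumann_algebra_def)

lemma commutant_adjoint:
  assumes "star_subalgebra H M" "A \<in> commutant H M"
  shows "op_adjoint H A \<in> commutant H M"
  using star_subalgebra_commutant[of M] assms by (simp add: star_subalgebra_def)

lemma von_neumann_one:
  assumes "von_neumann_algebra H M" shows "op_one H \<in> M"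
proof -
  have "op_one H \<in> commutant H (commutant H M)"
  proof (rule commutantI[OF op_one_bo commutant_bo])
    fix B f assume "B \<in> commutant H M" "f \<in> V"
    then show "op_one H (B f) = B (op_one H f)"
      using bo_mem[OF subsetD[OF commutant_bo]] by (simp add: op_one_apply)
  qed
  then show ?thesis using assms by (simp add: von_neumann_algebra_def)
qed

lemma von_neumann_BO: "von_neumann_algebra H BO"
proof -
  have "commutant H {} = BO" by (auto simp: commutant_def)
  then show ?thesis using von_neumann_commutant[of "{}"] by simp
qed

lemma vn_generated_superset: "S \<subseteq> vn_generated H S"
  by (auto simp: vn_generated_def)

lemma vn_generated_least: "\<lbrakk>von_neumann_algebra H M; S \<subseteq> M\<rbrakk> \<Longrightarrow> vn_generated H S \<subseteq> M"
  by (auto simp: vn_generated_def)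

lemma vn_generated_mono: "S \<subseteq> T \<Longrightarrow> vn_generated H S \<subseteq> vn_generated H T"
  by (auto simp: vn_generated_def)

text \<open>Algebraic closure is tested in each von Neumann algebra of the intersection. The double
  commutant is monotone, so the one of the intersection stays inside every member.\<close>

lemma von_neumann_vn_generated:
  assumes "S \<subseteq> BO"
  shows "von_neumann_algebra H (vn_generated H S)"
proof -
  let ?G = "vn_generated H S"
  have sub: "?G \<subseteq> BO" by (rule vn_generated_least[OF von_neumann_BO assms])
  have inI: "A \<in> ?G" if "\<And>M. \<lbrakk>star_subalgebra H M; op_one H \<in> M; ?G \<subseteq> M\<rbrakk> \<Longrightarrow> A \<in> M" for A
    unfolding vn_generated_def
  proof
    fix M assume "M \<in> {M. von_neumann_algebra H M \<and> S \<subseteq> M}"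
    then have M: "von_neumann_algebra H M" "S \<subseteq> M" by auto
    show "A \<in> M"
      using that[OF _ von_neumann_one[OF M(1)] vn_generated_least[OF M]] M(1)
      by (simp add: von_neumann_algebra_def)
  qed
  have "op_one H \<in> ?G" by (rule inI)
  moreover have "op_plus H A B \<in> ?G" "op_mult H A B \<in> ?G" "op_scale H c A \<in> ?G"
    "op_adjoint H A \<in> ?G" if "A \<in> ?G" "B \<in> ?G" for A B c
    using that by (auto intro!: inI simp: star_subalgebra_def subset_iff)
  ultimately have "star_subalgebra H ?G"
    using sub by (auto simp: star_subalgebra_def)
  moreover have "commutant H (commutant H ?G) \<subseteq> M" if "von_neumann_algebra H M" "S \<subseteq> M" for M
    using commutant_antimono[OF commutant_antimono[OF vn_generated_least[OF that]]] that
    by (simp add: von_neumann_algebra_def)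
  then have "commutant H (commutant H ?G) \<subseteq> ?G" by (auto simp: vn_generated_def)
  ultimately show ?thesis
    using subset_double_commutant[OF sub] by (auto simp: von_neumann_algebra_def)
qed

text \<open>A commuting set lies in its commutant, hence its double commutant also lies in the
  commutant. The generated algebra is inside the double commutant, so its elements belong to two
  sets that commute with each other.\<close>

lemma abelian_vn_generated:
  assumes "S \<subseteq> BO" "\<And>A. A \<in> S \<Longrightarrow> op_adjoint H A \<in> S" "abelian H S"
  shows "abelian H (vn_generated H S)"
proof -
  have "vn_generated H S \<subseteq> commutant H (commutant H S)"
  proof (rule vn_generated_least)
    have "op_adjoint H A \<in> commutant H S" if "A \<in> commutant H S" for A
      using star_subalgebra_commutant[OF assms(1,2)] that by (simp add: star_subalgebra_def)
    then show "von_neumann_algebra H (commutant H (commutant H S))"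
      by (intro von_neumann_commutant commutant_bo)
  qed (rule subset_double_commutant[OF assms(1)])
  moreover have "S \<subseteq> commutant H S"
    using assms(1,3) by (auto simp: commutant_def abelian_def)
  then have "commutant H (commutant H S) \<subseteq> commutant H S" by (rule commutant_antimono)
  ultimately have "A \<in> commutant H (commutant H S) \<and> A \<in> commutant H S"
    if "A \<in> vn_generated H S" for A using that by auto
  then show ?thesis unfolding abelian_def commutant_def[of H "commutant H S"] by auto
qed

lemma normal_vnorm:
  assumes T: "T \<in> BO" and f: "f \<in> V" and "T (op_adjoint H T f) = op_adjoint H T (T f)"
  shows "vnorm H (op_adjoint H T f) = vnorm H (T f)"
proof -
  have "ip H (op_adjoint H T f) (op_adjoint H T f) = ip H f (T (op_adjoint H T f))"
    using T f by (simp add: op_adjoint_ip' op_adjoint_bo bo_mem)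
  also have "\<dots> = ip H (T f) (T f)"
    using T f assms(3) by (simp add: op_adjoint_ip bo_mem)
  finally show ?thesis by (simp add: vnorm_def)
qed

text \<open>
  If \<open>x\<close> commutes with \<open>A\<close> and \<open>a\<^sub>n \<Omega> \<rightarrow> x \<Omega>\<close> with \<open>a\<^sub>n\<close> in \<open>A\<close>, then normality of
  \<open>a\<^sub>n - x\<close> also gives \<open>a\<^sub>n\<^sup>* \<Omega> \<rightarrow> x\<^sup>* \<Omega>\<close>. Both limits pass to \<open>z \<Omega>\<close> for \<open>z\<close> in the
  commutant of \<open>M\<close>, which is enough to see that \<open>x\<close> lies in the double commutant of \<open>A\<close>.
\<close>

lemma maximal_abelian_criterion:
  assumes A: "von_neumann_algebra H A" "abelian H A" "A \<subseteq> M"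
    and M: "M \<subseteq> BO"
    and \<Omega>: "\<Omega> \<in> V"
    and total: "\<And>f. \<lbrakk>f \<in> V; \<And>z. z \<in> commutant H M \<Longrightarrow> ip H f (z \<Omega>) = 0\<rbrakk> \<Longrightarrow> f = (\<lambda>_. 0)"
    and approx: "\<And>x e. \<lbrakk>x \<in> M; x \<in> commutant H A; 0 < (e::real)\<rbrakk>
      \<Longrightarrow> \<exists>a\<in>A. vnorm H (\<lambda>w. a \<Omega> w - x \<Omega> w) < e"
  shows "maximal_abelian_in H A M"
proof -
  have As: "star_subalgebra H A" and AA: "commutant H (commutant H A) = A"
    using A(1) by (auto simp: von_neumann_algebra_def)
  have ABO: "A \<subseteq> BO" using A(3) M by auto
  have "B \<subseteq> A" if B: "star_subalgebra H B" "abelian H B" "A \<subseteq> B" "B \<subseteq> M" for B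
  proof
    fix x assume x: "x \<in> B"
    have BBO: "B \<subseteq> BO" using B(4) M by auto
    have Badj: "op_adjoint H b \<in> B" if "b \<in> B" for b
      using that B(1) by (auto simp: star_subalgebra_def)
    have Bcomm: "a (b f) = b (a f)" if "a \<in> B" "b \<in> B" "f \<in> V" for a b f
    proof -
      have "op_mult H a b = op_mult H b a" using B(2) that by (auto simp: abelian_def)
      then have "op_mult H a b f = op_mult H b a f" by simp
      then show ?thesis using that by (simp add: op_mult_apply)
    qed
    \<comment> \<open>Commutation is first established on the vectors \<open>z \<Omega>\<close>
      only; adjoints extend it to all vectors afterwards.\<close>
    have key: "y (x (z \<Omega>)) = x (y (z \<Omega>))"
      if y: "y \<in> commutant H A" and z: "z \<in> commutant H M" and x: "x \<in> B" for x y z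
    proof -
      have zB: "z \<in> BO" and yB: "y \<in> BO" and xB: "x \<in> BO"
        using z y x BBO by (auto simp: commutant_def)
      have yz: "y (z \<Omega>) \<in> V" and zO: "z \<Omega> \<in> V" using zB yB \<Omega> by (auto simp: bo_mem)
      have xs: "op_adjoint H x \<in> BO" using Badj[OF x] BBO by auto
      have "ip H (y (x (z \<Omega>))) (z' \<Omega>) = ip H (x (y (z \<Omega>))) (z' \<Omega>)"
        if z': "z' \<in> commutant H M" for z'
      proof -
        have z'B: "z' \<in> BO" using z' by (auto simp: commutant_def)
        note z'O = bo_mem[OF z'B \<Omega>]
        define u where "u = op_adjoint H z' (y (z \<Omega>))"
        define v where "v = op_adjoint H z (op_adjoint H y (z' \<Omega>))"
        have uV: "u \<in> V" and vV: "v \<in> V"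
          using yz z'O by (auto simp: u_def v_def z'B zB yB op_adjoint_bo bo_mem)
        define K where "K = vnorm H u + vnorm H v"
        have K0: "K \<ge> 0" unfolding K_def using uV vV by simp
        \<comment> \<open>Since \<open>a\<close> commutes with \<open>y\<close>, replacing
          \<open>x\<close> by \<open>a\<close> leaves only the error \<open>d = a - x\<close>.
          Moving \<open>y\<close>, \<open>z\<close> and \<open>z'\<close> to the other side lets
          \<open>d\<close> or its adjoint act on \<Omega>, where both are small.\<close>
        have bound: "cmod (ip H (y (x (z \<Omega>))) (z' \<Omega>) - ip H (x (y (z \<Omega>))) (z' \<Omega>)) \<le> K * e"
          if e: "e > 0" for e
        proof -
          have "x \<in> commutant H A"
            using xB ABO B(3) x Bcomm by (intro commutantI) auto
          then obtain a where a: "a \<in> A" and ae: "vnorm H (\<lambda>w. a \<Omega> w - x \<Omega> w) < e"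
            using approx[of x e] x B(4) e by auto
          have aB: "a \<in> B" and aBO: "a \<in> BO" using a B(3) BBO by auto
          define d where "d = op_plus H a (op_scale H (-1) x)"
          have dB: "d \<in> B"
            unfolding d_def using B(1) aB x by (auto simp: star_subalgebra_def)
          have dBO: "d \<in> BO" using dB BBO by auto
          have dsB: "op_adjoint H d \<in> B" by (rule Badj[OF dB])
          have dsBO: "op_adjoint H d \<in> BO" using dsB BBO by auto
          have dap: "d f = (\<lambda>w. a f w - x f w)" if "f \<in> V" for f
            using that by (simp add: d_def op_apply)
          have dO: "vnorm H (d \<Omega>) \<le> e" using ae \<Omega> by (simp add: dap)
          have dsO: "vnorm H (op_adjoint H d \<Omega>) \<le> e"
            using normal_vnorm[OF dBO \<Omega> Bcomm[OF dB dsB \<Omega>]] dO by simp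
          have eq1: "ip H (y (x f)) g = ip H (y (a f)) g - ip H (y (d f)) g"
            if "f \<in> V" "g \<in> V" for f g
          proof -
            have "x f = (\<lambda>w. a f w + (-1) * d f w)" using that by (simp add: dap)
            then have "y (x f) = (\<lambda>w. y (a f) w + (-1) * y (d f) w)"
              using that by (simp only: bo_add[OF yB] bo_scale[OF yB] bo_mem[OF aBO] bo_mem[OF dBO]
                  scale_mem)
            then show ?thesis
              using that form_diff[of "y (a f)" "y (d f)" g]
              by (simp add: bo_mem[OF yB] bo_mem[OF aBO] bo_mem[OF dBO])
          qed
          have eq2: "ip H (x f) g = ip H (a f) g - ip H (d f) g" if "f \<in> V" "g \<in> V" for f g
          proof -
            have "x f = (\<lambda>w. a f w - d f w)" using that by (simp add: dap)
            then show ?thesis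
              using that form_diff[of "a f" "d f" g] by (simp add: bo_mem[OF aBO] bo_mem[OF dBO])
          qed
          have "ip H (y (x (z \<Omega>))) (z' \<Omega>) - ip H (x (y (z \<Omega>))) (z' \<Omega>)
             = ip H (d (y (z \<Omega>))) (z' \<Omega>) - ip H (y (d (z \<Omega>))) (z' \<Omega>)"
            using eq1[OF zO bo_mem[OF z'B \<Omega>]] eq2[OF yz bo_mem[OF z'B \<Omega>]]
              commutantD[OF y a zO] by simp
          also have "ip H (d (y (z \<Omega>))) (z' \<Omega>) = ip H u (op_adjoint H d \<Omega>)"
            using op_adjoint_ip[OF dBO yz z'O] commutantD[OF z', of "op_adjoint H d" \<Omega>]
              dsB B(4) \<Omega> yz by (auto simp: u_def op_adjoint_ip' z'B bo_mem[OF dsBO])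
          also have "ip H (y (d (z \<Omega>))) (z' \<Omega>) = ip H (d \<Omega>) v"
            using commutantD[OF z, of d \<Omega>] dB B(4) \<Omega> z'O
            by (auto simp: v_def op_adjoint_ip[symmetric] yB zB op_adjoint_bo bo_mem[OF dBO] bo_mem)
          also have "cmod (ip H u (op_adjoint H d \<Omega>) - ip H (d \<Omega>) v)
              \<le> cmod (ip H u (op_adjoint H d \<Omega>)) + cmod (ip H (d \<Omega>) v)"
            by (rule norm_triangle_ineq4)
          also have "\<dots> \<le> vnorm H u * e + e * vnorm H v"
            using ip_le[OF uV bo_mem[OF dsBO \<Omega>]] ip_le[OF bo_mem[OF dBO \<Omega>] vV]
              mult_left_mono[OF dsO vnorm_nonneg[OF uV]] mult_right_mono[OF dO vnorm_nonneg[OF vV]]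
            by linarith
          also have "\<dots> = K * e" by (simp add: K_def algebra_simps)
          finally show ?thesis .
        qed
        have "cmod (ip H (y (x (z \<Omega>))) (z' \<Omega>) - ip H (x (y (z \<Omega>))) (z' \<Omega>)) \<le> 0"
        proof (rule field_le_epsilon)
          fix e :: real assume e: "e > 0"
          have "K * (e / (K + 1)) \<le> e" using K0 e by (simp add: field_simps)
          then show "cmod (ip H (y (x (z \<Omega>))) (z' \<Omega>) - ip H (x (y (z \<Omega>))) (z' \<Omega>)) \<le> 0 + e"
            using bound[of "e / (K + 1)"] K0 e by simp
        qed
        then show ?thesis by simp
      qed
      then have "(\<lambda>w. y (x (z \<Omega>)) w - x (y (z \<Omega>)) w) = (\<lambda>_. 0)"
        using zO yz xB yB \<Omega>
        by (intro total diff_mem) (auto simp: form_diff bo_mem commutant_def)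
      then show ?thesis by (auto simp: fun_eq_iff)
    qed
    \<comment> \<open>Tested against \<open>z \<Omega>\<close>, both products move to the second
      argument as products of adjoints. There \<open>key\<close> applies, because the adjoints of
      \<open>x\<close> and \<open>y\<close> lie in \<open>B\<close> and in the commutant of
      \<open>A\<close>.\<close>
    have "x \<in> commutant H (commutant H A)"
    proof (rule commutantI[OF _ commutant_bo])
      show xB: "x \<in> BO" using x BBO by auto
      fix y f assume y: "y \<in> commutant H A" and f: "f \<in> V"
      have yB: "y \<in> BO" using y by (auto simp: commutant_def)
      note ys = commutant_adjoint[OF As y] and xs = Badj[OF x]
      have "ip H (x (y f)) (z \<Omega>) = ip H (y (x f)) (z \<Omega>)" if z: "z \<in> commutant H M" for z
      proof -
        have zO: "z \<Omega> \<in> V" using z \<Omega> by (auto simp: commutant_def bo_mem)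
        have "ip H (x (y f)) (z \<Omega>) = ip H f (op_adjoint H y (op_adjoint H x (z \<Omega>)))"
          using f zO xB yB by (simp add: op_adjoint_ip op_adjoint_bo bo_mem)
        also have "\<dots> = ip H f (op_adjoint H x (op_adjoint H y (z \<Omega>)))"
          using key[OF ys z xs] by simp
        also have "\<dots> = ip H (y (x f)) (z \<Omega>)"
          using f zO xB yB by (simp add: op_adjoint_ip op_adjoint_bo bo_mem)
        finally show ?thesis .
      qed
      then have "(\<lambda>w. x (y f) w - y (x f) w) = (\<lambda>_. 0)"
        using f xB yB \<Omega> by (intro total diff_mem) (auto simp: form_diff bo_mem commutant_def)
      then show "x (y f) = y (x f)" by (auto simp: fun_eq_iff)
    qed
    then show "x \<in> A" using AA by simp
  qed
  then show ?thesis using A As by (auto simp: maximal_abelian_in_def)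
qed

end

section \<open>The symmetrizers\<close>

locale mixed_q =
  fixes Q :: "real^'n^'n"
  assumes sym: "Q $ i $ j = Q $ j $ i"
    and range: "-1 < Q $ i $ j \<and> Q $ i $ j < 1"

definition permute_word :: "'a list \<Rightarrow> (nat \<Rightarrow> nat) \<Rightarrow> 'a list" where
  "permute_word w \<sigma> = map (\<lambda>p. w ! \<sigma> p) [0..<length w]"

text \<open>
  The functions \<open>s\<close> and \<open>t\<close> assign positions to the letters of \<open>w\<close>; every pair of letters
  that occurs in different orders for \<open>s\<close> and \<open>t\<close> contributes its entry of \<open>Q\<close> once.
\<close>

definition crossings :: "real^'n^'n \<Rightarrow> nat \<Rightarrow> 'n list \<Rightarrow> (nat \<Rightarrow> nat) \<Rightarrow> (nat \<Rightarrow> nat) \<Rightarrow> real" where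
  "crossings Q n w s t =
     (\<Prod>a<n. \<Prod>b<n. if s a < s b \<and> t b < t a then Q $ (w ! b) $ (w ! a) else 1)"

lemma length_permute_word [simp]: "length (permute_word w \<sigma>) = length w"
  by (simp add: permute_word_def)

lemma nth_permute_word [simp]: "p < length w \<Longrightarrow> permute_word w \<sigma> ! p = w ! \<sigma> p"
  by (simp add: permute_word_def)

lemma length_swap_at [simp]: "length (swap_at k w) = length w"
  by (simp add: swap_at_def)

lemma nth_swap_at:
  "\<lbrakk>Suc k < length w; a < length w\<rbrakk> \<Longrightarrow> swap_at k w ! a = w ! Transposition.transpose k (Suc k) a"
  by (simp add: swap_at_def nth_list_update Transposition.transpose_def)

subsection \<open>Inversions and reduced expressions\<close>

definition inversions :: "nat \<Rightarrow> (nat \<Rightarrow> nat) \<Rightarrow> (nat \<times> nat) set" where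
  "inversions n s = {(a, b). a < b \<and> b < n \<and> s b < s a}"

lemma finite_inversions [simp]: "finite (inversions n s)"
  by (rule finite_subset[of _ "{..<n} \<times> {..<n}"]) (auto simp: inversions_def)

lemma crossings_inversions:
  "crossings Q n w (\<lambda>a. a) s = (\<Prod>(a, b)\<in>inversions n s. Q $ (w ! b) $ (w ! a))"
proof -
  have "crossings Q n w (\<lambda>a. a) s =
      (\<Prod>x\<in>{..<n} \<times> {..<n}. if x \<in> inversions n s then Q $ (w ! snd x) $ (w ! fst x) else 1)"
    by (simp add: crossings_def prod.cartesian_product case_prod_beta inversions_def)
      (rule prod.cong, auto)
  also have "\<dots> = (\<Prod>x\<in>({..<n} \<times> {..<n}) \<inter> inversions n s. Q $ (w ! snd x) $ (w ! fst x))"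
    by (simp add: prod.inter_restrict)
  also have "({..<n} \<times> {..<n}) \<inter> inversions n s = inversions n s"
    by (auto simp: inversions_def)
  finally show ?thesis by (simp add: case_prod_beta)
qed

text \<open>The transposition preserves the order of every pair of positions except the swapped one,
  so inversions are transported and one is new. Both the length count for reduced expressions and
  the factorization of the coefficients rest on this.\<close>

lemma inversions_swap:
  assumes k: "Suc k < n" and s: "s k < s (Suc k)"
  defines "\<pi> \<equiv> Transposition.transpose k (Suc k)"
  shows "inversions n (s \<circ> \<pi>) = insert (k, Suc k) (map_prod \<pi> \<pi> ` inversions n s)"
    and "(k, Suc k) \<notin> map_prod \<pi> \<pi> ` inversions n s"
proof -
  have less: "\<pi> a < \<pi> b" if "a < b" "(a, b) \<noteq> (k, Suc k)" for a b
    using that by (auto simp: \<pi>_def Transposition.transpose_def)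
  have bound: "\<pi> a < n \<longleftrightarrow> a < n" for a
    using k by (auto simp: \<pi>_def Transposition.transpose_def)
  have inv: "\<pi> (\<pi> a) = a" for a by (simp add: \<pi>_def)
  have ks: "\<pi> k = Suc k" "\<pi> (Suc k) = k" by (simp_all add: \<pi>_def)
  show "inversions n (s \<circ> \<pi>) = insert (k, Suc k) (map_prod \<pi> \<pi> ` inversions n s)"
  proof (intro equalityI subsetI)
    fix x assume "x \<in> inversions n (s \<circ> \<pi>)"
    then obtain a b where x: "x = (a, b)" "a < b" "b < n" "s (\<pi> b) < s (\<pi> a)"
      by (auto simp: inversions_def)
    show "x \<in> insert (k, Suc k) (map_prod \<pi> \<pi> ` inversions n s)"
    proof (cases "(a, b) = (k, Suc k)")
      case False
      then have "(\<pi> a, \<pi> b) \<in> inversions n s" using x less bound by (auto simp: inversions_def)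
      then show ?thesis using x inv by (auto intro!: image_eqI[of _ _ "(\<pi> a, \<pi> b)"])
    qed (use x in auto)
  next
    fix x assume "x \<in> insert (k, Suc k) (map_prod \<pi> \<pi> ` inversions n s)"
    then consider "x = (k, Suc k)"
      | a b where "x = (\<pi> a, \<pi> b)" "a < b" "b < n" "s b < s a"
      by (auto simp: inversions_def)
    then show "x \<in> inversions n (s \<circ> \<pi>)"
    proof cases
      case 2
      then have "(a, b) \<noteq> (k, Suc k)" using s by auto
      then show ?thesis using 2 less inv bound by (auto simp: inversions_def)
    qed (use k s ks in \<open>auto simp: inversions_def\<close>)
  qed
  show "(k, Suc k) \<notin> map_prod \<pi> \<pi> ` inversions n s"
  proof
    assume "(k, Suc k) \<in> map_prod \<pi> \<pi> ` inversions n s"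
    then obtain a b where ab: "\<pi> a = k" "\<pi> b = Suc k" "a < b" by (auto simp: inversions_def)
    then have "a = Suc k" "b = k" using inv ks by metis+
    then show False using ab by simp
  qed
qed

lemma card_inversions_swap:
  assumes "Suc k < n" "s k < s (Suc k)"
  shows "card (inversions n (\<lambda>a. s (Transposition.transpose k (Suc k) a))) = Suc (card (inversions n s))"
proof -
  have "inj (map_prod (Transposition.transpose k (Suc k)) (Transposition.transpose k (Suc k)))"
    by (intro prod.inj_map) auto
  then show ?thesis
    using inversions_swap[of k n s, OF assms, unfolded o_def] by (simp add: card_image inj_on_subset)
qed

lemma crossings_swap:
  fixes Q :: "real^'n^'n"
  assumes k: "Suc k < n" and s: "s k < s (Suc k)" and w: "length w = n"
  shows "crossings Q n w (\<lambda>a. a) (\<lambda>a. s (Transposition.transpose k (Suc k) a)) =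
    Q $ (w ! Suc k) $ (w ! k) * crossings Q n (swap_at k w) (\<lambda>a. a) s"
proof -
  let ?\<pi> = "Transposition.transpose k (Suc k)"
  have inj: "inj (map_prod ?\<pi> ?\<pi>)" by (intro prod.inj_map) auto
  have "(\<Prod>(a, b)\<in>map_prod ?\<pi> ?\<pi> ` inversions n s. Q $ (w ! b) $ (w ! a)) =
      (\<Prod>(a, b)\<in>inversions n s. Q $ (w ! ?\<pi> b) $ (w ! ?\<pi> a))"
    by (subst prod.reindex) (auto intro: inj_on_subset[OF inj] simp: case_prod_beta)
  also have "\<dots> = (\<Prod>(a, b)\<in>inversions n s. Q $ (swap_at k w ! b) $ (swap_at k w ! a))"
    using k w by (intro prod.cong) (auto simp: inversions_def nth_swap_at)
  finally show ?thesis
    unfolding crossings_inversions inversions_swap(1)[of k n s, OF k s, unfolded o_def]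
    using inversions_swap(2)[of k n s, OF k s] by simp
qed

lemma permute_word_swap:
  assumes "Suc k < length w" "\<tau> permutes {..<length w}"
  shows "permute_word w (\<lambda>a. Transposition.transpose k (Suc k) (\<tau> a)) = permute_word (swap_at k w) \<tau>"
proof (rule nth_equalityI)
  fix p assume "p < length (permute_word w (\<lambda>a. Transposition.transpose k (Suc k) (\<tau> a)))"
  then show "permute_word w (\<lambda>a. Transposition.transpose k (Suc k) (\<tau> a)) ! p =
      permute_word (swap_at k w) \<tau> ! p"
    using assms permutes_in_image[OF assms(2), of p] by (simp add: nth_swap_at)
qed simp

lemma perm_expression_Cons:
  "perm_expression n \<sigma> (k # ks) \<longleftrightarrow>
     Suc k < n \<and> (\<exists>\<tau>. perm_expression n \<tau> ks \<and> \<sigma> = Transposition.transpose k (Suc k) \<circ> \<tau>)"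
  by (auto simp: perm_expression_def)

lemma inv_transpose_comp:
  assumes "\<tau> permutes S"
  shows "inv (Transposition.transpose k l \<circ> \<tau>) = (\<lambda>a. inv \<tau> (Transposition.transpose k l a))"
  using permutes_bij[OF assms] by (subst o_inv_distrib) auto

text \<open>Each letter of an expression changes the number of inversions by exactly one.\<close>

lemma perm_expression_length:
  assumes "perm_expression n \<sigma> ks"
  shows "\<sigma> permutes {..<n}" and "card (inversions n (inv \<sigma>)) \<le> length ks"
  using assms
proof (induction ks arbitrary: \<sigma>)
  case Nil
  { case 1
    then show ?case using permutes_id[unfolded id_def] by (auto simp: perm_expression_def)
  next
    case 2
    then have "\<sigma> = (\<lambda>a. a)" by (auto simp: perm_expression_def)
    moreover have "inv (\<lambda>a. a) = (\<lambda>a::nat. a)" using inv_id unfolding id_def by simp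
    moreover have "inversions n (\<lambda>a. a) = {}" by (auto simp: inversions_def)
    ultimately show ?case by simp }
next
  case (Cons k ks)
  { case 1
    then obtain \<tau> where "Suc k < n" "\<tau> permutes {..<n}"
      and \<sigma>: "\<sigma> = Transposition.transpose k (Suc k) \<circ> \<tau>"
      using Cons.IH by (auto simp: perm_expression_Cons)
    then show ?case unfolding \<sigma> by (intro permutes_compose permutes_swap_id) auto
  next
    case 2
    then obtain \<tau> where k: "Suc k < n" and \<tau>: "perm_expression n \<tau> ks"
      and \<sigma>: "\<sigma> = Transposition.transpose k (Suc k) \<circ> \<tau>" by (auto simp: perm_expression_Cons)
    let ?s = "inv \<tau>" and ?\<pi> = "Transposition.transpose k (Suc k)"
    note \<tau>p = Cons.IH(1)[OF \<tau>]
    have eq: "inv \<sigma> = (\<lambda>a. ?s (?\<pi> a))" using \<tau>p by (simp add: \<sigma> inv_transpose_comp)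
    have "?s k \<noteq> ?s (Suc k)" by (simp add: inj_eq[OF permutes_inj[OF permutes_inv[OF \<tau>p]]])
    then consider "?s k < ?s (Suc k)" | "?s (?\<pi> k) < ?s (?\<pi> (Suc k))" by force
    then show ?case
    proof cases
      case 1
      then show ?thesis
        unfolding eq list.size using card_inversions_swap[OF k 1] Cons.IH(2)[OF \<tau>] by linarith
    next
      case 2
      then show ?thesis
        unfolding eq using card_inversions_swap[of k n "\<lambda>a. ?s (?\<pi> a)", OF k 2] Cons.IH(2)[OF \<tau>]
        by simp
    qed }
qed

text \<open>In an expression as short as the inversion number, every letter creates an inversion,
  and the corresponding \<open>braid\<close> contributes the entry of \<open>Q\<close> for it. The
  result depends on \<open>\<sigma>\<close> alone, so the independence of the chosen reduced
  expression is obtained without using braid moves.\<close>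

lemma braid_perm_expression:
  fixes Q :: "real^'n^'n"
  assumes "perm_expression n \<sigma> ks" "length ks = card (inversions n (inv \<sigma>))" "length w = n"
  shows "foldr (\<lambda>k A. braid Q k \<circ> A) ks id f w =
    of_real (crossings Q n w (\<lambda>a. a) (inv \<sigma>)) * f (permute_word w \<sigma>)"
  using assms
proof (induction ks arbitrary: \<sigma> w)
  case Nil
  then have "\<sigma> = (\<lambda>a. a)" by (auto simp: perm_expression_def)
  moreover have "permute_word w (\<lambda>a. a) = w" by (simp add: permute_word_def map_nth)
  moreover have "inversions n (\<lambda>a. a) = {}" by (auto simp: inversions_def)
  moreover have "inv (\<lambda>a. a) = (\<lambda>a::nat. a)" using inv_id unfolding id_def by simp
  ultimately show ?case by (simp add: crossings_inversions)
next
  case (Cons k ks)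
  then obtain \<tau> where k: "Suc k < n" and \<tau>: "perm_expression n \<tau> ks"
    and \<sigma>: "\<sigma> = Transposition.transpose k (Suc k) \<circ> \<tau>" by (auto simp: perm_expression_Cons)
  let ?s = "inv \<tau>" and ?\<pi> = "Transposition.transpose k (Suc k)"
  note \<tau>p = perm_expression_length(1)[OF \<tau>] and le = perm_expression_length(2)[OF \<tau>]
  have eq: "inv \<sigma> = (\<lambda>a. ?s (?\<pi> a))" using \<tau>p by (simp add: \<sigma> inv_transpose_comp)
  \<comment> \<open>Otherwise \<open>\<tau>\<close> would have more inversions than
    \<open>ks\<close> has letters.\<close>
  have "?s k < ?s (Suc k)"
  proof (rule ccontr)
    assume "\<not> ?s k < ?s (Suc k)"
    moreover have "?s k \<noteq> ?s (Suc k)"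
      by (simp add: inj_eq[OF permutes_inj[OF permutes_inv[OF \<tau>p]]])
    ultimately have "card (inversions n ?s) = Suc (card (inversions n (\<lambda>a. ?s (?\<pi> a))))"
      using card_inversions_swap[OF k, of "\<lambda>a. ?s (?\<pi> a)"] by simp
    then show False using le Cons.prems(2) unfolding eq list.size by linarith
  qed
  moreover from this have "length ks = card (inversions n ?s)"
    using card_inversions_swap[OF k, of ?s] Cons.prems(2) unfolding eq list.size by linarith
  ultimately show ?case
    using Cons.IH[OF \<tau>, of "swap_at k w"] Cons.prems(3) k \<tau>p
    by (simp add: braid_def eq crossings_swap) (simp add: \<sigma> o_def permute_word_swap)
qed

text \<open>Bubble sort: a descent of the inverse is removed at the cost of one letter, and a
  permutation without descents is the identity.\<close>

lemma perm_expression_exists: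
  assumes "\<sigma> permutes {..<n}"
  shows "\<exists>ks. perm_expression n \<sigma> ks \<and> length ks = card (inversions n (inv \<sigma>))"
  using assms
proof (induction "card (inversions n (inv \<sigma>))" arbitrary: \<sigma> rule: less_induct)
  case less
  let ?s = "inv \<sigma>"
  have sp: "?s permutes {..<n}" by (rule permutes_inv[OF less.prems])
  show ?case
  proof (cases "\<exists>k. Suc k < n \<and> ?s (Suc k) < ?s k")
    case True
    then obtain k where k: "Suc k < n" "?s (Suc k) < ?s k" by auto
    let ?\<pi> = "Transposition.transpose k (Suc k)"
    define \<tau> where "\<tau> = ?\<pi> \<circ> \<sigma>"
    have \<tau>: "\<tau> permutes {..<n}"
      unfolding \<tau>_def using k less.prems by (intro permutes_compose permutes_swap_id) auto
    have inv\<tau>: "inv \<tau> = (\<lambda>a. ?s (?\<pi> a))" using less.prems by (simp add: \<tau>_def inv_transpose_comp)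
    have \<sigma>: "\<sigma> = ?\<pi> \<circ> \<tau>" by (simp add: \<tau>_def fun_eq_iff)
    have "card (inversions n ?s) = Suc (card (inversions n (inv \<tau>)))"
      using card_inversions_swap[OF k(1), of "inv \<tau>"] k by (simp add: inv\<tau>)
    moreover from this obtain ks where
      "perm_expression n \<tau> ks" "length ks = card (inversions n (inv \<tau>))"
      using less.hyps[of \<tau>] \<tau> by auto
    ultimately show ?thesis
      using k \<sigma> by (intro exI[of _ "k # ks"]) (auto simp: perm_expression_Cons)
  next
    case False
    have "p \<le> ?s p" if "p < n" for p
      using that
    proof (induction p)
      case (Suc p)
      have "?s p \<noteq> ?s (Suc p)" by (simp add: inj_eq[OF permutes_inj[OF sp]])
      then have "?s p < ?s (Suc p)" using False Suc.prems by force
      then show ?case using Suc by simp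
    qed simp
    then have "?s = id" by (intro permutes_natset_ge[OF sp]) auto
    moreover from this have "\<sigma> = id" using permutes_inv_inv[OF less.prems] by (simp add: inv_id)
    moreover have "inversions n id = {}" by (auto simp: inversions_def)
    ultimately show ?thesis
      by (intro exI[of _ "[]"]) (simp add: perm_expression_def)
  qed
qed

text \<open>Whichever reduced expression is chosen, its length is squeezed to the inversion number:
  no expression is shorter, and one of that length exists.\<close>

lemma symmetrizer_eq:
  fixes Q :: "real^'n^'n"
  assumes "length w = n"
  shows "symmetrizer Q n f w =
    (\<Sum>\<sigma> | \<sigma> permutes {..<n}. of_real (crossings Q n w (\<lambda>a. a) (inv \<sigma>)) * f (permute_word w \<sigma>))"
  unfolding symmetrizer_def
proof (intro sum.cong refl)
  fix \<sigma> assume "\<sigma> \<in> {\<sigma>. \<sigma> permutes {..<n}}"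
  then obtain ks where ks: "perm_expression n \<sigma> ks" "length ks = card (inversions n (inv \<sigma>))"
    using perm_expression_exists by auto
  then have "reduced_expression n \<sigma> ks"
    using perm_expression_length(2) by (auto simp: reduced_expression_def)
  then have red: "reduced_expression n \<sigma> (SOME ks. reduced_expression n \<sigma> ks)"
    (is "reduced_expression n \<sigma> ?ks") by (rule someI)
  then have "length ?ks \<le> length ks" "card (inversions n (inv \<sigma>)) \<le> length ?ks"
    using ks(1) perm_expression_length(2)[of n \<sigma> ?ks] by (auto simp: reduced_expression_def)
  then have "length ?ks = card (inversions n (inv \<sigma>))" using ks(2) by simp
  moreover have "perm_expression n \<sigma> ?ks" using red by (simp only: reduced_expression_def)
  ultimately show "braid_perm Q n \<sigma> f w =
      of_real (crossings Q n w (\<lambda>a. a) (inv \<sigma>)) * f (permute_word w \<sigma>)"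
    unfolding braid_perm_def using assms by (intro braid_perm_expression)
qed

subsection \<open>The recursion for the symmetrizers\<close>

text \<open>The annihilation formula read on coefficients: the value at a word collects
  \<open>f\<close> at all words obtained by inserting \<open>i\<close>, with one entry of
  \<open>Q\<close> for every letter that stands before the insertion.\<close>

fun ann :: "real^'n^'n \<Rightarrow> 'n \<Rightarrow> ('n list \<Rightarrow> complex) \<Rightarrow> 'n list \<Rightarrow> complex" where
  "ann Q i f [] = f [i]"
| "ann Q i f (j # v) = f (i # j # v) + of_real (Q $ i $ j) * ann Q i (\<lambda>u. f (j # u)) v"

lemma ann_eq_sum:
  "ann Q i f v = (\<Sum>k\<le>length v. of_real (\<Prod>j<k. Q $ i $ (v ! j)) * f (take k v @ i # drop k v))"
proof (induction v arbitrary: f)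
  case (Cons j v)
  show ?case
    by (simp add: Cons.IH sum.atMost_Suc_shift prod.lessThan_Suc_shift sum_distrib_left mult.assoc
        del: sum.atMost_Suc prod.lessThan_Suc)
qed simp

text \<open>
  A permutation \<open>\<sigma>\<close> of the letters of \<open>w\<close> is encoded as the list \<open>xs\<close> of its values.
\<close>

definition list_crossings :: "real^'n^'n \<Rightarrow> 'n list \<Rightarrow> nat list \<Rightarrow> real" where
  "list_crossings Q w xs = (\<Prod>p<length xs. \<Prod>p'<length xs.
     if p < p' \<and> xs ! p' < xs ! p then Q $ (w ! (xs ! p)) $ (w ! (xs ! p')) else 1)"

lemma list_crossings_Nil [simp]: "list_crossings Q w [] = 1"
  by (simp add: list_crossings_def)

lemma list_crossings_Cons:
  "list_crossings Q w (x # xs) =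
     prod_list (map (\<lambda>y. if y < x then Q $ (w ! x) $ (w ! y) else 1) xs) * list_crossings Q w xs"
  by (simp add: list_crossings_def prod.lessThan_Suc_shift prod.list_conv_set_nth atLeast0LessThan
      del: prod.lessThan_Suc cong: if_cong)

lemma crossings_eq_list_crossings:
  assumes "\<sigma> permutes {..<n}"
  shows "crossings Q n w (\<lambda>a. a) (inv \<sigma>) = list_crossings Q w (map \<sigma> [0..<n])"
proof -
  have "crossings Q n w (\<lambda>a. a) (inv \<sigma>) = (\<Prod>p'<n. \<Prod>p<n.
      if \<sigma> p' < \<sigma> p \<and> inv \<sigma> (\<sigma> p) < inv \<sigma> (\<sigma> p')
      then Q $ (w ! \<sigma> p) $ (w ! \<sigma> p') else 1)"
    unfolding crossings_def
    by (subst prod.permute[OF assms], unfold o_def, subst prod.permute[OF assms], unfold o_def, rule refl)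
  also have "\<dots> = (\<Prod>p<n. \<Prod>p'<n.
      if p < p' \<and> \<sigma> p' < \<sigma> p then Q $ (w ! \<sigma> p) $ (w ! \<sigma> p') else 1)"
    by (subst prod.swap) (simp add: permutes_inverses[OF assms] conj_commute)
  also have "\<dots> = list_crossings Q w (map \<sigma> [0..<n])"
    by (simp add: list_crossings_def cong: if_cong)
  finally show ?thesis .
qed

definition orderings :: "nat \<Rightarrow> nat list set" where
  "orderings n = {xs. distinct xs \<and> set xs = {..<n}}"

lemma length_orderings: "xs \<in> orderings n \<Longrightarrow> length xs = n"
  unfolding orderings_def using distinct_card by fastforce

lemma bij_betw_orderings:
  "bij_betw (\<lambda>\<sigma>. map \<sigma> [0..<n]) {\<sigma>. \<sigma> permutes {..<n}} (orderings n)"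
proof (rule bij_betwI')
  fix \<sigma> \<tau> assume s: "\<sigma> \<in> {\<sigma>. \<sigma> permutes {..<n}}" "\<tau> \<in> {\<sigma>. \<sigma> permutes {..<n}}"
  show "(map \<sigma> [0..<n] = map \<tau> [0..<n]) = (\<sigma> = \<tau>)"
  proof
    assume eq: "map \<sigma> [0..<n] = map \<tau> [0..<n]"
    show "\<sigma> = \<tau>"
    proof
      fix p show "\<sigma> p = \<tau> p"
        using eq s permutes_not_in[of \<sigma> "{..<n}" p] permutes_not_in[of \<tau> "{..<n}" p]
        by (cases "p < n") auto
    qed
  qed simp
next
  fix \<sigma> assume "\<sigma> \<in> {\<sigma>. \<sigma> permutes {..<n}}"
  then have s: "\<sigma> permutes {..<n}" by simp
  show "map \<sigma> [0..<n] \<in> orderings n"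
    using permutes_inj_on[OF s] permutes_image[OF s]
    by (auto simp: orderings_def distinct_map atLeast0LessThan)
next
  fix xs assume xs: "xs \<in> orderings n"
  define \<sigma> where "\<sigma> p = (if p < n then xs ! p else p)" for p
  have "bij_betw (\<lambda>p. xs ! p) {..<n} {..<n}"
    using bij_betw_nth[of xs "{..<n}" "{..<n}"] xs length_orderings[OF xs]
    by (auto simp: orderings_def)
  then have "bij_betw \<sigma> {..<n} {..<n}" by (rule bij_betw_cong[THEN iffD1, rotated]) (simp add: \<sigma>_def)
  then have "\<sigma> permutes {..<n}" by (rule bij_imp_permutes) (simp add: \<sigma>_def)
  moreover have "xs = map \<sigma> [0..<n]"
    using length_orderings[OF xs] by (intro nth_equalityI) (auto simp: \<sigma>_def)
  ultimately show "\<exists>\<sigma>\<in>{\<sigma>. \<sigma> permutes {..<n}}. xs = map \<sigma> [0..<n]" by auto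
qed

lemma symmetrizer_orderings:
  fixes Q :: "real^'n^'n"
  assumes "length w = n"
  shows "symmetrizer Q n f w =
    (\<Sum>xs\<in>orderings n. of_real (list_crossings Q w xs) * f (map (\<lambda>a. w ! a) xs))"
proof -
  have "symmetrizer Q n f w = (\<Sum>\<sigma> | \<sigma> permutes {..<n}.
      of_real (list_crossings Q w (map \<sigma> [0..<n])) * f (map (\<lambda>a. w ! a) (map \<sigma> [0..<n])))"
    unfolding symmetrizer_eq[OF assms]
    by (rule sum.cong) (auto simp: crossings_eq_list_crossings permute_word_def assms o_def)
  also have "\<dots> = (\<Sum>xs\<in>orderings n. of_real (list_crossings Q w xs) * f (map (\<lambda>a. w ! a) xs))"
    by (rule sum.reindex_bij_betw[OF bij_betw_orderings])
  finally show ?thesis .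
qed

definition insert_zero :: "nat \<Rightarrow> nat list \<Rightarrow> nat list" where
  "insert_zero k xs = map Suc (take k xs) @ 0 # map Suc (drop k xs)"

text \<open>Label 0 stands for the first letter of the word; an ordering is determined by the place
  of this label and the ordering of the rest. This is the coset decomposition of the symmetric group
  behind the recursion for the symmetrizers.\<close>

lemma sum_orderings_Suc:
  "(\<Sum>ys\<in>orderings (Suc n). F ys) = (\<Sum>xs\<in>orderings n. \<Sum>k\<le>n. F (insert_zero k xs))"
proof -
  let ?del = "\<lambda>ys. map (\<lambda>x. x - 1) (filter (\<lambda>x. x \<noteq> 0) ys)"
  have "(\<Sum>(xs, k)\<in>orderings n \<times> {..n}. F (insert_zero k xs)) = (\<Sum>ys\<in>orderings (Suc n). F ys)"
  proof (rule sum.reindex_bij_witness[where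
        i = "\<lambda>ys. (?del ys, length (takeWhile (\<lambda>x. x \<noteq> 0) ys))"
        and j = "\<lambda>(xs, k). insert_zero k xs"])
    fix x assume "x \<in> orderings n \<times> {..n}"
    then obtain xs k where x: "x = (xs, k)" and xs: "xs \<in> orderings n" and k: "k \<le> n" by auto
    have tw: "takeWhile (\<lambda>x. 0 < x) (map Suc as @ 0 # bs) = map Suc as" for as bs
      by (induction as) auto
    have fl: "filter (\<lambda>x. 0 < x) (map Suc as) = map Suc as" for as
      by (induction as) auto
    show "(\<lambda>ys. (?del ys, length (takeWhile (\<lambda>x. x \<noteq> 0) ys))) (case x of (xs, k) \<Rightarrow> insert_zero k xs) = x"
      using k length_orderings[OF xs]
      by (simp add: x insert_zero_def tw fl o_def flip: map_append)
    have "set (take k xs) \<union> set (drop k xs) = {..<n}"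
      using xs by (simp add: orderings_def flip: set_append)
    then have "Suc ` set (take k xs) \<union> Suc ` set (drop k xs) = Suc ` {..<n}" by blast
    moreover have "set (take k xs) \<inter> set (drop k xs) = {}"
      using xs by (auto simp: orderings_def dest: set_take_disj_set_drop_if_distinct[of xs k k])
    ultimately show "(case x of (xs, k) \<Rightarrow> insert_zero k xs) \<in> orderings (Suc n)"
      using xs by (auto simp: x insert_zero_def orderings_def distinct_map lessThan_Suc_eq_insert_0)
  next
    fix ys assume ys: "ys \<in> orderings (Suc n)"
    then have "0 \<in> set ys" by (simp add: orderings_def)
    then obtain as bs where ys_eq: "ys = as @ 0 # bs" and as: "0 \<notin> set as"
      using split_list_first by metis
    have bs: "0 \<notin> set bs" using ys by (auto simp: orderings_def ys_eq)
    have tw: "takeWhile (\<lambda>x. x \<noteq> 0) ys = as" using as by (auto simp: ys_eq takeWhile_append)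
    have "filter (\<lambda>x. x \<noteq> 0) as = as" "filter (\<lambda>x. x \<noteq> 0) bs = bs"
      using as bs unfolding filter_id_conv by metis+
    then have fl: "filter (\<lambda>x. x \<noteq> 0) ys = as @ bs" by (simp add: ys_eq)
    have Suc: "map (\<lambda>x. Suc (x - 1)) cs = cs" if "0 \<notin> set cs" for cs
      using that by (induction cs) auto
    show "(case (?del ys, length (takeWhile (\<lambda>x. x \<noteq> 0) ys)) of (xs, k) \<Rightarrow> insert_zero k xs) = ys"
      unfolding tw fl using as bs Suc[of as] Suc[of bs] by (simp add: insert_zero_def ys_eq o_def)
    have "inj_on (\<lambda>x. x - 1) (set (as @ bs))"
    proof (rule inj_onI)
      fix x y :: nat
      assume xy: "x \<in> set (as @ bs)" "y \<in> set (as @ bs)" "x - 1 = y - 1"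
      then have "x \<noteq> 0" "y \<noteq> 0" using as bs by (auto intro: ccontr)
      then show "x = y" using xy(3) by simp
    qed
    moreover have "distinct (as @ bs)" using ys by (auto simp: orderings_def ys_eq)
    moreover have "insert 0 (set (as @ bs)) = insert 0 (Suc ` {..<n})"
      using ys by (auto simp: orderings_def ys_eq lessThan_Suc_eq_insert_0)
    then have "set (as @ bs) = Suc ` {..<n}"
      using as bs by (subst (asm) insert_ident) auto
    moreover have "(\<lambda>x. x - 1) ` Suc ` {..<n} = {..<n}" by (simp add: image_image)
    ultimately have "?del ys \<in> orderings n"
      unfolding fl orderings_def mem_Collect_eq distinct_map set_map by metis
    moreover have "length as \<le> n" using length_orderings[OF ys] by (simp add: ys_eq)
    ultimately show "(?del ys, length (takeWhile (\<lambda>x. x \<noteq> 0) ys)) \<in> orderings n \<times> {..n}"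
      unfolding tw by simp
  qed auto
  then show ?thesis by (simp add: sum.cartesian_product)
qed

text \<open>Label 0 is the smallest, so it is inverted exactly with the labels in front of
  it.\<close>

lemma list_crossings_insert_zero:
  "list_crossings Q (i # u) (map Suc as @ 0 # map Suc bs) =
     prod_list (map (\<lambda>x. Q $ (u ! x) $ i) as) * list_crossings Q u (as @ bs)"
proof (induction as)
  case Nil
  have "list_crossings Q (i # u) (map Suc bs) = list_crossings Q u bs"
    by (induction bs) (simp_all add: list_crossings_Cons o_def cong: if_cong)
  moreover have "prod_list (map (\<lambda>y. 1) bs) = (1::real)" by (induction bs) auto
  ultimately show ?case by (simp add: list_crossings_Cons o_def)
next
  case (Cons a as)
  then show ?case by (simp add: list_crossings_Cons o_def mult_ac cong: if_cong)
qed

context mixed_q begin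

text \<open>For a fixed ordering of the letters of \<open>u\<close>, the sum over the places of
  \<open>i\<close> is the value of \<open>ann\<close>. This factorization is what makes
  \<open>ann\<close> adjoint to creation for the deformed inner product.\<close>

lemma symmetrizer_Cons:
  assumes u: "length u = n"
  shows "symmetrizer Q (Suc n) f (i # u) = symmetrizer Q n (ann Q i f) u"
proof -
  have *: "list_crossings Q (i # u) (insert_zero k xs) =
      (\<Prod>j<k. Q $ i $ (map (\<lambda>a. u ! a) xs ! j)) * list_crossings Q u xs"
    if xs: "xs \<in> orderings n" and k: "k \<le> n" for xs k
  proof -
    have "prod_list (map (\<lambda>x. Q $ (u ! x) $ i) (take k xs)) =
        (\<Prod>j<k. Q $ i $ (map (\<lambda>a. u ! a) xs ! j))"
      using k length_orderings[OF xs]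
      by (simp add: prod.list_conv_set_nth atLeast0LessThan sym[of _ i])
    then show ?thesis by (simp add: insert_zero_def list_crossings_insert_zero)
  qed
  have "symmetrizer Q (Suc n) f (i # u) = (\<Sum>xs\<in>orderings n. \<Sum>k\<le>n.
      of_real (list_crossings Q (i # u) (insert_zero k xs)) *
      f (map (\<lambda>a. (i # u) ! a) (insert_zero k xs)))"
    using u by (simp add: symmetrizer_orderings sum_orderings_Suc)
  also have "\<dots> = (\<Sum>xs\<in>orderings n.
      of_real (list_crossings Q u xs) * ann Q i f (map (\<lambda>a. u ! a) xs))"
  proof (intro sum.cong refl)
    fix xs assume xs: "xs \<in> orderings n"
    have "map (\<lambda>a. (i # u) ! a) (insert_zero k xs) =
        take k (map (\<lambda>a. u ! a) xs) @ i # drop k (map (\<lambda>a. u ! a) xs)" for k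
      by (simp add: insert_zero_def o_def take_map drop_map)
    then show "(\<Sum>k\<le>n. of_real (list_crossings Q (i # u) (insert_zero k xs)) *
          f (map (\<lambda>a. (i # u) ! a) (insert_zero k xs))) =
        of_real (list_crossings Q u xs) * ann Q i f (map (\<lambda>a. u ! a) xs)"
      using length_orderings[OF xs] unfolding ann_eq_sum sum_distrib_left
      by (intro sum.cong) (auto simp: *[OF xs] mult_ac)
  qed
  finally show ?thesis using u by (simp add: symmetrizer_orderings)
qed

end

subsection \<open>Positivity\<close>

text \<open>
  A kernel that is a sum of a nonnegative multiple of an equivalence kernel with two classes
  and of a rank one kernel preserves positivity under entrywise multiplication; this is the
  case of the Schur product theorem needed here.
\<close>

definition kernel_form :: "'x set \<Rightarrow> ('x \<Rightarrow> 'x \<Rightarrow> real) \<Rightarrow> ('x \<Rightarrow> complex) \<Rightarrow> real" where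
  "kernel_form X K \<phi> = Re (\<Sum>x\<in>X. \<Sum>y\<in>X. \<phi> x * cnj (\<phi> y) * of_real (K x y))"

text \<open>In the first case the vector is cut along the two classes of \<open>g\<close>; in the
  second the rank one factor is absorbed into the vector.\<close>

lemma kernel_form_mult:
  fixes K :: "'x \<Rightarrow> 'x \<Rightarrow> real" and g :: "'x \<Rightarrow> bool"
  assumes "\<And>\<phi>. 0 \<le> kernel_form X K \<phi>"
  shows "0 \<le> kernel_form X (\<lambda>x y. if g x = g y then K x y else 0) \<phi>"
    and "0 \<le> kernel_form X (\<lambda>x y. K x y * (s x * s y)) \<phi>"
proof -
  have "kernel_form X (\<lambda>x y. if g x = g y then K x y else 0) \<phi> =
      kernel_form X K (\<lambda>x. if g x then \<phi> x else 0) + kernel_form X K (\<lambda>x. if g x then 0 else \<phi> x)"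
    unfolding kernel_form_def plus_complex.sel(1)[symmetric] sum.distrib[symmetric]
    by (intro arg_cong[of _ _ Re] sum.cong refl) auto
  then show "0 \<le> kernel_form X (\<lambda>x y. if g x = g y then K x y else 0) \<phi>"
    using assms by simp
  have "kernel_form X (\<lambda>x y. K x y * (s x * s y)) \<phi> = kernel_form X K (\<lambda>x. of_real (s x) * \<phi> x)"
    unfolding kernel_form_def by (intro arg_cong[of _ _ Re] sum.cong refl) simp
  then show "0 \<le> kernel_form X (\<lambda>x y. K x y * (s x * s y)) \<phi>" using assms by simp
qed

lemma kernel_form_add: "kernel_form X (\<lambda>x y. a * K x y + b * L x y) \<phi> =
    a * kernel_form X K \<phi> + b * kernel_form X L \<phi>"
proof -
  have "kernel_form X (\<lambda>x y. a * K x y + b * L x y) \<phi> =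
     Re (of_real a * (\<Sum>x\<in>X. \<Sum>y\<in>X. \<phi> x * cnj (\<phi> y) * of_real (K x y))
       + of_real b * (\<Sum>x\<in>X. \<Sum>y\<in>X. \<phi> x * cnj (\<phi> y) * of_real (L x y)))"
    unfolding kernel_form_def sum_distrib_left sum.distrib[symmetric]
    by (intro arg_cong[of _ _ Re] sum.cong refl) (simp add: algebra_simps)
  then show ?thesis by (simp add: kernel_form_def)
qed

text \<open>Each factor of \<open>K\<close> is a nonnegative combination of a two-class kernel and a
  rank one kernel. Taking the two-class summand in every factor produces the subtracted multiple of
  \<open>E\<close>, and everything else is positive. This explicit remainder is what later yields
  strict positivity.\<close>

lemma kernel_form_prod:
  fixes q :: "'p \<Rightarrow> real" and g :: "'p \<Rightarrow> 'x \<Rightarrow> bool"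
  assumes "finite P" "\<And>p. p \<in> P \<Longrightarrow> \<bar>q p\<bar> \<le> 1"
  defines "K \<equiv> \<lambda>P x y. \<Prod>p\<in>P. if g p x = g p y then 1 else q p"
    and "E \<equiv> \<lambda>P x y. if \<forall>p\<in>P. g p x = g p y then 1 else 0"
  shows "0 \<le> kernel_form X (\<lambda>x y. K P x y - (\<Prod>p\<in>P. 1 - \<bar>q p\<bar>) * E P x y) \<phi> \<and>
    0 \<le> kernel_form X (K P) \<phi>"
  using assms(1,2)
proof (induction P arbitrary: \<phi> rule: finite_induct)
  case empty
  have "kernel_form X (\<lambda>x y. 1) \<phi> = Re ((\<Sum>x\<in>X. \<phi> x) * cnj (\<Sum>x\<in>X. \<phi> x))"
    by (simp add: kernel_form_def sum_product)
  moreover have "0 \<le> Re (z * cnj z)" for z by simp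
  ultimately have "0 \<le> kernel_form X (\<lambda>x y. 1) \<phi>" by metis
  moreover have "kernel_form X (\<lambda>x y. 0) \<phi> = 0" by (simp add: kernel_form_def)
  ultimately show ?case by (simp add: K_def E_def)
next
  case (insert p P)
  \<comment> \<open>The signs are chosen so that \<open>\<bar>q p\<bar> * (s x * s y)\<close> equals
    \<open>q p\<close> when \<open>x\<close> and \<open>y\<close> disagree at \<open>p\<close>, and
    \<open>\<bar>q p\<bar>\<close> when they agree.\<close>
  define s where "s x = (if g p x then 1 else if q p \<ge> 0 then 1 else - 1 :: real)" for x
  have le: "\<bar>q p\<bar> \<le> 1" using insert.prems by simp
  have factor: "(if g p x = g p y then 1 else q p) =
      (1 - \<bar>q p\<bar>) * (if g p x = g p y then 1 else 0) + \<bar>q p\<bar> * (s x * s y)" for x y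
    by (auto simp: s_def)
  let ?D = "\<lambda>x y. K P x y - (\<Prod>p\<in>P. 1 - \<bar>q p\<bar>) * E P x y"
  have IH: "0 \<le> kernel_form X ?D \<phi>" "0 \<le> kernel_form X (K P) \<phi>" for \<phi>
    using insert.IH[of \<phi>] insert.prems by auto
  have Kp: "K (insert p P) = (\<lambda>x y. (1 - \<bar>q p\<bar>) * (if g p x = g p y then K P x y else 0)
      + \<bar>q p\<bar> * (K P x y * (s x * s y)))"
    using insert.hyps by (auto simp: fun_eq_iff K_def factor algebra_simps simp del: if_cancel)
  have "0 \<le> kernel_form X (K (insert p P)) \<phi>"
    unfolding Kp kernel_form_add
    using le kernel_form_mult[of X "K P", OF IH(2)] by (intro add_nonneg_nonneg mult_nonneg_nonneg) auto
  moreover have Dp: "(\<lambda>x y. K (insert p P) x y - (\<Prod>p\<in>insert p P. 1 - \<bar>q p\<bar>) * E (insert p P) x y) =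
      (\<lambda>x y. (1 - \<bar>q p\<bar>) * (if g p x = g p y then ?D x y else 0)
      + \<bar>q p\<bar> * (K P x y * (s x * s y)))"
    unfolding Kp using insert.hyps by (auto simp: fun_eq_iff E_def algebra_simps)
  have "0 \<le> kernel_form X (\<lambda>x y. K (insert p P) x y
      - (\<Prod>p\<in>insert p P. 1 - \<bar>q p\<bar>) * E (insert p P) x y) \<phi>"
    unfolding Dp kernel_form_add
    using le kernel_form_mult(1)[of X ?D, OF IH(1)] kernel_form_mult(2)[of X "K P", OF IH(2)]
    by (intro add_nonneg_nonneg mult_nonneg_nonneg) auto
  ultimately show ?case by simp
qed

section \<open>The inner product as a sum over pairs of arrangements\<close>

abbreviation perms :: "nat \<Rightarrow> (nat \<Rightarrow> nat) set" where
  "perms n \<equiv> {\<sigma>. \<sigma> permutes {..<n}}"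

lemma permute_word_comp:
  assumes "\<sigma> permutes {..<length w}"
  shows "permute_word (permute_word w \<tau>) \<sigma> = permute_word w (\<tau> \<circ> \<sigma>)"
proof (rule nth_equalityI)
  fix p assume "p < length (permute_word (permute_word w \<tau>) \<sigma>)"
  then show "permute_word (permute_word w \<tau>) \<sigma> ! p = permute_word w (\<tau> \<circ> \<sigma>) ! p"
    using permutes_in_image[OF assms, of p] by simp
qed simp

lemma permute_word_id: "permute_word w (\<lambda>a. a) = w"
  by (simp add: permute_word_def map_nth)

lemma bij_betw_permute_word:
  assumes \<tau>: "\<tau> permutes {..<n}"
  shows "bij_betw (\<lambda>w. permute_word w \<tau>) {w. length w = n} {w. length w = n}"
proof (rule bij_betw_byWitness[where f' = "\<lambda>w. permute_word w (inv \<tau>)"])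
  have "\<tau> \<circ> inv \<tau> = (\<lambda>a. a)" "inv \<tau> \<circ> \<tau> = (\<lambda>a. a)"
    using permutes_inverses[OF \<tau>] by (auto simp: fun_eq_iff)
  then show "\<forall>w\<in>{w. length w = n}. permute_word (permute_word w \<tau>) (inv \<tau>) = w"
    "\<forall>w\<in>{w. length w = n}. permute_word (permute_word w (inv \<tau>)) \<tau> = w"
    using \<tau> permutes_inv[OF \<tau>] by (auto simp: permute_word_comp permute_word_id)
qed auto

lemma crossings_permute_word:
  fixes Q :: "real^'n^'n"
  assumes \<tau>: "\<tau> permutes {..<n}" and w: "length w = n"
  shows "crossings Q n (permute_word w \<tau>) s t =
    crossings Q n w (\<lambda>a. s (inv \<tau> a)) (\<lambda>a. t (inv \<tau> a))"
proof -
  have "crossings Q n (permute_word w \<tau>) s t = (\<Prod>a<n. \<Prod>b<n.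
      if s a < s b \<and> t b < t a then Q $ (w ! \<tau> b) $ (w ! \<tau> a) else 1)"
    using w by (simp add: crossings_def cong: if_cong)
  also have "\<dots> = crossings Q n w (\<lambda>a. s (inv \<tau> a)) (\<lambda>a. t (inv \<tau> a))"
    unfolding crossings_def
    by (subst (2) prod.permute[OF \<tau>], unfold o_def, subst (2) prod.permute[OF \<tau>], unfold o_def)
      (simp add: permutes_inverses[OF \<tau>])
  finally show ?thesis .
qed

lemma length_finite [simp]: "finite {w :: 'n::finite list. length w = n}"
  using finite_lists_length_eq[of "UNIV :: 'n set" n] by simp

context mixed_q begin

lemma crossings_commute: "crossings Q n w s t = crossings Q n w t s"
  unfolding crossings_def
  by (subst prod.swap) (auto intro!: prod.cong simp: sym)

text \<open>
  Averaging over all arrangements \<open>\<sigma>\<close> makes the kernel symmetric in \<open>\<sigma>\<close> and \<open>\<tau>\<close>, so that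
  hermitian symmetry, positivity and invariance under reversal of words can be read off.
\<close>

lemma level_ip_eq:
  "of_nat (fact n) * level_ip Q n f g = (\<Sum>w | length w = n.
    \<Sum>\<sigma>\<in>perms n. \<Sum>\<tau>\<in>perms n.
      f (permute_word w \<sigma>) * cnj (g (permute_word w \<tau>)) * of_real (crossings Q n w (inv \<sigma>) (inv \<tau>)))"
proof -
  have *: "level_ip Q n f g = (\<Sum>w | length w = n. \<Sum>\<tau>\<in>perms n.
      f (permute_word w \<sigma>) * cnj (g (permute_word w \<tau>)) * of_real (crossings Q n w (inv \<sigma>) (inv \<tau>)))"
    if \<sigma>: "\<sigma> permutes {..<n}" for \<sigma>
  proof -
    have "level_ip Q n f g = (\<Sum>w | length w = n. f (permute_word w \<sigma>) *
        cnj (symmetrizer Q n g (permute_word w \<sigma>)))"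
      unfolding level_ip_def tensor_ip_def
      by (rule sum.reindex_bij_betw[OF bij_betw_permute_word[OF \<sigma>], symmetric])
    also have "\<dots> = (\<Sum>w | length w = n. \<Sum>\<tau>\<in>perms n.
      f (permute_word w \<sigma>) * cnj (g (permute_word w \<tau>)) * of_real (crossings Q n w (inv \<sigma>) (inv \<tau>)))"
    proof (intro sum.cong refl)
      fix w :: "'n list" assume "w \<in> {w. length w = n}"
      then have w: "length w = n" by simp
      have "f (permute_word w \<sigma>) * cnj (symmetrizer Q n g (permute_word w \<sigma>)) =
        (\<Sum>\<rho>\<in>perms n. f (permute_word w \<sigma>) * cnj (g (permute_word w (\<sigma> \<circ> \<rho>))) *
          of_real (crossings Q n w (inv \<sigma>) (inv (\<sigma> \<circ> \<rho>))))"
        using w unfolding symmetrizer_eq[of "permute_word w \<sigma>" n, simplified, OF w] cnj_sum sum_distrib_left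
      proof (intro sum.cong refl)
        fix \<rho> assume "\<rho> \<in> perms n"
        then have \<rho>: "\<rho> permutes {..<n}" by simp
        have "inv (\<sigma> \<circ> \<rho>) = inv \<rho> \<circ> inv \<sigma>"
          by (rule o_inv_distrib[OF permutes_bij[OF \<sigma>] permutes_bij[OF \<rho>]])
        then show "f (permute_word w \<sigma>) * cnj (of_real (crossings Q n (permute_word w \<sigma>) (\<lambda>a. a) (inv \<rho>))
              * g (permute_word (permute_word w \<sigma>) \<rho>)) =
            f (permute_word w \<sigma>) * cnj (g (permute_word w (\<sigma> \<circ> \<rho>))) *
            of_real (crossings Q n w (inv \<sigma>) (inv (\<sigma> \<circ> \<rho>)))"
          using crossings_permute_word[OF \<sigma> w, of Q "\<lambda>a. a" "inv \<rho>"] permute_word_comp[of \<rho> w \<sigma>] \<rho> w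
          by (simp add: o_def mult_ac)
      qed
      also have "\<dots> = (\<Sum>\<tau>\<in>perms n. f (permute_word w \<sigma>) *
          cnj (g (permute_word w \<tau>)) * of_real (crossings Q n w (inv \<sigma>) (inv \<tau>)))"
        by (rule setum_permutations_compose_left[OF \<sigma>, symmetric, where f = "\<lambda>\<tau>. f (permute_word w \<sigma>) *
          cnj (g (permute_word w \<tau>)) * of_real (crossings Q n w (inv \<sigma>) (inv \<tau>))"])
      finally show "f (permute_word w \<sigma>) * cnj (symmetrizer Q n g (permute_word w \<sigma>)) =
        (\<Sum>\<tau>\<in>perms n. f (permute_word w \<sigma>) *
          cnj (g (permute_word w \<tau>)) * of_real (crossings Q n w (inv \<sigma>) (inv \<tau>)))" .
    qed
    finally show ?thesis .
  qed
  have "of_nat (fact n) * level_ip Q n f g = (\<Sum>\<sigma>\<in>perms n. level_ip Q n f g)"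
    by (simp add: card_permutations)
  also have "\<dots> = (\<Sum>\<sigma>\<in>perms n. \<Sum>w | length w = n. \<Sum>\<tau>\<in>perms n.
      f (permute_word w \<sigma>) * cnj (g (permute_word w \<tau>)) * of_real (crossings Q n w (inv \<sigma>) (inv \<tau>)))"
    using * by (intro sum.cong) auto
  finally show ?thesis by (subst sum.swap)
qed

lemma level_ip_cnj: "level_ip Q n g f = cnj (level_ip Q n f g)"
proof -
  have "of_nat (fact n) * cnj (level_ip Q n f g) = cnj (of_nat (fact n) * level_ip Q n f g)" by simp
  also have "\<dots> = of_nat (fact n) * level_ip Q n g f"
    unfolding level_ip_eq cnj_sum
    by (rule sum.cong[OF refl], subst sum.swap)
      (simp add: crossings_commute[of _ _ "inv _" "inv _"] mult_ac)
  finally show ?thesis by simp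
qed

lemma prod_square_split:
  fixes G :: "nat \<Rightarrow> nat \<Rightarrow> real"
  assumes "\<And>a. G a a = 1"
  shows "(\<Prod>a<n. \<Prod>b<n. G a b) = (\<Prod>b<n. \<Prod>a<b. G a b * G b a)"
proof (induction n)
  case (Suc n)
  then show ?case using assms by (simp add: prod.distrib mult_ac)
qed simp

text \<open>Symmetry of \<open>Q\<close> lets the two orders of a pair of labels share one factor.
  This gives the shape that \<open>kernel_form_prod\<close> treats, with one index per unordered
  pair.\<close>

lemma crossings_pairs:
  assumes "inj s" "inj t"
  shows "crossings Q n w s t =
    (\<Prod>p\<in>(SIGMA b:{..<n}. {..<b}). if (s (snd p) < s (fst p)) = (t (snd p) < t (fst p)) then 1
      else Q $ (w ! fst p) $ (w ! snd p))"
proof -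
  have "crossings Q n w s t = (\<Prod>b<n. \<Prod>a<b.
      (if s a < s b \<and> t b < t a then Q $ (w ! b) $ (w ! a) else 1) *
      (if s b < s a \<and> t a < t b then Q $ (w ! a) $ (w ! b) else 1))"
    unfolding crossings_def by (rule prod_square_split) simp
  also have "\<dots> = (\<Prod>b<n. \<Prod>a<b. if (s a < s b) = (t a < t b) then 1 else Q $ (w ! b) $ (w ! a))"
  proof (intro prod.cong refl)
    fix a b :: nat assume "a \<in> {..<b}"
    then have "s a \<noteq> s b" "t a \<noteq> t b" by (auto simp: inj_eq[OF assms(1)] inj_eq[OF assms(2)])
    then show "(if s a < s b \<and> t b < t a then Q $ (w ! b) $ (w ! a) else 1) *
      (if s b < s a \<and> t a < t b then Q $ (w ! a) $ (w ! b) else 1) =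
      (if (s a < s b) = (t a < t b) then 1 else Q $ (w ! b) $ (w ! a))"
      using sym[of "w ! a" "w ! b"] by (auto simp: not_less)
  qed
  also have "\<dots> = (\<Prod>p\<in>(SIGMA b:{..<n}. {..<b}). if (s (snd p) < s (fst p)) = (t (snd p) < t (fst p)) then 1
      else Q $ (w ! fst p) $ (w ! snd p))"
    by (subst prod.Sigma) (auto simp: case_prod_beta)
  finally show ?thesis .
qed

text \<open>The value at \<open>a\<close> is the number of labels with a smaller value, hence it is
  determined by the relative order. Consequently the kernel of full agreement is the identity
  matrix.\<close>

lemma permutes_eqI_order:
  assumes \<sigma>: "\<sigma> permutes {..<n}" and \<tau>: "\<tau> permutes {..<n}"
    and eq: "\<And>a b. \<lbrakk>a < b; b < n\<rbrakk> \<Longrightarrow> (\<sigma> a < \<sigma> b) = (\<tau> a < (\<tau> b :: nat))"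
  shows "\<sigma> = \<tau>"
proof -
  have rank: "card {b. b < n \<and> s b < s a} = s a" if s: "s permutes {..<n}" and a: "a < n" for s a
  proof -
    have "s ` {b. b < n \<and> s b < s a} = {..<s a}"
    proof (intro equalityI subsetI)
      fix y assume y: "y \<in> {..<s a}"
      then have "y < n" using permutes_in_image[OF s, of a] a by simp
      then have "inv s y < n" using permutes_in_image[OF permutes_inv[OF s], of y] by simp
      then show "y \<in> s ` {b. b < n \<and> s b < s a}"
        using y by (intro image_eqI[of _ _ "inv s y"]) (auto simp: permutes_inverses[OF s])
    qed auto
    moreover have "card (s ` {b. b < n \<and> s b < s a}) = card {b. b < n \<and> s b < s a}"
      by (rule card_image[OF inj_on_subset[OF permutes_inj[OF s]]]) simp
    ultimately show ?thesis by simp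
  qed
  have eq': "(\<sigma> b < \<sigma> a) = (\<tau> b < \<tau> a)" if "a < n" "b < n" for a b
  proof (cases a b rule: linorder_cases)
    case less
    then have "\<sigma> a \<noteq> \<sigma> b" "\<tau> a \<noteq> \<tau> b"
      by (auto simp: inj_eq[OF permutes_inj[OF \<sigma>]] inj_eq[OF permutes_inj[OF \<tau>]])
    then show ?thesis using eq[OF less \<open>b < n\<close>] by linarith
  next
    case greater
    then show ?thesis using eq[OF greater \<open>a < n\<close>] by simp
  qed simp
  show ?thesis
  proof
    fix a show "\<sigma> a = \<tau> a"
    proof (cases "a < n")
      case True
      then have "{b. b < n \<and> \<sigma> b < \<sigma> a} = {b. b < n \<and> \<tau> b < \<tau> a}" using eq' by auto
      then show ?thesis using rank[OF \<sigma> True] rank[OF \<tau> True] by simp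
    next
      case False
      then show ?thesis using permutes_not_in[OF \<sigma>] permutes_not_in[OF \<tau>] by simp
    qed
  qed
qed

text \<open>All entries of \<open>Q\<close> are below 1 in absolute value, so the multiple of the
  identity matrix split off by \<open>kernel_form_prod\<close> is strictly positive. The constants
  are these multiples divided by the \<open>fact n\<close> of the average.\<close>

lemma level_ip_lower_bound:
  "\<exists>c. (\<forall>w. 0 < c w) \<and> (\<forall>f. (\<Sum>w | length w = n. c w * (cmod (f w))\<^sup>2) \<le> Re (level_ip Q n f f))"
proof -
  define P where "P = (SIGMA b:{..<n}. {..<b})"
  define d where "d w = (\<Prod>p\<in>P. 1 - \<bar>Q $ (w ! fst p) $ (w ! snd p)\<bar>)" for w :: "'n list"
  have abs1: "\<bar>Q $ i $ j\<bar> < 1" for i j using range[of i j] by auto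
  have d: "d w > 0" for w unfolding d_def by (rule prod_pos) (simp add: abs1)
  define X where "X = {\<sigma>. \<sigma> permutes {..<n}}"
  have finX: "finite X" unfolding X_def by (rule finite_permutations) simp
  have form: "d w * (cmod (f w))\<^sup>2 \<le> kernel_form X (\<lambda>\<sigma> \<tau>. crossings Q n w (inv \<sigma>) (inv \<tau>)) \<phi>"
    if \<phi>: "\<phi> = (\<lambda>\<sigma>. f (permute_word w \<sigma>))" for w f \<phi>
  proof -
    define g where "g p \<sigma> \<longleftrightarrow> inv \<sigma> (snd p) < inv \<sigma> (fst p)" for p :: "nat \<times> nat" and \<sigma> :: "nat \<Rightarrow> nat"
    define K where "K \<sigma> \<tau> = (\<Prod>p\<in>P. if g p \<sigma> = g p \<tau> then 1 else Q $ (w ! fst p) $ (w ! snd p))" for \<sigma> \<tau>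
    define E where "E \<sigma> \<tau> = (if \<forall>p\<in>P. g p \<sigma> = g p \<tau> then 1 else 0 :: real)" for \<sigma> \<tau>
    have "crossings Q n w (inv \<sigma>) (inv \<tau>) = K \<sigma> \<tau>" if "\<sigma> \<in> X" "\<tau> \<in> X" for \<sigma> \<tau>
      using that permutes_inj[OF permutes_inv[of \<sigma>]] permutes_inj[OF permutes_inv[of \<tau>]]
      by (auto simp: X_def crossings_pairs P_def g_def K_def)
    then have "kernel_form X (\<lambda>\<sigma> \<tau>. crossings Q n w (inv \<sigma>) (inv \<tau>)) \<phi> = kernel_form X K \<phi>"
      unfolding kernel_form_def by (intro arg_cong[of _ _ Re] sum.cong) auto
    moreover have "0 \<le> kernel_form X (\<lambda>\<sigma> \<tau>. 1 * K \<sigma> \<tau> + (- d w) * E \<sigma> \<tau>) \<phi>"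
      using kernel_form_prod[of P "\<lambda>p. Q $ (w ! fst p) $ (w ! snd p)" X g \<phi>]
      by (simp add: P_def abs1 less_imp_le K_def E_def d_def)
    then have "0 \<le> kernel_form X K \<phi> - d w * kernel_form X E \<phi>"
      unfolding kernel_form_add by simp
    moreover have "E \<sigma> \<tau> = (if \<tau> = \<sigma> then 1 else 0)" if "\<sigma> \<in> X" "\<tau> \<in> X" for \<sigma> \<tau>
    proof -
      have "\<sigma> = \<tau>" if "\<forall>p\<in>P. g p \<sigma> = g p \<tau>"
      proof -
        have "inv \<sigma> = inv \<tau>"
        proof (rule permutes_eqI_order)
          fix a b assume "a < b" "b < n"
          then show "(inv \<sigma> a < inv \<sigma> b) = (inv \<tau> a < inv \<tau> b)"
            using that by (auto simp: P_def g_def)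
        qed (use \<open>\<sigma> \<in> X\<close> \<open>\<tau> \<in> X\<close> permutes_inv in \<open>auto simp: X_def\<close>)
        then have "inv (inv \<sigma>) = inv (inv \<tau>)" by simp
        then show ?thesis using \<open>\<sigma> \<in> X\<close> \<open>\<tau> \<in> X\<close> by (simp add: X_def permutes_inv_inv)
      qed
      then show ?thesis by (auto simp: E_def)
    qed
    then have "kernel_form X E \<phi> = Re (\<Sum>\<sigma>\<in>X. \<Sum>\<tau>\<in>X. if \<tau> = \<sigma> then \<phi> \<sigma> * cnj (\<phi> \<tau>) else 0)"
      unfolding kernel_form_def by (intro arg_cong[of _ _ Re] sum.cong) auto
    then have "kernel_form X E \<phi> = (\<Sum>\<sigma>\<in>X. (cmod (\<phi> \<sigma>))\<^sup>2)"
      using finX by (simp add: complex_norm_square[symmetric] del: of_real_power)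
    \<comment> \<open>Among the diagonal terms only the identity arrangement is kept; it gives the
      coefficient of \<open>w\<close> itself.\<close>
    moreover have "(cmod (\<phi> (\<lambda>a. a)))\<^sup>2 \<le> (\<Sum>\<sigma>\<in>X. (cmod (\<phi> \<sigma>))\<^sup>2)"
      using finX permutes_id[unfolded id_def] by (intro member_le_sum) (auto simp: X_def)
    ultimately have 1: "(cmod (\<phi> (\<lambda>a. a)))\<^sup>2 \<le> kernel_form X E \<phi>"
      and 2: "d w * kernel_form X E \<phi> \<le> kernel_form X (\<lambda>\<sigma> \<tau>. crossings Q n w (inv \<sigma>) (inv \<tau>)) \<phi>"
      by simp_all
    have "d w * (cmod (f w))\<^sup>2 \<le> d w * kernel_form X E \<phi>"
      using 1 d[of w] by (simp add: \<phi> permute_word_id)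
    then show ?thesis using 2 by linarith
  qed
  have "(\<Sum>w | length w = n. d w / fact n * (cmod (f w))\<^sup>2) \<le> Re (level_ip Q n f f)" for f
  proof -
    have "(\<Sum>w | length w = n. d w * (cmod (f w))\<^sup>2) \<le> (\<Sum>w | length w = n.
        kernel_form X (\<lambda>\<sigma> \<tau>. crossings Q n w (inv \<sigma>) (inv \<tau>)) (\<lambda>\<sigma>. f (permute_word w \<sigma>)))"
      by (intro sum_mono form refl)
    also have "\<dots> = Re (of_nat (fact n) * level_ip Q n f f)"
      unfolding level_ip_eq by (simp add: kernel_form_def X_def)
    also have "\<dots> = fact n * Re (level_ip Q n f f)"
      using Re_complex_of_real[of "fact n"] Im_complex_of_real[of "fact n"]
      by (simp del: Re_complex_of_real Im_complex_of_real)
    finally show ?thesis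
      by (simp add: sum_divide_distrib[symmetric] field_simps)
  qed
  then show ?thesis using d by (intro exI[of _ "\<lambda>w. d w / fact n"]) auto
qed

text \<open>Reversing the positions reverses the order of every pair in both arrangements, so
  agreement is unaffected. Right operators inherit their bounds and adjoints from left ones through
  this symmetry.\<close>

lemma level_ip_rev: "level_ip Q n (\<lambda>w. f (rev w)) (\<lambda>w. g (rev w)) = level_ip Q n f g"
proof -
  define r where "r p = (if p < n then n - 1 - p else p)" for p
  have rr: "r (r p) = p" for p by (simp add: r_def)
  have "bij_betw r {..<n} {..<n}"
    by (rule bij_betw_byWitness[where f' = r]) (simp_all add: rr image_subset_iff, simp_all add: r_def)
  then have r: "r permutes {..<n}" by (rule bij_imp_permutes) (simp add: r_def)
  have inv_r: "inv r = r" by (rule inv_unique_comp) (auto simp: rr fun_eq_iff)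
  have rev_word: "rev (permute_word w \<sigma>) = permute_word w (\<sigma> \<circ> r)" if "length w = n" for w :: "'n list" and \<sigma>
    using that by (intro nth_equalityI) (auto simp: rev_nth r_def)
  have cross: "crossings Q n w (inv (\<sigma> \<circ> r)) (inv (\<tau> \<circ> r)) = crossings Q n w (inv \<sigma>) (inv \<tau>)"
    if \<sigma>: "\<sigma> permutes {..<n}" and \<tau>: "\<tau> permutes {..<n}" for w \<sigma> \<tau>
  proof -
    have inv_comp: "inv (\<rho> \<circ> r) = (\<lambda>a. r (inv \<rho> a))" if "\<rho> permutes {..<n}" for \<rho>
      using o_inv_distrib[OF permutes_bij[OF that] permutes_bij[OF r]] by (simp add: inv_r o_def)
    have less: "r (inv \<rho> a) < r (inv \<rho> b) \<longleftrightarrow> inv \<rho> b < inv \<rho> a"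
      if "\<rho> permutes {..<n}" "a < n" "b < n" for \<rho> a b
      using permutes_in_image[OF permutes_inv[OF that(1)], of a]
        permutes_in_image[OF permutes_inv[OF that(1)], of b] that by (auto simp: r_def)
    have "crossings Q n w (inv (\<sigma> \<circ> r)) (inv (\<tau> \<circ> r)) = (\<Prod>a<n. \<Prod>b<n.
        if inv \<sigma> b < inv \<sigma> a \<and> inv \<tau> a < inv \<tau> b then Q $ (w ! b) $ (w ! a) else 1)"
      unfolding crossings_def inv_comp[OF \<sigma>] inv_comp[OF \<tau>]
      by (intro prod.cong refl) (simp add: less \<sigma> \<tau>)
    also have "\<dots> = crossings Q n w (inv \<sigma>) (inv \<tau>)"
      unfolding crossings_def by (subst prod.swap) (auto intro!: prod.cong simp: sym)
    finally show ?thesis .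
  qed
  let ?G = "\<lambda>w \<sigma> \<tau>. f (permute_word w \<sigma>) * cnj (g (permute_word w \<tau>)) *
    of_real (crossings Q n w (inv \<sigma>) (inv \<tau>))"
  have "of_nat (fact n) * level_ip Q n (\<lambda>w. f (rev w)) (\<lambda>w. g (rev w)) = (\<Sum>w | length w = n.
      \<Sum>\<sigma>\<in>perms n. \<Sum>\<tau>\<in>perms n. ?G w (\<sigma> \<circ> r) (\<tau> \<circ> r))"
    unfolding level_ip_eq by (intro sum.cong refl) (simp add: rev_word cross)
  also have "\<dots> = (\<Sum>w | length w = n. \<Sum>\<sigma>\<in>perms n. \<Sum>\<tau>\<in>perms n. ?G w \<sigma> \<tau>)"
  proof (rule sum.cong[OF refl])
    fix w :: "'n list"
    have "(\<Sum>\<sigma>\<in>perms n. \<Sum>\<tau>\<in>perms n. ?G w (\<sigma> \<circ> r) (\<tau> \<circ> r)) =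
        (\<Sum>\<sigma>\<in>perms n. \<Sum>\<tau>\<in>perms n. ?G w (\<sigma> \<circ> r) \<tau>)"
    proof (rule sum.cong[OF refl])
      fix \<sigma>
      show "(\<Sum>\<tau>\<in>perms n. ?G w (\<sigma> \<circ> r) (\<tau> \<circ> r)) =
          (\<Sum>\<tau>\<in>perms n. ?G w (\<sigma> \<circ> r) \<tau>)"
        by (rule sum_permutations_compose_right[OF r, symmetric, where f = "?G w (\<sigma> \<circ> r)"])
    qed
    also have "\<dots> = (\<Sum>\<sigma>\<in>perms n. \<Sum>\<tau>\<in>perms n. ?G w \<sigma> \<tau>)"
      by (rule sum_permutations_compose_right[OF r, symmetric,
            where f = "\<lambda>\<sigma>. \<Sum>\<tau>\<in>perms n. ?G w \<sigma> \<tau>"])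
    finally show "(\<Sum>\<sigma>\<in>perms n. \<Sum>\<tau>\<in>perms n. ?G w (\<sigma> \<circ> r) (\<tau> \<circ> r)) =
        (\<Sum>\<sigma>\<in>perms n. \<Sum>\<tau>\<in>perms n. ?G w \<sigma> \<tau>)" .
  qed
  finally have "of_nat (fact n) * level_ip Q n (\<lambda>w. f (rev w)) (\<lambda>w. g (rev w)) =
      of_nat (fact n) * level_ip Q n f g"
    unfolding level_ip_eq[of n f g] .
  then show ?thesis by simp
qed

end

section \<open>Creation and annihilation on the levels\<close>

text \<open>The creation operator without restriction to the Fock space, so that its identities hold
  for arbitrary functions and on single levels.\<close>

definition create :: "'n \<Rightarrow> ('n list \<Rightarrow> complex) \<Rightarrow> 'n list \<Rightarrow> complex" where
  "create i f w = (case w of [] \<Rightarrow> 0 | j # v \<Rightarrow> if j = i then f v else 0)"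

lemma create_simps [simp]:
  "create i f [] = 0" "create i f (j # v) = (if j = i then f v else 0)"
  by (simp_all add: create_def)

text \<open>The mixed q-commutation relation.\<close>

lemma ann_create:
  "ann Q i (create j f) = (\<lambda>w. (if i = j then f w else 0) + of_real (Q $ i $ j) * create j (ann Q i f) w)"
proof
  fix w show "ann Q i (create j f) w =
      (if i = j then f w else 0) + of_real (Q $ i $ j) * create j (ann Q i f) w"
  proof (cases w)
    case (Cons k v)
    have "ann Q i (\<lambda>u. create j f (k # u)) v = (if k = j then ann Q i f v else 0)"
    proof (cases "k = j")
      case False
      have "ann Q i (\<lambda>u. 0) v = 0" by (induction v) simp_all
      then show ?thesis using False by simp
    qed simp
    then show ?thesis by (auto simp: Cons)
  qed auto
qed

lemma sum_words_Suc:
  "(\<Sum>w | length w = Suc n. F w) = (\<Sum>i\<in>(UNIV :: 'n::finite set). \<Sum>w | length w = n. F (i # w))"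
proof -
  have "(\<Sum>(i, w)\<in>(UNIV :: 'n set) \<times> {w. length w = n}. F (i # w)) = (\<Sum>w | length w = Suc n. F w)"
    by (rule sum.reindex_bij_witness[where i = "\<lambda>w. (hd w, tl w)" and j = "\<lambda>(i, w). i # w"])
      (auto simp: length_Suc_conv)
  then show ?thesis by (simp add: sum.cartesian_product)
qed

lemma words_0: "{w. length w = 0} = {[]}"
  by auto

context mixed_q begin

abbreviation "lip \<equiv> level_ip Q"

abbreviation "lnorm2 n f \<equiv> Re (level_ip Q n f f)"

lemma level_ip_lower:
  obtains c where "\<And>w. 0 < c w"
    "\<And>f. (\<Sum>w | length w = n. c w * (cmod (f w))\<^sup>2) \<le> lnorm2 n f"
  using level_ip_lower_bound[of n] by blast

lemma level_ip_definite:
  assumes "lnorm2 n f = 0" "length w = n"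
  shows "f w = 0"
proof -
  obtain c where c: "\<And>w. 0 < c w" "(\<Sum>w | length w = n. c w * (cmod (f w))\<^sup>2) \<le> lnorm2 n f"
    using level_ip_lower[of n] by metis
  have "c w * (cmod (f w))\<^sup>2 \<le> (\<Sum>w | length w = n. c w * (cmod (f w))\<^sup>2)"
    using assms(2) less_imp_le[OF c(1)] by (intro member_le_sum) auto
  then have "c w * (cmod (f w))\<^sup>2 \<le> 0" using c assms by simp
  then show ?thesis using c(1)[of w] by (simp add: mult_le_0_iff not_le[symmetric] not_less)
qed

sublocale level: positive_form UNIV "lip n" for n
proof
  show "0 \<le> lnorm2 n f" for f
  proof -
    obtain c where c: "\<And>w. 0 < c w" "(\<Sum>w | length w = n. c w * (cmod (f w))\<^sup>2) \<le> lnorm2 n f"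
      using level_ip_lower[of n] by metis
    have "0 \<le> (\<Sum>w | length w = n. c w * (cmod (f w))\<^sup>2)"
      using c(1) by (intro sum_nonneg mult_nonneg_nonneg) (auto intro: less_imp_le)
    then show ?thesis using c(2) by linarith
  qed
  show "lip n (\<lambda>w. f w + g w) h = lip n f h + lip n g h" for f g h
    by (simp add: level_ip_def tensor_ip_def distrib_right sum.distrib)
  show "lip n (\<lambda>w. c * f w) g = c * lip n f g" for c f g
    by (simp add: level_ip_def tensor_ip_def sum_distrib_left mult.assoc)
  show "lip n g f = cnj (lip n f g)" for f g by (rule level_ip_cnj)
qed auto

lemma level_ip_cong_left:
  assumes "\<And>w. length w = n \<Longrightarrow> f w = f' w"
  shows "lip n f g = lip n f' g"
  unfolding level_ip_def tensor_ip_def by (intro sum.cong) (auto simp: assms)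

lemma level_ip_cong:
  assumes "\<And>w. length w = n \<Longrightarrow> f w = f' w" "\<And>w. length w = n \<Longrightarrow> g w = g' w"
  shows "lip n f g = lip n f' g'"
proof -
  have "lip n f g = lip n f' g" by (rule level_ip_cong_left[OF assms(1)])
  also have "\<dots> = cnj (lip n g f')" by (rule level_ip_cnj)
  also have "lip n g f' = lip n g' f'" by (rule level_ip_cong_left[OF assms(2)])
  finally show ?thesis using level_ip_cnj[of n f' g'] by simp
qed

lemma level_ip_create: "lip (Suc n) (create i f) g = lip n f (ann Q i g)"
proof -
  have "lip (Suc n) (create i f) g = (\<Sum>j\<in>UNIV. \<Sum>w | length w = n.
      if j = i then f w * cnj (symmetrizer Q n (ann Q i g) w) else 0)"
    unfolding level_ip_def tensor_ip_def sum_words_Suc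
    by (intro sum.cong refl) (auto simp: symmetrizer_Cons)
  also have "\<dots> = lip n f (ann Q i g)"
    unfolding level_ip_def tensor_ip_def by (subst sum.swap) simp
  finally show ?thesis .
qed

lemma level_ip_create_0: "lip 0 (create i f) g = 0"
  by (simp add: level_ip_def tensor_ip_def words_0)

text \<open>The solution of k = 1 + m k, where m is the largest absolute value of an entry of
  \<open>Q\<close>. It is the constant that reproduces itself in the inductive norm estimate for
  creation.\<close>

definition create_bound :: real where
  "create_bound = 1 / (1 - Max (range (\<lambda>(i, j). \<bar>Q $ i $ j\<bar>)))"

lemma Q_abs_less: "\<bar>Q $ i $ j\<bar> < 1"
  using range[of i j] by auto

lemma create_bound_pos: "0 < create_bound"
  and create_bound_ge: "1 + \<bar>Q $ i $ i\<bar> * create_bound \<le> create_bound"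
proof -
  let ?m = "Max (range (\<lambda>(i, j). \<bar>Q $ i $ j\<bar>))"
  have m1: "?m < 1" by (subst Max_less_iff) (auto simp: Q_abs_less)
  then show "0 < create_bound" by (simp add: create_bound_def)
  moreover have "\<bar>Q $ i $ i\<bar> \<le> ?m" by (rule Max_ge) (auto intro!: image_eqI[of _ _ "(i, i)"])
  ultimately have "1 + \<bar>Q $ i $ i\<bar> * create_bound \<le> 1 + ?m * create_bound"
    by (intro add_left_mono mult_right_mono) auto
  also have "\<dots> = create_bound"
  proof -
    have "1 + m * (1 / (1 - m)) = 1 / (1 - m)" if "m < 1" for m :: real
      using that by (simp add: field_simps)
    then show ?thesis using m1 unfolding create_bound_def by blast
  qed
  finally show "1 + \<bar>Q $ i $ i\<bar> * create_bound \<le> create_bound" .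
qed

lemma create_lnorm2:
  "lnorm2 (Suc n) (create i f) = lnorm2 n f + (case n of 0 \<Rightarrow> 0 | Suc m \<Rightarrow> Q $ i $ i * lnorm2 m (ann Q i f))"
proof -
  have "lip n f (\<lambda>w. c * create i (ann Q i f) w) = (case n of 0 \<Rightarrow> 0 | Suc m \<Rightarrow> cnj c * lip m (ann Q i f) (ann Q i f))" for c
    using level_ip_cnj[of n f "create i (ann Q i f)"] level_ip_cnj[of _ "ann Q i f" "ann Q i f"]
    by (cases n) (auto simp: level.form_scale_right level_ip_create level_ip_create_0)
  then show ?thesis
    by (auto simp: level_ip_create ann_create level.form_add_right split: nat.splits)
qed

text \<open>Nonnegativity of the form at \<open>create_bound\<close> times \<open>f\<close> minus
  \<open>create i (ann Q i f)\<close>. The passage from an operator to its adjoint is thus made with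
  a bound at the single vector \<open>ann Q i f\<close>, which is what the induction on levels has
  available.\<close>

lemma ann_bound_if_create_bound:
  assumes "lnorm2 (Suc n) (create i (ann Q i f)) \<le> create_bound * lnorm2 n (ann Q i f)"
  shows "lnorm2 n (ann Q i f) \<le> create_bound * lnorm2 (Suc n) f"
proof -
  let ?k = create_bound
  let ?x = "lnorm2 n (ann Q i f)"
  have "0 \<le> lnorm2 (Suc n) (\<lambda>w. of_real ?k * f w - create i (ann Q i f) w)"
    by (rule level.form_pos) simp
  also have "\<dots> = ?k\<^sup>2 * lnorm2 (Suc n) f + lnorm2 (Suc n) (create i (ann Q i f))
      - 2 * Re (lip (Suc n) (\<lambda>w. of_real ?k * f w) (create i (ann Q i f)))"
    using create_bound_pos by (subst level.form_diff_self) (auto simp: level.form_scale_self)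
  also have "lip (Suc n) (\<lambda>w. of_real ?k * f w) (create i (ann Q i f)) = of_real ?k * lip n (ann Q i f) (ann Q i f)"
    using level_ip_cnj[of "Suc n" f "create i (ann Q i f)"] level_ip_cnj[of n "ann Q i f" "ann Q i f"]
    by (simp add: level.form_scale level_ip_create)
  finally have "?k * ?x \<le> ?k * (?k * lnorm2 (Suc n) f)"
    using assms by (simp add: power2_eq_square algebra_simps)
  then show ?thesis using create_bound_pos by simp
qed

text \<open>The commutation relation reduces the norm of a created vector to that of
  \<open>f\<close> and of \<open>ann Q i f\<close>. The latter is controlled by the bound one level
  below.\<close>

lemma create_bound: "lnorm2 (Suc n) (create i f) \<le> create_bound * lnorm2 n f"
proof (induction n arbitrary: f)
  case 0
  have "1 \<le> create_bound"
    using create_bound_ge[of i] create_bound_pos by (smt (verit) mult_nonneg_nonneg abs_ge_zero)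
  then show ?case
    using mult_right_mono[of 1 create_bound "lnorm2 0 f"] level.form_pos[of f 0]
    by (simp add: create_lnorm2)
next
  case (Suc n)
  have "lnorm2 n (ann Q i f) \<le> create_bound * lnorm2 (Suc n) f"
    by (rule ann_bound_if_create_bound[OF Suc])
  then have "\<bar>Q $ i $ i\<bar> * lnorm2 n (ann Q i f) \<le> \<bar>Q $ i $ i\<bar> * (create_bound * lnorm2 (Suc n) f)"
    by (intro mult_left_mono) auto
  moreover have "Q $ i $ i * lnorm2 n (ann Q i f) \<le> \<bar>Q $ i $ i\<bar> * lnorm2 n (ann Q i f)"
    using level.form_pos[of "ann Q i f" n] by (intro mult_right_mono) auto
  moreover have "(1 + \<bar>Q $ i $ i\<bar> * create_bound) * lnorm2 (Suc n) f \<le> create_bound * lnorm2 (Suc n) f"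
    using create_bound_ge level.form_pos[of f "Suc n"] by (intro mult_right_mono) auto
  ultimately show ?case by (simp add: create_lnorm2 algebra_simps)
qed

lemma ann_bound: "lnorm2 n (ann Q i f) \<le> create_bound * lnorm2 (Suc n) f"
  by (rule ann_bound_if_create_bound[OF create_bound])

end

section \<open>The Fock space\<close>

definition delta :: "'a \<Rightarrow> 'a \<Rightarrow> complex" where
  "delta w v = (if v = w then 1 else 0)"

definition truncate :: "nat \<Rightarrow> ('a list \<Rightarrow> complex) \<Rightarrow> 'a list \<Rightarrow> complex" where
  "truncate N f w = (if length w < N then f w else 0)"

definition component :: "nat \<Rightarrow> ('a list \<Rightarrow> complex) \<Rightarrow> 'a list \<Rightarrow> complex" where
  "component n f w = (if length w = n then f w else 0)"

context mixed_q begin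

abbreviation "Fock \<equiv> Q_Fock Q"
abbreviation "\<F> \<equiv> vectors (Q_Fock Q)"
abbreviation "fip \<equiv> ip (Q_Fock Q)"
abbreviation "fnorm \<equiv> vnorm (Q_Fock Q)"

lemma mem_Fock: "f \<in> \<F> \<longleftrightarrow> summable (\<lambda>n. lnorm2 n f)"
  by (simp add: Q_Fock_def)

lemma ip_Fock: "fip f g = (\<Sum>n. lip n f g)"
  by (simp add: Q_Fock_def)

lemma cmod_lip_le: "cmod (lip n f g) \<le> (lnorm2 n f + lnorm2 n g) / 2"
proof (rule power2_le_imp_le)
  have "(cmod (lip n f g))\<^sup>2 \<le> lnorm2 n f * lnorm2 n g" by (rule level.cauchy_schwarz) simp_all
  moreover have "0 \<le> (lnorm2 n f - lnorm2 n g)\<^sup>2" by simp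
  ultimately show "(cmod (lip n f g))\<^sup>2 \<le> ((lnorm2 n f + lnorm2 n g) / 2)\<^sup>2"
    by (simp add: power2_eq_square field_simps)
  show "0 \<le> (lnorm2 n f + lnorm2 n g) / 2"
    using level.form_pos[of f n] level.form_pos[of g n] by simp
qed

lemma summable_lip: "\<lbrakk>f \<in> \<F>; g \<in> \<F>\<rbrakk> \<Longrightarrow> summable (\<lambda>n. lip n f g)"
  unfolding mem_Fock
  by (rule summable_comparison_test'[of "\<lambda>n. (lnorm2 n f + lnorm2 n g) / 2" 0, OF _ cmod_lip_le])
    (intro summable_divide summable_add)

sublocale fock: positive_form \<F> fip
proof
  show "(\<lambda>_. 0) \<in> \<F>" unfolding mem_Fock using level.form_zero[OF UNIV_I] by simp
  show "(\<lambda>w. f w + g w) \<in> \<F>" if "f \<in> \<F>" "g \<in> \<F>" for f g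
    unfolding mem_Fock
  proof (rule summable_comparison_test'[of "\<lambda>n. 2 * (lnorm2 n f + lnorm2 n g)" 0])
    show "norm (lnorm2 n (\<lambda>w. f w + g w)) \<le> 2 * (lnorm2 n f + lnorm2 n g)" for n
      using level.form_pos[of "\<lambda>w. f w + g w" n] level.form_add_self[of f g n]
        cmod_lip_le[of n f g] complex_Re_le_cmod[of "lip n f g"] by simp
  qed (use that in \<open>auto simp: mem_Fock intro: summable_add summable_mult\<close>)
  show "(\<lambda>w. c * f w) \<in> \<F>" if "f \<in> \<F>" for c f
    using that unfolding mem_Fock by (auto simp: level.form_scale_self intro: summable_mult)
  show "fip (\<lambda>w. f w + g w) h = fip f h + fip g h" if "f \<in> \<F>" "g \<in> \<F>" "h \<in> \<F>" for f g h
    unfolding ip_Fock by (simp add: level.form_add suminf_add summable_lip that)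
  show "fip (\<lambda>w. c * f w) g = c * fip f g" if "f \<in> \<F>" "g \<in> \<F>" for c f g
    unfolding ip_Fock by (simp add: level.form_scale suminf_mult summable_lip that)
  show "fip g f = cnj (fip f g)" if "f \<in> \<F>" "g \<in> \<F>" for f g
    unfolding ip_Fock level_ip_cnj[of _ g f]
    by (rule sums_unique[symmetric]) (simp add: sums_cnj summable_lip that summable_sums)
  show "0 \<le> Re (fip f f)" if "f \<in> \<F>" for f
    unfolding ip_Fock Re_suminf[OF summable_lip[OF that that]]
    using that by (intro suminf_nonneg) (auto simp: mem_Fock level.form_pos)
qed

lemma fip_self: "f \<in> \<F> \<Longrightarrow> Re (fip f f) = (\<Sum>n. lnorm2 n f)"
  unfolding ip_Fock by (simp add: Re_suminf summable_lip)

lemma vnorm_Fock: "f \<in> \<F> \<Longrightarrow> fnorm f = sqrt (\<Sum>n. lnorm2 n f)"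
  by (simp add: vnorm_def fip_self)

lemma lip_truncate: "lip n (truncate N f) g = (if n < N then lip n f g else 0)"
proof (cases "n < N")
  case True
  then show ?thesis by (auto simp: truncate_def intro: level_ip_cong)
next
  case False
  then have "lip n (truncate N f) g = lip n (\<lambda>_. 0) g"
    by (intro level_ip_cong) (auto simp: truncate_def)
  then show ?thesis using False level.form_zero by simp
qed

lemma lip_truncate': "lip n g (truncate N f) = (if n < N then lip n g f else 0)"
  using level_ip_cnj[of n g "truncate N f"] level_ip_cnj[of n g f] by (simp add: lip_truncate)

lemma lip_component: "lip n (component m f) g = (if n = m then lip n f g else 0)"
proof (cases "n = m")
  case True
  then show ?thesis by (auto simp: component_def intro: level_ip_cong)
next
  case False
  then have "lip n (component m f) g = lip n (\<lambda>_. 0) g"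
    by (intro level_ip_cong) (auto simp: component_def)
  then show ?thesis using False level.form_zero by simp
qed

lemma truncate_Fock [simp]: "truncate N f \<in> \<F>"
  unfolding mem_Fock by (rule summable_finite[of "{..<N}"]) (auto simp: lip_truncate)

lemma component_Fock [simp]: "component n f \<in> \<F>"
  unfolding mem_Fock by (rule summable_finite[of "{n}"]) (auto simp: lip_component)

lemma truncate_fip: "fip (truncate N f) g = (\<Sum>n<N. lip n f g)"
  unfolding ip_Fock by (subst suminf_finite[of "{..<N}"]) (auto simp: lip_truncate)

lemma component_fip: "fip (component n f) g = lip n f g"
  unfolding ip_Fock by (subst suminf_finite[of "{n}"]) (auto simp: lip_component)

lemma truncate_0: "truncate 0 f = (\<lambda>_. 0)"
  by (auto simp: truncate_def)

lemma truncate_Suc: "truncate (Suc N) f = (\<lambda>w. truncate N f w + component N f w)"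
  by (auto simp: truncate_def component_def)

lemma finite_support_Fock:
  assumes "\<And>w. length w \<ge> N \<Longrightarrow> f w = 0"
  shows "f \<in> \<F>"
proof -
  have "f = truncate N f" using assms by (force simp: truncate_def fun_eq_iff)
  then show ?thesis using truncate_Fock by metis
qed

lemma delta_Fock [simp]: "delta w \<in> \<F>"
  by (rule finite_support_Fock[of "Suc (length w)"]) (auto simp: delta_def)

lemma fip_definite:
  assumes "f \<in> \<F>" "fip f f = 0" shows "f = (\<lambda>_. 0)"
proof
  fix w :: "'n list"
  have "(\<Sum>n. lnorm2 n f) = 0" using fip_self[OF assms(1)] assms(2) by simp
  then have "lnorm2 (length w) f = 0"
    using suminf_eq_zero_iff[of "\<lambda>n. lnorm2 n f"] assms(1) by (simp add: mem_Fock level.form_pos)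
  then show "f w = 0" by (rule level_ip_definite) simp
qed

lemma truncate_tendsto:
  assumes "f \<in> \<F>"
  shows "(\<lambda>N. fnorm (\<lambda>w. f w - truncate N f w)) \<longlonglongrightarrow> 0"
proof -
  let ?S = "\<Sum>n. lnorm2 n f"
  have s: "summable (\<lambda>n. lnorm2 n f)" using assms by (simp add: mem_Fock)
  have "Re (fip (\<lambda>w. f w - truncate N f w) (\<lambda>w. f w - truncate N f w)) = ?S - (\<Sum>n<N. lnorm2 n f)" for N
  proof -
    have "fip f (truncate N f) = cnj (\<Sum>n<N. lip n f f)"
      using fock.form_cnj[of "truncate N f" f] assms by (simp add: truncate_fip)
    moreover have "fip (truncate N f) (truncate N f) = (\<Sum>n<N. lip n f f)"
      by (simp add: truncate_fip lip_truncate')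
    ultimately show ?thesis
      using assms by (simp add: fock.form_diff_self fip_self)
  qed
  then have "(\<lambda>N. fnorm (\<lambda>w. f w - truncate N f w)) = (\<lambda>N. sqrt (?S - (\<Sum>n<N. lnorm2 n f)))"
    by (simp add: vnorm_def)
  moreover have "(\<lambda>N. sqrt (?S - (\<Sum>n<N. lnorm2 n f))) \<longlonglongrightarrow> sqrt (?S - ?S)"
    by (intro tendsto_intros summable_LIMSEQ s)
  ultimately show ?thesis by simp
qed

section \<open>Solvability on the levels and representation of functionals\<close>

lemma lip_delta: "length w = n \<Longrightarrow> lip n (delta w) g = cnj (symmetrizer Q n g w)"
  unfolding level_ip_def tensor_ip_def delta_def by (simp add: if_distrib[of "\<lambda>x. x * _"] cong: if_cong)

lemma lip_sum_delta:
  assumes "W \<subseteq> {w. length w = n}" "\<And>w. w \<notin> W \<Longrightarrow> f w = 0"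
  shows "lip n f g = (\<Sum>w\<in>W. f w * lip n (delta w) g)"
proof -
  have "lip n f g = (\<Sum>w | length w = n. f w * lip n (delta w) g)"
    unfolding level_ip_def[of Q n f] tensor_ip_def by (intro sum.cong) (auto simp: lip_delta)
  also have "\<dots> = (\<Sum>w\<in>W. f w * lip n (delta w) g)"
    using assms by (intro sum.mono_neutral_right) auto
  finally show ?thesis .
qed

text \<open>Invertibility of the symmetrizers, by adjoining one word at a time.\<close>

lemma level_solve:
  assumes "finite W" "W \<subseteq> {w. length w = n}"
  shows "\<exists>h. (\<forall>w. w \<notin> W \<longrightarrow> h w = 0) \<and> (\<forall>w\<in>W. lip n (delta w) h = b w)"
  using assms
proof (induction W arbitrary: b rule: finite_induct)
  case empty
  then show ?case by (intro exI[of _ "\<lambda>_. 0"]) auto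
next
  case (insert x W)
  obtain u where u: "\<And>w. w \<notin> W \<Longrightarrow> u w = 0"
    "\<And>w. w \<in> W \<Longrightarrow> lip n (delta w) u = lip n (delta w) (delta x)"
    using insert.IH[of "\<lambda>w. lip n (delta w) (delta x)"] insert.prems by auto
  obtain v where v: "\<And>w. w \<notin> W \<Longrightarrow> v w = 0" "\<And>w. w \<in> W \<Longrightarrow> lip n (delta w) v = b w"
    using insert.IH[of b] insert.prems by auto
  \<comment> \<open>A Gram-Schmidt step: \<open>e\<close> is the basis vector of \<open>x\<close>
    made orthogonal to the words in \<open>W\<close>. Its pairing \<open>s\<close> with that basis
    vector is its own squared norm.\<close>
  define e where "e w = delta x w - u w" for w
  have eW: "lip n (delta w) e = 0" if "w \<in> W" for w
    using u(2)[OF that] unfolding e_def by (simp add: level.form_diff_right)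
  have "lip n e e = lip n (delta x) e - lip n u e"
    unfolding e_def[abs_def] by (simp add: level.form_diff)
  also have "lip n u e = 0"
    using lip_sum_delta[of W n u e] insert.prems u(1) eW by simp
  finally have ee: "lip n e e = lip n (delta x) e" by simp
  define s where "s = lip n (delta x) e"
  have "s \<noteq> 0"
  proof
    assume "s = 0"
    then have "lnorm2 n e = 0" using ee by (simp add: s_def)
    then have "e x = 0" using insert.prems by (intro level_ip_definite) auto
    then show False using u(1)[OF insert.hyps(2)] by (simp add: e_def delta_def)
  qed
  \<comment> \<open>The conjugate appears because the form is antilinear in its second argument,
    where \<open>t\<close> will stand.\<close>
  define t where "t = cnj ((b x - lip n (delta x) v) / s)"
  define h where "h w = v w + t * e w" for w
  have lh: "lip n (delta w) h = lip n (delta w) v + cnj t * lip n (delta w) e" for w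
    unfolding h_def[abs_def] by (simp add: level.form_add_right level.form_scale_right)
  have "lip n (delta x) h = b x"
    unfolding lh using \<open>s \<noteq> 0\<close> by (simp add: t_def s_def[symmetric])
  moreover have "lip n (delta w) h = b w" if "w \<in> W" for w
    unfolding lh using eW[OF that] v(2)[OF that] by simp
  moreover have "h w = 0" if "w \<notin> insert x W" for w
    using that u(1) v(1) by (simp add: h_def e_def delta_def)
  ultimately show ?case by (intro exI[of _ h]) auto
qed

lemma functional_component:
  assumes add: "\<And>f g. f \<in> \<F> \<Longrightarrow> g \<in> \<F> \<Longrightarrow> \<phi> (\<lambda>w. f w + g w) = \<phi> f + \<phi> g"
    and scale: "\<And>c f. f \<in> \<F> \<Longrightarrow> \<phi> (\<lambda>w. c * f w) = c * (\<phi> f :: complex)"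
  shows "\<phi> (component n f) = (\<Sum>w | length w = n. f w * \<phi> (delta w))"
proof -
  have zero: "\<phi> (\<lambda>_. 0) = 0" using scale[OF fock.zero_mem, of 0] by simp
  have "(\<lambda>v. \<Sum>w\<in>W. f w * delta w v) \<in> \<F> \<and>
      \<phi> (\<lambda>v. \<Sum>w\<in>W. f w * delta w v) = (\<Sum>w\<in>W. f w * \<phi> (delta w))" if "finite W" for W
    using that
  proof induction
    case (insert x W)
    have "(\<lambda>v. \<Sum>w\<in>insert x W. f w * delta w v) = (\<lambda>v. f x * delta x v + (\<Sum>w\<in>W. f w * delta w v))"
      using insert by simp
    then show ?case
      using insert add[of "\<lambda>v. f x * delta x v" "\<lambda>v. \<Sum>w\<in>W. f w * delta w v"]
      by (simp add: fock.add_mem fock.scale_mem scale)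
  qed (simp add: zero fock.zero_mem)
  moreover have "component n f = (\<lambda>v. \<Sum>w | length w = n. f w * delta w v)"
    by (auto simp: component_def delta_def fun_eq_iff if_distrib[of "\<lambda>x. _ * x"] cong: if_cong)
  ultimately show ?thesis by simp
qed

text \<open>On each level the representing vector solves a finite linear system. Applying the bound
  for the functional to truncations of the assembled vector shows that its squared level norms are
  summable.\<close>

lemma Fock_riesz:
  assumes add: "\<And>f g. f \<in> \<F> \<Longrightarrow> g \<in> \<F> \<Longrightarrow> \<phi> (\<lambda>w. f w + g w) = \<phi> f + \<phi> g"
    and scale: "\<And>c f. f \<in> \<F> \<Longrightarrow> \<phi> (\<lambda>w. c * f w) = c * (\<phi> f :: complex)"
    and bound: "\<And>f. f \<in> \<F> \<Longrightarrow> cmod (\<phi> f) \<le> C * fnorm f"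
  shows "\<exists>h\<in>\<F>. \<forall>f\<in>\<F>. \<phi> f = fip f h"
proof -
  define hn where "hn n = (SOME h. \<forall>w\<in>{w. length w = n}. lip n (delta w) h = \<phi> (delta w))" for n
  have hn: "lip n (delta w) (hn n) = \<phi> (delta w)" if "length w = n" for n w
  proof -
    have "\<exists>h. \<forall>w\<in>{w. length w = n}. lip n (delta w) h = \<phi> (delta w)"
      using level_solve[OF length_finite subset_refl, of n "\<lambda>w. \<phi> (delta w)"] by blast
    from someI_ex[OF this] show ?thesis using that unfolding hn_def by simp
  qed
  define h where "h w = hn (length w) w" for w
  have comp: "\<phi> (component n f) = lip n f h" for n f
  proof -
    have "lip n f h = lip n f (hn n)" by (rule level_ip_cong) (auto simp: h_def)
    also have "\<dots> = lip n (component n f) (hn n)" by (simp add: lip_component)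
    also have "\<dots> = (\<Sum>w | length w = n. component n f w * lip n (delta w) (hn n))"
      by (rule lip_sum_delta) (auto simp: component_def)
    also have "\<dots> = (\<Sum>w | length w = n. f w * \<phi> (delta w))"
      by (intro sum.cong) (auto simp: component_def hn)
    also have "\<dots> = \<phi> (component n f)" by (rule functional_component[OF add scale, symmetric])
    finally show ?thesis by simp
  qed
  have trunc: "\<phi> (truncate N f) = (\<Sum>n<N. lip n f h)" for N f
  proof (induction N)
    case 0
    then show ?case using scale[OF fock.zero_mem, of 0] by (simp add: truncate_0)
  next
    case (Suc N)
    then show ?case unfolding truncate_Suc by (subst add) (simp_all add: comp)
  qed
  have "h \<in> \<F>"
    unfolding mem_Fock
  proof (rule summableI_nonneg_bounded)
    fix N
    let ?S = "\<Sum>n<N. lnorm2 n h"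
    have S0: "0 \<le> ?S" by (intro sum_nonneg level.form_pos) simp
    have "fip (truncate N h) (truncate N h) = (\<Sum>n<N. lip n h h)"
      by (simp add: truncate_fip lip_truncate')
    then have "fnorm (truncate N h) = sqrt ?S" by (simp add: vnorm_def)
    then have "cmod (\<Sum>n<N. lip n h h) \<le> C * sqrt ?S"
      using bound[of "truncate N h"] by (simp add: trunc)
    then have le: "?S \<le> C * sqrt ?S"
      using complex_Re_le_cmod[of "\<Sum>n<N. lip n h h"] by simp
    show "?S \<le> C\<^sup>2"
    proof (cases "?S = 0")
      case False
      then have pos: "sqrt ?S > 0" using S0 by simp
      have "sqrt ?S * sqrt ?S \<le> C * sqrt ?S" using le S0 by simp
      then have "sqrt ?S \<le> C" using pos by (rule mult_right_le_imp_le)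
      then have "(sqrt ?S)\<^sup>2 \<le> C\<^sup>2" using pos by (intro power_mono) auto
      then show ?thesis using S0 by simp
    qed simp
  qed (simp add: level.form_pos)
  moreover have "\<phi> f = fip f h" if f: "f \<in> \<F>" for f
  proof -
    have "(\<lambda>N. \<phi> (truncate N f)) \<longlonglongrightarrow> fip f h"
      unfolding trunc ip_Fock by (rule summable_LIMSEQ[OF summable_lip[OF f \<open>h \<in> \<F>\<close>]])
    moreover have "(\<lambda>N. \<phi> f - \<phi> (truncate N f)) \<longlonglongrightarrow> 0"
    proof (rule Lim_null_comparison)
      have "\<phi> f = \<phi> (\<lambda>w. f w - truncate N f w) + \<phi> (truncate N f)" for N
        using add[OF fock.diff_mem[OF f truncate_Fock] truncate_Fock, of N f N f] by simp
      then have "\<phi> f - \<phi> (truncate N f) = \<phi> (\<lambda>w. f w - truncate N f w)" for N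
        by (simp add: algebra_simps)
      then show "\<forall>\<^sub>F N in sequentially. norm (\<phi> f - \<phi> (truncate N f))
          \<le> C * fnorm (\<lambda>w. f w - truncate N f w)"
        using bound[OF fock.diff_mem[OF f truncate_Fock]] by simp
      show "(\<lambda>N. C * fnorm (\<lambda>w. f w - truncate N f w)) \<longlonglongrightarrow> 0"
        using tendsto_mult_right_zero[OF truncate_tendsto[OF f]] by simp
    qed
    then have "(\<lambda>N. \<phi> f - (\<phi> f - \<phi> (truncate N f))) \<longlonglongrightarrow> \<phi> f - 0"
      by (intro tendsto_intros)
    ultimately show ?thesis using LIMSEQ_unique by fastforce
  qed
  ultimately show ?thesis by blast
qed

sublocale fock: hilbert_functions Fock
  by unfold_locales (fact fip_definite, rule Fock_riesz)

section \<open>Creation, annihilation and field operators on the Fock space\<close>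

lemma create_Fock: "f \<in> \<F> \<Longrightarrow> create i f \<in> \<F>"
  and create_vnorm: "f \<in> \<F> \<Longrightarrow> fnorm (create i f) \<le> sqrt create_bound * fnorm f"
proof -
  assume f: "f \<in> \<F>"
  have le: "\<bar>lnorm2 (Suc n) (create i f)\<bar> \<le> create_bound * lnorm2 n f" for n
    using create_bound[of n i f] level.form_pos[of "create i f" "Suc n"] by simp
  have sf: "summable (\<lambda>n. create_bound * lnorm2 n f)" using f by (intro summable_mult) (simp add: mem_Fock)
  have "summable (\<lambda>n. lnorm2 (Suc n) (create i f))"
    by (rule summable_comparison_test'[OF sf, of 0]) (simp add: le)
  then have s: "summable (\<lambda>n. lnorm2 n (create i f))" by (subst (asm) summable_Suc_iff)
  then show c: "create i f \<in> \<F>" by (simp add: mem_Fock)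
  have "(\<Sum>n. lnorm2 n (create i f)) = (\<Sum>n. lnorm2 (Suc n) (create i f))"
    using suminf_split_head[OF s] by (simp add: level_ip_create_0)
  also have "\<dots> \<le> (\<Sum>n. create_bound * lnorm2 n f)"
    using sf s create_bound by (intro suminf_le) (simp_all only: summable_Suc_iff[of "\<lambda>n. lnorm2 n (create i f)"])
  also have "\<dots> = create_bound * (\<Sum>n. lnorm2 n f)"
    using f by (intro suminf_mult) (simp add: mem_Fock)
  finally show "fnorm (create i f) \<le> sqrt create_bound * fnorm f"
    using f c by (simp add: vnorm_Fock real_sqrt_mult[symmetric])
qed

lemma ann_Fock: "f \<in> \<F> \<Longrightarrow> ann Q i f \<in> \<F>"
  and ann_vnorm: "f \<in> \<F> \<Longrightarrow> fnorm (ann Q i f) \<le> sqrt create_bound * fnorm f"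
proof -
  assume f: "f \<in> \<F>"
  have le: "\<bar>lnorm2 n (ann Q i f)\<bar> \<le> create_bound * lnorm2 (Suc n) f" for n
    using ann_bound[of n i f] level.form_pos[of "ann Q i f" n] by simp
  have sf: "summable (\<lambda>n. lnorm2 n f)" using f by (simp add: mem_Fock)
  then have sf1: "summable (\<lambda>n. lnorm2 (Suc n) f)" by (subst summable_Suc_iff)
  have s: "summable (\<lambda>n. lnorm2 n (ann Q i f))"
    by (rule summable_comparison_test'[OF summable_mult[OF sf1, of create_bound], of 0]) (simp add: le)
  then show c: "ann Q i f \<in> \<F>" by (simp add: mem_Fock)
  have "(\<Sum>n. lnorm2 n (ann Q i f)) \<le> (\<Sum>n. create_bound * lnorm2 (Suc n) f)"
    using sf1 s ann_bound by (intro suminf_le summable_mult) auto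
  also have "\<dots> = create_bound * (\<Sum>n. lnorm2 (Suc n) f)"
    using sf1 by (rule suminf_mult)
  also have "\<dots> \<le> create_bound * (\<Sum>n. lnorm2 n f)"
    using suminf_split_head[OF sf] level.form_pos[of f 0] create_bound_pos
    by (intro mult_left_mono) auto
  finally show "fnorm (ann Q i f) \<le> sqrt create_bound * fnorm f"
    using f c by (simp add: vnorm_Fock real_sqrt_mult[symmetric])
qed

lemma fip_create:
  assumes "f \<in> \<F>" "g \<in> \<F>"
  shows "fip (create i f) g = fip f (ann Q i g)"
  unfolding ip_Fock
  using suminf_split_head[OF summable_lip[OF create_Fock[OF assms(1)] assms(2)], of i]
  by (simp add: level_ip_create_0 level_ip_create)

lemma create_add: "create i (\<lambda>w. f w + g w) = (\<lambda>w. create i f w + create i g w)"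
  by (auto simp: create_def fun_eq_iff split: list.splits)

lemma create_scale: "create i (\<lambda>w. c * f w) = (\<lambda>w. c * create i f w)"
  by (auto simp: create_def fun_eq_iff split: list.splits)

lemma ann_add: "ann Q i (\<lambda>w. f w + g w) v = ann Q i f v + ann Q i g v"
  by (induction v arbitrary: f g) (simp_all add: algebra_simps)

lemma ann_scale: "ann Q i (\<lambda>w. c * f w) v = c * ann Q i f v"
  by (induction v arbitrary: f) (simp_all add: algebra_simps)

lemma creation_eq: "creation Q i = restrict (create i) \<F>"
  by (simp add: creation_def create_def[abs_def])

lemma creation_bounded: "creation Q i \<in> fock.BO"
  unfolding creation_eq
  by (rule fock.boI[where C = "sqrt create_bound"])
    (auto simp: create_Fock create_vnorm create_add create_scale fock.add_mem fock.scale_mem)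

lemma annihilation_bounded: "restrict (ann Q i) \<F> \<in> fock.BO"
  by (rule fock.boI[where C = "sqrt create_bound"])
    (auto simp: ann_Fock ann_vnorm ann_add ann_scale fock.add_mem fock.scale_mem)

lemma adjoint_creation: "op_adjoint Fock (creation Q i) = restrict (ann Q i) \<F>"
  by (rule fock.op_adjoint_eqI[OF annihilation_bounded]) (simp add: creation_eq fip_create)

definition field :: "'n \<Rightarrow> ('n list \<Rightarrow> complex) \<Rightarrow> 'n list \<Rightarrow> complex" where
  "field i f w = create i f w + ann Q i f w"

lemma q_gaussian_eq: "q_gaussian Q i = restrict (field i) \<F>"
  unfolding q_gaussian_def adjoint_creation unfolding op_plus_def creation_eq field_def[abs_def]
  by (auto simp: fun_eq_iff restrict_def)

lemma q_gaussian_bounded: "q_gaussian Q i \<in> fock.BO"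
  unfolding q_gaussian_def adjoint_creation
  by (intro fock.op_plus_bo creation_bounded annihilation_bounded)

lemma field_Fock: "f \<in> \<F> \<Longrightarrow> field i f \<in> \<F>"
  unfolding field_def[abs_def] by (intro fock.add_mem create_Fock ann_Fock)

lemma fip_field:
  assumes "f \<in> \<F>" "g \<in> \<F>"
  shows "fip (field i f) g = fip f (field i g)"
proof -
  have "fip (ann Q i f) g = fip f (create i g)"
    using fip_create[OF assms(2,1), of i] fock.form_cnj[of "create i g" f] fock.form_cnj[of g "ann Q i f"]
      assms by (simp add: create_Fock ann_Fock)
  then show ?thesis
    using assms unfolding field_def[abs_def]
    by (simp add: fock.form_add fock.form_add_right create_Fock ann_Fock fip_create)
qed

lemma adjoint_q_gaussian: "op_adjoint Fock (q_gaussian Q i) = q_gaussian Q i"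
  by (rule fock.op_adjoint_eqI[OF q_gaussian_bounded]) (simp add: q_gaussian_eq fip_field)

end

section \<open>Right field operators and cyclicity of the vacuum\<close>

text \<open>Reversal of words. Right operators are defined by conjugating left ones with it.\<close>

definition reflect :: "('a list \<Rightarrow> complex) \<Rightarrow> 'a list \<Rightarrow> complex" where
  "reflect f w = f (rev w)"

lemma reflect_reflect [simp]: "reflect (reflect f) = f"
  by (simp add: reflect_def[abs_def])

lemma reflect_add: "reflect (\<lambda>w. f w + g w) = (\<lambda>w. reflect f w + reflect g w)"
  by (simp add: reflect_def[abs_def])

lemma reflect_scale: "reflect (\<lambda>w. c * f w) = (\<lambda>w. c * reflect f w)"
  by (simp add: reflect_def[abs_def])

lemma reflect_delta: "reflect (delta w) = delta (rev w)"
  by (auto simp: fun_eq_iff reflect_def delta_def rev_swap)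

lemma ann_cong:
  assumes "\<And>u. length u = Suc (length v) \<Longrightarrow> f u = g u"
  shows "ann Q i f v = ann Q i g v"
  unfolding ann_eq_sum by (intro sum.cong) (simp_all add: assms)

definition right_create :: "'n \<Rightarrow> ('n list \<Rightarrow> complex) \<Rightarrow> 'n list \<Rightarrow> complex" where
  "right_create j f = reflect (create j (reflect f))"

lemma right_create_simps:
  "right_create j f w = (if w \<noteq> [] \<and> last w = j then f (butlast w) else 0)"
proof (cases w rule: rev_cases)
  case (snoc v k)
  then show ?thesis by (simp add: right_create_def reflect_def)
qed (simp add: right_create_def reflect_def)

lemma create_eq: "create i f w = (if w \<noteq> [] \<and> hd w = i then f (tl w) else 0)"
  by (cases w) auto

lemma create_right_create: "create i (right_create j f) = right_create j (create i f)"
proof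
  fix w show "create i (right_create j f) w = right_create j (create i f) w"
  proof (cases w)
    case (Cons k v)
    then show ?thesis by (cases v rule: rev_cases) (auto simp: right_create_simps create_eq)
  qed (simp add: right_create_simps)
qed

text \<open>The removal of the appended letter happens after passing all of \<open>w\<close>, which
  costs the product of the entries over \<open>w\<close>.\<close>

lemma ann_right_create:
  "ann Q i (right_create j f) w =
     right_create j (ann Q i f) w + (if i = j then of_real (prod_list (map (\<lambda>k. Q $ i $ k) w)) * f w else 0)"
proof (induction w arbitrary: f)
  case Nil
  then show ?case by (simp add: right_create_simps)
next
  case (Cons k v)
  have "ann Q i (\<lambda>u. right_create j f (k # u)) v = ann Q i (right_create j (\<lambda>u. f (k # u))) v"
    by (rule ann_cong) (auto simp: right_create_simps)
  then show ?case
    by (cases "v = []") (auto simp: Cons.IH right_create_simps algebra_simps)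
qed

context mixed_q begin

definition right_ann :: "'n \<Rightarrow> ('n list \<Rightarrow> complex) \<Rightarrow> 'n list \<Rightarrow> complex" where
  "right_ann j f = reflect (ann Q j (reflect f))"

definition right_field :: "'n \<Rightarrow> ('n list \<Rightarrow> complex) \<Rightarrow> 'n list \<Rightarrow> complex" where
  "right_field j f = reflect (field j (reflect f))"

lemma right_field_eq: "right_field j f w = right_create j f w + right_ann j f w"
  by (simp add: right_field_def right_create_def right_ann_def reflect_def field_def)

lemma right_ann_create:
  "right_ann j (create i f) w =
     create i (right_ann j f) w + (if j = i then of_real (prod_list (map (\<lambda>k. Q $ j $ k) w)) * f w else 0)"
proof -
  have "reflect (create i f) = right_create i (reflect f)" by (simp add: right_create_def)
  then have "right_ann j (create i f) w = ann Q j (right_create i (reflect f)) (rev w)"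
    by (simp add: right_ann_def reflect_def[of "ann _ _ _"])
  also have "\<dots> = right_create i (ann Q j (reflect f)) (rev w) +
      (if j = i then of_real (prod_list (map (\<lambda>k. Q $ j $ k) (rev w))) * f w else 0)"
    by (simp add: ann_right_create reflect_def)
  also have "right_create i (ann Q j (reflect f)) (rev w) = create i (right_ann j f) w"
    by (simp add: right_create_def right_ann_def reflect_def)
  also have "prod_list (map (\<lambda>k. Q $ j $ k) (rev w)) = prod_list (map (\<lambda>k. Q $ j $ k) w)"
    by (simp add: rev_map[symmetric])
  finally show ?thesis .
qed

lemma reflect_lnorm2: "lip n (reflect f) (reflect g) = lip n f g"
  unfolding reflect_def[abs_def] by (rule level_ip_rev)

lemma reflect_Fock [simp]: "reflect f \<in> \<F> \<longleftrightarrow> f \<in> \<F>"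
  by (simp add: mem_Fock reflect_lnorm2)

lemma fip_reflect: "fip (reflect f) (reflect g) = fip f g"
  by (simp add: ip_Fock reflect_lnorm2)

lemma fip_reflect_left: "fip (reflect f) g = fip f (reflect g)"
  using fip_reflect[of f "reflect g"] by simp

lemma vnorm_reflect: "fnorm (reflect f) = fnorm f"
  by (simp add: vnorm_def fip_reflect)

lemma right_create_Fock: "f \<in> \<F> \<Longrightarrow> right_create j f \<in> \<F>"
  by (simp add: right_create_def create_Fock)

lemma right_ann_Fock: "f \<in> \<F> \<Longrightarrow> right_ann j f \<in> \<F>"
  by (simp add: right_ann_def ann_Fock)

lemma right_field_Fock: "f \<in> \<F> \<Longrightarrow> right_field j f \<in> \<F>"
  by (simp add: right_field_def field_Fock)

lemma fip_right_create: "\<lbrakk>f \<in> \<F>; g \<in> \<F>\<rbrakk> \<Longrightarrow> fip (right_create j f) g = fip f (right_ann j g)"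
  by (simp add: right_create_def right_ann_def fip_reflect_left[of "create _ _"] fip_create)
    (simp add: fip_reflect_left)

lemma fip_right_field: "\<lbrakk>f \<in> \<F>; g \<in> \<F>\<rbrakk> \<Longrightarrow> fip (right_field j f) g = fip f (right_field j g)"
  by (simp add: right_field_def fip_reflect_left[of "field _ _"] fip_field)
    (simp add: fip_reflect_left)

text \<open>The annihilation operators commute because their adjoints do.\<close>

lemma ann_right_ann:
  assumes f: "f \<in> \<F>"
  shows "ann Q i (right_ann j f) = right_ann j (ann Q i f)"
proof (rule fock.vec_eqI)
  fix h assume h: "h \<in> \<F>"
  have cnj1: "fip (ann Q i g) h = fip g (create i h)" if "g \<in> \<F>" "h \<in> \<F>" for g h
    using fip_create[OF that(2,1), of i] fock.form_cnj[of "create i h" g] fock.form_cnj[of h "ann Q i g"] that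
    by (simp add: create_Fock ann_Fock)
  have cnj2: "fip (right_ann j g) h = fip g (right_create j h)" if "g \<in> \<F>" "h \<in> \<F>" for g h
    using fip_right_create[OF that(2,1), of j] fock.form_cnj[of "right_create j h" g]
      fock.form_cnj[of h "right_ann j g"] that by (simp add: right_create_Fock right_ann_Fock)
  show "fip (ann Q i (right_ann j f)) h = fip (right_ann j (ann Q i f)) h"
    using f h by (simp add: cnj1 cnj2 create_Fock ann_Fock right_create_Fock right_ann_Fock
        create_right_create)
qed (simp_all add: f ann_Fock right_ann_Fock)

text \<open>Left and right creation commute, and so do left and right annihilation. For
  \<open>i = j\<close> each mixed pair contributes the same diagonal operator, a product of entries
  of \<open>Q\<close> over the word, once on either side of the equation.\<close>

lemma field_right_field:
  assumes "f \<in> \<F>"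
  shows "field i (right_field j f) = right_field j (field i f)"
proof
  fix w
  have radd: "right_create j (\<lambda>w. f w + g w) v = right_create j f v + right_create j g v"
    "right_ann j (\<lambda>w. f w + g w) v = right_ann j f v + right_ann j g v" for f g v
    by (simp_all add: right_create_def right_ann_def reflect_add create_add ann_add
        reflect_def[of "\<lambda>w. _ w + _ w"] reflect_def[of "create _ _"] reflect_def[of "ann _ _ _"])
  have "field i (right_field j f) w =
      create i (right_create j f) w + create i (right_ann j f) w +
      ann Q i (right_create j f) w + ann Q i (right_ann j f) w"
    unfolding field_def right_field_eq[abs_def] create_add ann_add by simp
  also have "\<dots> = right_create j (create i f) w + right_ann j (create i f) w +
      right_create j (ann Q i f) w + right_ann j (ann Q i f) w"
    using assms
    by (simp add: create_right_create ann_right_ann right_ann_create ann_right_create)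
  also have "\<dots> = right_field j (field i f) w"
    unfolding right_field_eq field_def[abs_def] radd by simp
  finally show "field i (right_field j f) w = right_field j (field i f) w" .
qed

definition right_gaussian :: "'n \<Rightarrow> 'n list operator" where
  "right_gaussian j = restrict (right_field j) \<F>"

lemma right_gaussian_bounded: "right_gaussian j \<in> fock.BO"
proof -
  obtain C where C: "\<And>f. f \<in> \<F> \<Longrightarrow> fnorm (q_gaussian Q j f) \<le> C * fnorm f"
    using fock.bo_bound[OF q_gaussian_bounded[of j]] by metis
  have add: "field j (\<lambda>w. f w + g w) = (\<lambda>w. field j f w + field j g w)" for f g
    by (simp add: field_def[abs_def] create_add ann_add algebra_simps)
  have scale: "field j (\<lambda>w. c * f w) = (\<lambda>w. c * field j f w)" for c f
    by (simp add: field_def[abs_def] create_scale ann_scale algebra_simps)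
  show ?thesis
    unfolding right_gaussian_def
  proof (rule fock.boI[where C = C])
    show "fnorm (restrict (right_field j) \<F> f) \<le> C * fnorm f" if "f \<in> \<F>" for f
      using C[of "reflect f"] that by (simp add: right_field_def vnorm_reflect q_gaussian_eq)
  qed (auto simp: right_field_Fock field_Fock right_field_def reflect_add reflect_scale add scale
      fock.add_mem fock.scale_mem)
qed

lemma adjoint_right_gaussian: "op_adjoint Fock (right_gaussian j) = right_gaussian j"
  by (rule fock.op_adjoint_eqI[OF right_gaussian_bounded]) (simp add: right_gaussian_def fip_right_field)

section \<open>The algebra, its commutant and the vacuum\<close>

abbreviation "\<Gamma> \<equiv> mixed_q_gaussian_algebra Q"

lemma von_neumann_\<Gamma>: "von_neumann_algebra Fock \<Gamma>"
  unfolding mixed_q_gaussian_algebra_def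
  by (rule fock.von_neumann_vn_generated) (auto simp: q_gaussian_bounded)

lemma \<Gamma>_bounded: "\<Gamma> \<subseteq> fock.BO"
  using von_neumann_\<Gamma> by (auto simp: von_neumann_algebra_def star_subalgebra_def)

text \<open>The commutant of a self-adjoint operator is a von Neumann algebra, so it contains the
  generated algebra as soon as it contains the generators.\<close>

lemma right_gaussian_commutant: "right_gaussian j \<in> commutant Fock \<Gamma>"
proof -
  have "von_neumann_algebra Fock (commutant Fock {right_gaussian j})"
    by (rule fock.von_neumann_commutant) (auto simp: right_gaussian_bounded adjoint_right_gaussian)
  moreover have "q_gaussian Q i \<in> commutant Fock {right_gaussian j}" for i
  proof (rule fock.commutantI[OF q_gaussian_bounded])
    fix B f assume "B \<in> {right_gaussian j}" "f \<in> \<F>"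
    then show "q_gaussian Q i (B f) = B (q_gaussian Q i f)"
      by (simp add: right_gaussian_def q_gaussian_eq right_field_Fock field_Fock field_right_field)
  qed (simp add: right_gaussian_bounded)
  ultimately have "\<Gamma> \<subseteq> commutant Fock {right_gaussian j}"
    unfolding mixed_q_gaussian_algebra_def by (intro fock.vn_generated_least) auto
  then show ?thesis using right_gaussian_bounded by (auto simp: commutant_def)
qed

abbreviation "\<Omega> \<equiv> delta ([] :: 'n list)"

text \<open>Induction on the word length: a creation operator is a field operator minus an
  annihilation operator, and both are applied to functions on shorter words over \<open>J\<close>.
  The set \<open>D\<close> is kept abstract to serve for vacuum orbits of left algebras and for
  reflected orbits of the commutant.\<close>

lemma field_closed_contains:
  assumes add: "\<And>f g. \<lbrakk>f \<in> D; g \<in> D\<rbrakk> \<Longrightarrow> (\<lambda>w. f w + g w) \<in> D"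
    and scale: "\<And>c f. f \<in> D \<Longrightarrow> (\<lambda>w. c * f w) \<in> D"
    and vac: "\<Omega> \<in> D"
    and closed: "\<And>j f. \<lbrakk>j \<in> J; f \<in> D\<rbrakk> \<Longrightarrow> field j f \<in> D"
    and f: "\<And>w. length w \<ge> n \<or> \<not> set w \<subseteq> J \<Longrightarrow> f w = 0"
  shows "f \<in> D"
  using f
proof (induction n arbitrary: f)
  case 0
  then have "f = (\<lambda>w. 0 * \<Omega> w)" by auto
  then show ?case using scale[OF vac] by metis
next
  case (Suc n)
  have zero: "(\<lambda>w. 0) \<in> D" using scale[OF vac, of 0] by simp
  have sum: "(\<lambda>w. \<Sum>j\<in>J'. h j w) \<in> D" if "finite J'" "\<And>j. j \<in> J' \<Longrightarrow> h j \<in> D" for J' :: "'n set" and h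
    using that by (induction J' rule: finite_induct) (auto simp: zero intro!: add)
  define F where "F j u = f (j # u)" for j u
  have F: "F j \<in> D" if "j \<in> J" for j
    using Suc.prems that by (intro Suc.IH) (auto simp: F_def)
  have A: "ann Q j (F j) \<in> D" if j: "j \<in> J" for j
  proof (rule Suc.IH)
    fix w assume w: "n \<le> length w \<or> \<not> set w \<subseteq> J"
    have "F j (take k w @ j # drop k w) = 0" if "k \<le> length w" for k
    proof -
      have "set w \<subseteq> set (take k w @ j # drop k w)"
        using set_append[of "take k w" "drop k w"] by auto
      then show ?thesis using w unfolding F_def by (intro Suc.prems) auto
    qed
    then show "ann Q j (F j) w = 0" by (simp add: ann_eq_sum)
  qed
  have eq: "f w = f [] * \<Omega> w + ((\<Sum>j\<in>J. field j (F j) w) + (-1) * (\<Sum>j\<in>J. ann Q j (F j) w))" for w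
  proof -
    have "(\<Sum>j\<in>J. field j (F j) w) + (-1) * (\<Sum>j\<in>J. ann Q j (F j) w) = (\<Sum>j\<in>J. create j (F j) w)"
      by (simp add: field_def sum.distrib)
    also have "f [] * \<Omega> w + \<dots> = f w"
    proof (cases w)
      case (Cons k v)
      then have "(\<Sum>j\<in>J. create j (F j) w) = (if k \<in> J then f w else 0)"
        by (simp add: F_def)
      then show ?thesis using Suc.prems[of w] Cons by (auto simp: delta_def)
    qed (simp add: delta_def)
    finally show ?thesis by simp
  qed
  have "f = (\<lambda>w. f [] * \<Omega> w + ((\<Sum>j\<in>J. field j (F j) w) + (-1) * (\<Sum>j\<in>J. ann Q j (F j) w)))"
    by (rule ext) (rule eq)
  also have "\<dots> \<in> D"
    by (intro add scale vac sum finite closed F A)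
  finally show ?case .
qed

lemma field_restrict: "f \<in> \<F> \<Longrightarrow> q_gaussian Q j f = field j f"
  by (simp add: q_gaussian_eq)

lemma op_vacuum_dense:
  assumes A: "star_subalgebra Fock A" "op_one Fock \<in> A" "\<And>j. j \<in> J \<Longrightarrow> q_gaussian Q j \<in> A"
    and f: "\<And>w. length w \<ge> n \<or> \<not> set w \<subseteq> J \<Longrightarrow> f w = 0"
  shows "\<exists>a\<in>A. a \<Omega> = f"
proof -
  have "f \<in> {a \<Omega> | a. a \<in> A}"
  proof (rule field_closed_contains[where J = J and n = n])
    show "\<Omega> \<in> {a \<Omega> | a. a \<in> A}"
      using A(2) by (auto intro!: exI[of _ "op_one Fock"] simp: fock.op_one_apply)
    show "(\<lambda>w. f w + g w) \<in> {a \<Omega> | a. a \<in> A}" if fg: "f \<in> {a \<Omega> | a. a \<in> A}" "g \<in> {a \<Omega> | a. a \<in> A}" for f g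
    proof -
      obtain a b where "a \<in> A" "b \<in> A" "f = a \<Omega>" "g = b \<Omega>" using fg by auto
      then show ?thesis
        using A(1) unfolding star_subalgebra_def
        by (intro CollectI exI[of _ "op_plus Fock a b"]) (simp add: fock.op_plus_apply)
    qed
    show "(\<lambda>w. c * f w) \<in> {a \<Omega> | a. a \<in> A}" if fg: "f \<in> {a \<Omega> | a. a \<in> A}" for c f
    proof -
      obtain a where "a \<in> A" "f = a \<Omega>" using fg by auto
      then show ?thesis
        using A(1) unfolding star_subalgebra_def
        by (intro CollectI exI[of _ "op_scale Fock c a"]) (simp add: fock.op_scale_apply)
    qed
    show "field j f \<in> {a \<Omega> | a. a \<in> A}" if j: "j \<in> J" and f: "f \<in> {a \<Omega> | a. a \<in> A}" for j f
    proof -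
      obtain a where a: "a \<in> A" "f = a \<Omega>" using f by auto
      then have "f \<in> \<F>" using A(1) fock.bo_mem[OF _ delta_Fock] by (auto simp: star_subalgebra_def)
      then have "field j f = op_mult Fock (q_gaussian Q j) a \<Omega>"
        using a by (simp add: fock.op_mult_apply field_restrict)
      moreover have "op_mult Fock (q_gaussian Q j) a \<in> A"
        using A(1) A(3)[OF j] a by (auto simp: star_subalgebra_def)
      ultimately show ?thesis by auto
    qed
  qed (rule f)
  then show ?thesis by auto
qed

text \<open>The vacuum is cyclic for the commutant: after reflection its orbit is stable under the
  left field operators, because right multiplication by a generator stays in the commutant. Every
  component of \<open>f\<close> is therefore attained and orthogonal to \<open>f\<close>.\<close>

lemma commutant_vacuum_total:
  assumes f: "f \<in> \<F>" and orth: "\<And>z. z \<in> commutant Fock \<Gamma> \<Longrightarrow> fip f (z \<Omega>) = 0"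
  shows "f = (\<lambda>_. 0)"
proof -
  have star: "star_subalgebra Fock (commutant Fock \<Gamma>)"
    using von_neumann_\<Gamma> by (intro fock.star_subalgebra_commutant \<Gamma>_bounded)
      (auto simp: von_neumann_algebra_def star_subalgebra_def)
  have one: "op_one Fock \<in> commutant Fock \<Gamma>"
    using \<Gamma>_bounded by (intro fock.commutantI)
      (auto simp: fock.op_one_bo fock.op_one_apply fock.bo_mem subsetD)
  let ?D = "{reflect (z \<Omega>) | z. z \<in> commutant Fock \<Gamma>}"
  have *: "\<exists>z\<in>commutant Fock \<Gamma>. component n f = z \<Omega>" for n
  proof -
    have "reflect (component n f) \<in> ?D"
    proof (rule field_closed_contains[where J = UNIV and n = "Suc n"])
      show "\<Omega> \<in> ?D"
        using one by (auto intro!: exI[of _ "op_one Fock"] simp: fock.op_one_apply reflect_delta)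
      show "(\<lambda>w. f w + g w) \<in> ?D" if fg: "f \<in> ?D" "g \<in> ?D" for f g
      proof -
        obtain a b where "a \<in> commutant Fock \<Gamma>" "b \<in> commutant Fock \<Gamma>"
          "f = reflect (a \<Omega>)" "g = reflect (b \<Omega>)" using fg by auto
        then show ?thesis
          using star unfolding star_subalgebra_def
          by (intro CollectI exI[of _ "op_plus Fock a b"]) (simp add: fock.op_plus_apply reflect_add)
      qed
      show "(\<lambda>w. c * f w) \<in> ?D" if fg: "f \<in> ?D" for c f
      proof -
        obtain a where "a \<in> commutant Fock \<Gamma>" "f = reflect (a \<Omega>)" using fg by auto
        then show ?thesis
          using star unfolding star_subalgebra_def
          by (intro CollectI exI[of _ "op_scale Fock c a"]) (simp add: fock.op_scale_apply reflect_scale)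
      qed
      show "field j f \<in> ?D" if f: "f \<in> ?D" for j f
      proof -
        obtain a where a: "a \<in> commutant Fock \<Gamma>" "f = reflect (a \<Omega>)" using f by auto
        then have aO: "a \<Omega> \<in> \<F>" by (auto simp: commutant_def fock.bo_mem)
        then have "field j f = reflect (op_mult Fock (right_gaussian j) a \<Omega>)"
          using a by (simp add: fock.op_mult_apply right_gaussian_def right_field_def)
        moreover have "op_mult Fock (right_gaussian j) a \<in> commutant Fock \<Gamma>"
          using star right_gaussian_commutant a by (auto simp: star_subalgebra_def)
        ultimately show ?thesis by auto
      qed
    qed (auto simp: reflect_def component_def)
    then obtain z where z: "z \<in> commutant Fock \<Gamma>" "reflect (component n f) = reflect (z \<Omega>)" by auto
    then have "component n f = z \<Omega>" by (metis reflect_reflect)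
    then show ?thesis using z by auto
  qed
  have "fip f (component n f) = 0" for n
    using *[of n] orth by auto
  then have "lip n f f = 0" for n
    using fock.form_cnj[of "component n f" f] f component_fip[of n f f] by simp
  then have "fip f f = 0" by (simp add: ip_Fock)
  then show ?thesis by (rule fip_definite[OF f])
qed

end

section \<open>A two-parameter recurrence\<close>

text \<open>For \<open>0 \<le> x \<le> a\<close> one has
  \<open>exp (- (x / (1 - a))) \<le> 1 - x\<close>, and the exponents form a geometric
  series.\<close>

lemma prod_lower_bound:
  fixes a r :: real
  assumes a: "0 \<le> a" "a < 1" and r: "0 \<le> r" "r < 1"
  shows "\<exists>\<delta>>0. \<forall>n. \<delta> \<le> (\<Prod>j<n. 1 - a * r ^ j)"
proof (intro exI conjI allI)
  let ?b = "a / (1 - a)"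
  show "0 < exp (- ?b / (1 - r))" by simp
  fix n
  have "exp (- ?b * (\<Sum>j<n. r ^ j)) = (\<Prod>j<n. exp (- ?b * r ^ j))"
    by (simp add: sum_distrib_left exp_sum)
  also have "\<dots> \<le> (\<Prod>j<n. 1 - a * r ^ j)"
  proof (intro prod_mono conjI)
    fix j
    have rj: "0 \<le> r ^ j" "r ^ j \<le> 1" using r by (auto intro: power_le_one)
    let ?x = "a * r ^ j"
    have x: "0 \<le> ?x" "?x \<le> a" using a rj mult_left_le[of "r ^ j" a] by auto
    have "1 / (1 - ?x) = 1 + ?x / (1 - ?x)" using x a by (simp add: field_simps)
    also have "\<dots> \<le> 1 + ?x / (1 - a)" using x a by (intro add_left_mono divide_left_mono) auto
    also have "\<dots> \<le> exp (?x / (1 - a))" by (rule exp_ge_add_one_self)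
    finally have "exp (- (?x / (1 - a))) \<le> 1 - ?x"
      using x a by (simp add: exp_minus field_simps)
    then show "exp (- ?b * r ^ j) \<le> 1 - ?x" by simp
  qed simp
  finally have le: "exp (- ?b * (\<Sum>j<n. r ^ j)) \<le> (\<Prod>j<n. 1 - a * r ^ j)" .
  have "(\<Sum>j<n. r ^ j) \<le> 1 / (1 - r)"
    using r sum_gp_strict[of r n] by (simp add: divide_right_mono)
  then have "?b * (\<Sum>j<n. r ^ j) \<le> ?b * (1 / (1 - r))"
    using a by (intro mult_left_mono) auto
  then have "exp (- ?b / (1 - r)) \<le> exp (- ?b * (\<Sum>j<n. r ^ j))" by simp
  then show "exp (- ?b / (1 - r)) \<le> (\<Prod>j<n. 1 - a * r ^ j)" using le by linarith
qed

lemma prod_upper_bound: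
  fixes a r :: real
  assumes a: "0 \<le> a" and r: "0 \<le> r" "r < 1"
  shows "(\<Prod>j<n. 1 + a * r ^ j) \<le> exp (a / (1 - r))"
proof -
  have "(\<Prod>j<n. 1 + a * r ^ j) \<le> (\<Prod>j<n. exp (a * r ^ j))"
    using a r by (intro prod_mono conjI exp_ge_add_one_self) auto
  also have "\<dots> = exp (a * (\<Sum>j<n. r ^ j))" by (simp add: sum_distrib_left exp_sum)
  also have "\<dots> \<le> exp (a * (1 / (1 - r)))"
  proof -
    have "(\<Sum>j<n. r ^ j) \<le> 1 / (1 - r)"
      using r sum_gp_strict[of r n] by (simp add: divide_right_mono)
    then show ?thesis using a by (simp add: mult_left_mono del: times_divide_eq_right)
  qed
  finally show ?thesis by simp
qed

text \<open>The q-Pochhammer symbol (q; q)_m.\<close>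

definition q_poch :: "real \<Rightarrow> nat \<Rightarrow> real" where
  "q_poch q m = (\<Prod>j<m. 1 - q ^ Suc j)"

lemma q_poch_simps [simp]: "q_poch q 0 = 1" "q_poch q (Suc m) = q_poch q m * (1 - q ^ Suc m)"
  by (simp_all add: q_poch_def)

lemma power_abs_less_1: "\<bar>q\<bar> < 1 \<Longrightarrow> \<bar>q ^ Suc j\<bar> < (1::real)"
  unfolding power_abs using power_less_one_iff[of "\<bar>q\<bar>" "Suc j"] by simp

lemma q_poch_pos: "\<bar>q\<bar> < 1 \<Longrightarrow> 0 < q_poch q m"
  unfolding q_poch_def using power_abs_less_1[of q]
  by (intro prod_pos) (simp add: abs_less_iff del: power_Suc)

lemma q_poch_bounds:
  assumes q: "\<bar>q\<bar> < 1"
  obtains c C where "0 < c" "\<And>m. c \<le> q_poch q m" "\<And>m. q_poch q m \<le> C"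
proof -
  obtain c where c: "0 < c" "\<And>n. c \<le> (\<Prod>j<n. 1 - \<bar>q\<bar> * \<bar>q\<bar> ^ j)"
    using prod_lower_bound[of "\<bar>q\<bar>" "\<bar>q\<bar>"] q by auto
  have abs: "\<bar>q ^ Suc j\<bar> = \<bar>q\<bar> * \<bar>q\<bar> ^ j" for j by (simp add: abs_mult power_abs)
  have "(\<Prod>j<m. 1 - \<bar>q\<bar> * \<bar>q\<bar> ^ j) \<le> q_poch q m" for m
    unfolding q_poch_def
  proof (intro prod_mono conjI)
    fix j
    show "0 \<le> 1 - \<bar>q\<bar> * \<bar>q\<bar> ^ j" using power_abs_less_1[OF q, of j] unfolding abs by simp
    show "1 - \<bar>q\<bar> * \<bar>q\<bar> ^ j \<le> 1 - q ^ Suc j" using abs[of j] abs_ge_self[of "q ^ Suc j"] by linarith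
  qed
  moreover have "q_poch q m \<le> (\<Prod>j<m. 1 + \<bar>q\<bar> * \<bar>q\<bar> ^ j)" for m
    unfolding q_poch_def
  proof (intro prod_mono conjI)
    fix j
    show "0 \<le> 1 - q ^ Suc j" using power_abs_less_1[OF q, of j] by (simp add: abs_less_iff del: power_Suc)
    show "1 - q ^ Suc j \<le> 1 + \<bar>q\<bar> * \<bar>q\<bar> ^ j" using abs[of j] abs_ge_minus_self[of "q ^ Suc j"] by linarith
  qed
  then have "q_poch q m \<le> exp (\<bar>q\<bar> / (1 - \<bar>q\<bar>))" for m
    using prod_upper_bound[of "\<bar>q\<bar>" "\<bar>q\<bar>" m] q by (meson abs_ge_zero order_trans)
  ultimately show ?thesis using that[of c] c by (meson order_trans)
qed

text \<open>
  By Jacobi's triple product, the differences of consecutive values are, up to a constant, the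
  Fourier coefficients of the orthogonality weight of the continuous \<open>q\<close>-Hermite polynomials.
\<close>

definition theta :: "real \<Rightarrow> int \<Rightarrow> real" where
  "theta q k = (-1) ^ nat \<bar>k\<bar> * q ^ nat (k * (k + 1) div 2)"

lemma theta_pos_step:
  assumes "k \<ge> 1" shows "theta q k = - (q ^ nat k) * theta q (k - 1)"
proof -
  have "k * (k + 1) = (k - 1) * (k - 1 + 1) + k * 2" by (simp add: algebra_simps)
  then have "k * (k + 1) div 2 = (k - 1) * (k - 1 + 1) div 2 + k" by simp
  moreover have "0 \<le> (k - 1) * (k - 1 + 1) div 2" using assms by simp
  ultimately have n1: "nat (k * (k + 1) div 2) = nat k + nat ((k - 1) * (k - 1 + 1) div 2)"
    using assms by (simp add: nat_add_distrib)
  have n2: "nat \<bar>k\<bar> = Suc (nat \<bar>k - 1\<bar>)" using assms by simp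
  show ?thesis unfolding theta_def n1 n2 power_add power_Suc by simp
qed

text \<open>The number k (k + 1) is unchanged under the reflection while the parity of k changes.
  Negative indices are reduced to nonnegative ones in this way.\<close>

lemma theta_reflect: "theta q (- 1 - k) = - theta q k"
proof -
  have e: "(- 1 - k) * (- 1 - k + 1) = k * (k + 1)" by (simp add: algebra_simps)
  have "(-1::real) ^ nat \<bar>- 1 - k\<bar> = - ((-1) ^ nat \<bar>k\<bar>)"
  proof (cases "k \<ge> 0")
    case True
    then have "nat \<bar>- 1 - k\<bar> = Suc (nat \<bar>k\<bar>)" by simp
    then show ?thesis by (simp only: power_Suc mult_minus1)
  next
    case False
    then have "nat \<bar>k\<bar> = Suc (nat \<bar>- 1 - k\<bar>)" by simp
    then show ?thesis by (simp only: power_Suc mult_minus1 minus_minus)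
  qed
  then show ?thesis unfolding theta_def e by simp
qed

text \<open>Formally this is the ratio \<open>- (q ^ k)\<close> of consecutive values, multiplied by
  \<open>q ^ a\<close> or \<open>q ^ b\<close> with \<open>k = M - a = b - M\<close>. This form has
  no negative powers, so it covers negative \<open>k\<close> and \<open>q = 0\<close> as
  well.\<close>

lemma theta_shift:
  assumes "a + b = 2 * M" "k = int M - int a"
  shows "theta q k * q ^ a = - (q ^ M) * theta q (k - 1)"
    and "theta q (k - 1) * q ^ b = - (q ^ M) * theta q k"
proof -
  have up: "theta q k * q ^ a = - (q ^ M) * theta q (k - 1)" if "k = int M - int a" "a \<le> 2 * M" for a k
  proof (cases "k \<ge> 1")
    case True
    then have "M = a + nat k" using that by simp
    then have "q ^ M = q ^ a * q ^ nat k" by (simp only: power_add)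
    then show ?thesis using theta_pos_step[OF True, of q] by simp
  next
    case False
    have a: "a = M + nat (- k)" using that False by linarith
    have refl: "theta q (k - 1) = - theta q (- k)" "theta q k = - theta q (- k - 1)"
      using theta_reflect[of q "- k"] theta_reflect[of q "- k - 1"] by simp_all
    have "theta q (- k) = - (q ^ nat (- k)) * theta q (- k - 1)"
    proof (cases "k = 0")
      case True
      then show ?thesis using refl by simp
    qed (use False theta_pos_step[of "- k" q] in simp)
    then show ?thesis unfolding refl by (simp add: a power_add)
  qed
  show "theta q k * q ^ a = - (q ^ M) * theta q (k - 1)" using assms by (intro up) auto
  have "theta q (- k) * q ^ b = - (q ^ M) * theta q (- k - 1)" using assms by (intro up) auto
  then show "theta q (k - 1) * q ^ b = - (q ^ M) * theta q k"
    using theta_reflect[of q "- k - 1"] theta_reflect[of q "k - 1"] by simp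
qed

lemma sum_power_inj_le:
  fixes r :: real
  assumes "finite A" "inj_on h A" "0 \<le> r" "r < 1"
  shows "(\<Sum>a\<in>A. r ^ h a) \<le> 1 / (1 - r)"
proof -
  have "(\<Sum>a\<in>A. r ^ h a) = (\<Sum>n\<in>h ` A. r ^ n)" using assms(2) by (simp add: sum.reindex)
  also have "\<dots> \<le> (\<Sum>n. r ^ n)" using assms by (intro sum_le_suminf summable_geometric) auto
  finally show ?thesis using assms by (simp add: suminf_geometric)
qed

text \<open>Quadratic exponents are weakened to linear ones: a triangular number is at least its
  index, and negative indices are reflected.\<close>

lemma theta_abs_le:
  assumes "\<bar>q\<bar> < 1"
  shows "\<bar>theta q k\<bar> \<le> \<bar>q\<bar> ^ nat (if 0 \<le> k then k else - 1 - k)"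
proof -
  have "\<bar>theta q k\<bar> \<le> \<bar>q\<bar> ^ nat k" if "k \<ge> 0" for k
  proof -
    have "k * 2 \<le> k * (k + 1)" using that by (cases "k = 0") auto
    then have "nat k \<le> nat (k * (k + 1) div 2)" by (intro nat_mono) simp
    then show ?thesis using assms by (auto simp: theta_def abs_mult power_abs intro!: power_decreasing)
  qed
  from this[of k] this[of "- 1 - k"] show ?thesis using theta_reflect[of q k] by auto
qed

lemma theta_sum_le:
  assumes q: "\<bar>q\<bar> < 1"
  shows "(\<Sum>a\<le>n. \<bar>theta q (K - int a)\<bar>) \<le> 2 / (1 - \<bar>q\<bar>)"
proof -
  let ?h = "\<lambda>a. nat (if 0 \<le> K - int a then K - int a else - 1 - (K - int a))"
  let ?A = "{a. a \<le> n \<and> 0 \<le> K - int a}" and ?B = "{a. a \<le> n \<and> \<not> 0 \<le> K - int a}"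
  have "(\<Sum>a\<le>n. \<bar>theta q (K - int a)\<bar>) \<le> (\<Sum>a\<le>n. \<bar>q\<bar> ^ ?h a)"
    by (intro sum_mono theta_abs_le q)
  also have "\<dots> = (\<Sum>a\<in>?A. \<bar>q\<bar> ^ ?h a) + (\<Sum>a\<in>?B. \<bar>q\<bar> ^ ?h a)"
    by (subst sum.union_disjoint[symmetric]) (auto intro!: sum.cong)
  also have "\<dots> \<le> 1 / (1 - \<bar>q\<bar>) + 1 / (1 - \<bar>q\<bar>)"
    using q by (intro add_mono sum_power_inj_le) (auto simp: inj_on_def)
  finally show ?thesis by simp
qed

text \<open>
  Summed over \<open>m + k = 2 M + 1\<close> with the weights \<open>theta q (M - m)\<close>, the recurrence relates the
  weighted sum over level \<open>2 M + 2\<close> to the one over level \<open>2 M\<close>.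
\<close>

lemma theta_recurrence_solution:
  fixes f :: "nat \<Rightarrow> nat \<Rightarrow> complex" and q c :: real
  assumes rec: "\<And>m k. of_real (1 - q ^ Suc m) * f (Suc m) k - of_real (1 - q ^ Suc k) * f m (Suc k) =
      (if k = 0 then 0 else of_real (1 - c * q ^ m) * f m (k - 1)) -
      (if m = 0 then 0 else of_real (1 - c * q ^ k) * f (m - 1) k)"
  shows "complex_of_real (q_poch q M) *
      (\<Sum>a\<le>2 * M. of_real (theta q (int M - int a) - theta q (int M - int a - 1)) * f a (2 * M - a)) =
      complex_of_real (\<Prod>j<M. 1 - c * q ^ j) * (2 * f 0 0)"
proof (induction M)
  case 0
  show ?case by (simp add: theta_def)
next
  case (Suc M)
  define \<Phi> where "\<Phi> M = (\<Sum>a\<le>2 * M.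
    of_real (theta q (int M - int a) - theta q (int M - int a - 1)) * f a (2 * M - a))" for M
  define g where "g a = theta q (int M - int a)" for a
  let ?n = "2 * M"
  have g1: "theta q (int M - int a - 1) = g (Suc a)" for a
    by (simp add: g_def algebra_simps)
  have A: "of_real (1 - q ^ Suc M) * \<Phi> (Suc M) = (\<Sum>m\<le>Suc ?n. of_real (g m) *
      (of_real (1 - q ^ Suc m) * f (Suc m) (Suc ?n - m) - of_real (1 - q ^ Suc (Suc ?n - m)) * f m (Suc (Suc ?n - m))))"
  proof -
    define G where "G a = theta q (int (Suc M) - int a)" for a
    have Gs: "G (Suc a) = g a" for a by (simp add: G_def g_def)
    have G1: "theta q (int (Suc M) - int a - 1) = g a" for a
      by (simp add: g_def algebra_simps)
    \<comment> \<open>Both parts of \<open>theta_shift\<close> combine so that the factors depending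
      on \<open>a\<close> become the constant \<open>1 - q ^ Suc M\<close>.\<close>
    have shift: "G a * (1 - q ^ a) - g a * (1 - q ^ (2 * Suc M - a)) = (1 - q ^ Suc M) * (G a - g a)"
      if "a \<le> 2 * Suc M" for a
      using theta_shift[of a "2 * Suc M - a" "Suc M" "int (Suc M) - int a" q] that
      unfolding G1 G_def[symmetric] by (simp add: algebra_simps)
    have "of_real (1 - q ^ Suc M) * \<Phi> (Suc M) =
        (\<Sum>a\<le>2 * Suc M. of_real ((1 - q ^ Suc M) * (G a - g a)) * f a (2 * Suc M - a))"
      unfolding \<Phi>_def G1 G_def[symmetric] sum_distrib_left
      by (intro sum.cong) (simp_all add: mult.assoc)
    also have "\<dots> = (\<Sum>a\<le>2 * Suc M. of_real (G a * (1 - q ^ a) - g a * (1 - q ^ (2 * Suc M - a))) * f a (2 * Suc M - a))"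
      by (intro sum.cong refl) (simp only: shift atMost_iff)
    also have "\<dots> = (\<Sum>a\<le>Suc (Suc ?n). of_real (G a * (1 - q ^ a)) * f a (Suc (Suc ?n) - a))
        - (\<Sum>a\<le>Suc (Suc ?n). of_real (g a * (1 - q ^ (Suc (Suc ?n) - a))) * f a (Suc (Suc ?n) - a))"
      by (simp only: of_real_diff left_diff_distrib sum_subtractf mult_Suc_right add_2_eq_Suc)
    also have "(\<Sum>a\<le>Suc (Suc ?n). of_real (G a * (1 - q ^ a)) * f a (Suc (Suc ?n) - a)) =
        (\<Sum>m\<le>Suc ?n. of_real (g m * (1 - q ^ Suc m)) * f (Suc m) (Suc ?n - m))"
      by (subst sum.atMost_Suc_shift) (simp add: Gs)
    also have "(\<Sum>a\<le>Suc (Suc ?n). of_real (g a * (1 - q ^ (Suc (Suc ?n) - a))) * f a (Suc (Suc ?n) - a)) =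
        (\<Sum>m\<le>Suc ?n. of_real (g m * (1 - q ^ Suc (Suc ?n - m))) * f m (Suc (Suc ?n - m)))"
      by (subst sum.atMost_Suc) (simp add: Suc_diff_le del: sum.atMost_Suc power_Suc)
    finally show ?thesis
      by (simp only: of_real_mult mult.assoc sum_subtractf[symmetric] right_diff_distrib[symmetric])
  qed
  also have "\<dots> = (\<Sum>m\<le>Suc ?n. of_real (g m) *
      ((if m = Suc ?n then 0 else of_real (1 - c * q ^ m) * f m (?n - m)) -
       (if m = 0 then 0 else of_real (1 - c * q ^ (Suc ?n - m)) * f (m - 1) (Suc ?n - m))))"
  proof (rule sum.cong[OF refl])
    fix m assume "m \<in> {..Suc ?n}"
    then have k: "(Suc ?n - m = 0) = (m = Suc ?n)" "Suc ?n - m - 1 = ?n - m" by auto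
    show "of_real (g m) *
        (of_real (1 - q ^ Suc m) * f (Suc m) (Suc ?n - m) -
          of_real (1 - q ^ Suc (Suc ?n - m)) * f m (Suc (Suc ?n - m))) =
      of_real (g m) *
        ((if m = Suc ?n then 0 else of_real (1 - c * q ^ m) * f m (?n - m)) -
         (if m = 0 then 0 else of_real (1 - c * q ^ (Suc ?n - m)) * f (m - 1) (Suc ?n - m)))"
      unfolding rec k by (rule refl)
  qed
  \<comment> \<open>The boundary cases \<open>k = 0\<close> and \<open>m = 0\<close> drop out. After
    an index shift in the second sum both run over level \<open>2 * M\<close>.\<close>
  also have "\<dots> = (\<Sum>m\<le>?n. of_real (g m) * (of_real (1 - c * q ^ m) * f m (?n - m))) -
      (\<Sum>m\<le>?n. of_real (g (Suc m)) * (of_real (1 - c * q ^ (?n - m)) * f m (?n - m)))"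
  proof -
    have "(\<Sum>m\<le>Suc ?n. of_real (g m) * (if m = Suc ?n then 0 else of_real (1 - c * q ^ m) * f m (?n - m))) =
        (\<Sum>m\<le>?n. of_real (g m) * (of_real (1 - c * q ^ m) * f m (?n - m)))"
      by (simp add: sum.atMost_Suc)
    moreover have "(\<Sum>m\<le>Suc ?n. of_real (g m) *
        (if m = 0 then 0 else of_real (1 - c * q ^ (Suc ?n - m)) * f (m - 1) (Suc ?n - m))) =
        (\<Sum>m\<le>?n. of_real (g (Suc m)) * (of_real (1 - c * q ^ (?n - m)) * f m (?n - m)))"
      by (subst sum.atMost_Suc_shift) simp
    ultimately show ?thesis by (simp add: sum_subtractf right_diff_distrib del: sum.atMost_Suc)
  qed
  also have "\<dots> = (\<Sum>m\<le>?n. of_real ((1 - c * q ^ M) * (g m - g (Suc m))) * f m (?n - m))"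
    unfolding sum_subtractf[symmetric]
  proof (intro sum.cong refl)
    fix m assume m: "m \<in> {..?n}"
    \<comment> \<open>The same mechanism one level lower, now with the factor \<open>c\<close>: the
      result is the constant \<open>1 - c * q ^ M\<close>.\<close>
    have "g m * q ^ m = - (q ^ M) * g (Suc m)" "g (Suc m) * q ^ (?n - m) = - (q ^ M) * g m"
      using theta_shift[of m "?n - m" M "int M - int m" q] m unfolding g1 g_def[symmetric] by auto
    then have "g m * (1 - c * q ^ m) - g (Suc m) * (1 - c * q ^ (?n - m)) =
        (1 - c * q ^ M) * (g m - g (Suc m))"
      by (simp add: algebra_simps)
    then have "of_real ((1 - c * q ^ M) * (g m - g (Suc m))) * f m (?n - m) =
        of_real (g m * (1 - c * q ^ m) - g (Suc m) * (1 - c * q ^ (?n - m))) * f m (?n - m)" by simp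
    also have "\<dots> = of_real (g m) * (of_real (1 - c * q ^ m) * f m (?n - m)) -
        of_real (g (Suc m)) * (of_real (1 - c * q ^ (?n - m)) * f m (?n - m))"
      by (simp add: algebra_simps)
    finally show "of_real (g m) * (of_real (1 - c * q ^ m) * f m (?n - m)) -
        of_real (g (Suc m)) * (of_real (1 - c * q ^ (?n - m)) * f m (?n - m)) =
        of_real ((1 - c * q ^ M) * (g m - g (Suc m))) * f m (?n - m)"
      by (rule sym)
  qed
  also have "\<dots> = of_real (1 - c * q ^ M) * \<Phi> M"
    unfolding \<Phi>_def g1 g_def[symmetric] sum_distrib_left by (intro sum.cong) (simp_all add: mult.assoc)
  finally have step: "of_real (1 - q ^ Suc M) * \<Phi> (Suc M) = of_real (1 - c * q ^ M) * \<Phi> M" .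
  have "complex_of_real (q_poch q (Suc M)) * \<Phi> (Suc M) =
      of_real (q_poch q M) * (of_real (1 - q ^ Suc M) * \<Phi> (Suc M))"
    by (simp del: power_Suc)
  also have "\<dots> = of_real (1 - c * q ^ M) * (of_real (q_poch q M) * \<Phi> M)"
    unfolding step by (simp only: mult_ac)
  also have "of_real (q_poch q M) * \<Phi> M = complex_of_real (\<Prod>j<M. 1 - c * q ^ j) * (2 * f 0 0)"
    using Suc.IH by (simp only: \<Phi>_def)
  finally show ?case unfolding \<Phi>_def by (simp only: prod.lessThan_Suc of_real_mult mult_ac)
qed

text \<open>The weights have uniformly bounded absolute sum, so the weighted sum over level 2 M is
  at most a constant times \<open>\<epsilon> (2 * M)\<close>. By the explicit solution it is also at
  least a fixed positive multiple of the initial value, because the products of the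
  \<open>1 - c * q ^ j\<close> stay away from 0 for \<open>\<bar>c\<bar> < 1\<close>.\<close>

lemma theta_recurrence_zero:
  fixes e :: "nat \<Rightarrow> nat \<Rightarrow> complex" and q c :: real
  assumes q: "\<bar>q\<bar> < 1" and c: "\<bar>c\<bar> < 1"
    and rec: "\<And>m k. e (Suc m) k - e m (Suc k) =
      (if k = 0 then 0 else of_real ((1 - q ^ k) * (1 - c * q ^ m)) * e m (k - 1)) -
      (if m = 0 then 0 else of_real ((1 - q ^ m) * (1 - c * q ^ k)) * e (m - 1) k)"
    and bound: "\<And>m k. cmod (e m k) \<le> \<epsilon> (m + k) * sqrt (q_poch q m * q_poch q k)"
    and lim: "\<epsilon> \<longlonglongrightarrow> 0"
  shows "e 0 0 = 0"
proof -
  let ?P = "q_poch q"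
  \<comment> \<open>Division by both q-Pochhammer symbols moves the factors \<open>1 - q ^ k\<close>
    and \<open>1 - q ^ m\<close> from the right of the recurrence to \<open>1 - q ^ Suc m\<close>
    and \<open>1 - q ^ Suc k\<close> on the left, as \<open>theta_recurrence_solution\<close>
    expects.\<close>
  define f where "f m k = e m k / of_real (?P m * ?P k)" for m k
  have P0: "?P m \<noteq> 0" "?P m > 0" for m using q_poch_pos[OF q, of m] by auto
  have P1: "1 - q ^ Suc m \<noteq> 0" for m using power_abs_less_1[OF q, of m] by (auto simp del: power_Suc)
  have P1c: "1 - complex_of_real q ^ Suc m \<noteq> 0" for m
    using P1[of m] by (metis of_real_1 of_real_diff of_real_eq_0_iff of_real_power)
  have frec: "of_real (1 - q ^ Suc m) * f (Suc m) k - of_real (1 - q ^ Suc k) * f m (Suc k) =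
      (if k = 0 then 0 else of_real (1 - c * q ^ m) * f m (k - 1)) -
      (if m = 0 then 0 else of_real (1 - c * q ^ k) * f (m - 1) k)" for m k
  proof -
    have "of_real (1 - q ^ Suc m) * f (Suc m) k - of_real (1 - q ^ Suc k) * f m (Suc k) =
        (e (Suc m) k - e m (Suc k)) / of_real (?P m * ?P k)"
      using P0 P1c by (simp add: f_def divide_simps del: power_Suc)
    also have "\<dots> = (if k = 0 then 0 else of_real (1 - c * q ^ m) * f m (k - 1)) -
      (if m = 0 then 0 else of_real (1 - c * q ^ k) * f (m - 1) k)"
      unfolding rec using P0 P1c
      by (cases m; cases k) (simp_all add: f_def divide_simps del: power_Suc)
    finally show ?thesis .
  qed
  obtain C0 C1 where C0: "0 < C0" "\<And>m. C0 \<le> ?P m" and C1: "\<And>m. ?P m \<le> C1"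
    using q_poch_bounds[OF q] by metis
  have C1pos: "0 < C1" using C0 C1[of 0] by simp
  obtain \<delta> where \<delta>: "\<delta> > 0" "\<And>n. \<delta> \<le> (\<Prod>j<n. 1 - \<bar>c\<bar> * \<bar>q\<bar> ^ j)"
    using prod_lower_bound[of "\<bar>c\<bar>" "\<bar>q\<bar>"] q c by auto
  have \<delta>': "\<delta> \<le> (\<Prod>j<M. 1 - c * q ^ j)" for M
  proof -
    have "(\<Prod>j<M. 1 - \<bar>c\<bar> * \<bar>q\<bar> ^ j) \<le> (\<Prod>j<M. 1 - c * q ^ j)"
    proof (intro prod_mono conjI)
      fix j
      have "\<bar>q\<bar> ^ j \<le> 1" using q by (intro power_le_one) auto
      then have "\<bar>c\<bar> * \<bar>q\<bar> ^ j \<le> 1 * 1" using c by (intro mult_mono) auto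
      then show "0 \<le> 1 - \<bar>c\<bar> * \<bar>q\<bar> ^ j" by simp
      have "c * q ^ j \<le> \<bar>c\<bar> * \<bar>q\<bar> ^ j"
        using abs_ge_self[of "c * q ^ j"] by (simp add: abs_mult power_abs)
      then show "1 - \<bar>c\<bar> * \<bar>q\<bar> ^ j \<le> 1 - c * q ^ j" by simp
    qed
    then show ?thesis using \<delta>(2)[of M] by linarith
  qed
  have \<epsilon>0: "0 \<le> \<epsilon> n" for n
  proof -
    have "0 \<le> \<epsilon> n * sqrt (?P n * ?P 0)" using order_trans[OF norm_ge_zero bound[of n 0]] by simp
    then show ?thesis using P0(2)[of n] by (simp add: zero_le_mult_iff)
  qed
  \<comment> \<open>\<open>4 / (1 - \<bar>q\<bar>)\<close> bounds the two theta sums in the weights,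
    \<open>C1\<close> bounds the prefactor \<open>q_poch q M\<close>, and \<open>C0\<close> is a
    lower bound for the square root of a product of two q-Pochhammer symbols.\<close>
  define S where "S = C1 / C0 * (4 / (1 - \<bar>q\<bar>))"
  have main: "\<delta> * (2 * cmod (f 0 0)) \<le> S * \<epsilon> (2 * M)" for M
  proof -
    let ?w = "\<lambda>a. theta q (int M - int a) - theta q (int M - int a - 1)"
    have "\<delta> * (2 * cmod (f 0 0)) \<le> cmod (complex_of_real (\<Prod>j<M. 1 - c * q ^ j) * (2 * f 0 0))"
      using \<delta>'[of M] \<delta>(1) by (simp only: norm_mult norm_of_real) (auto intro!: mult_right_mono)
    also have "\<dots> = cmod (of_real (?P M) * (\<Sum>a\<le>2 * M. of_real (?w a) * f a (2 * M - a)))"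
      by (simp only: theta_recurrence_solution[of q f c M, OF frec])
    also have "\<dots> = ?P M * cmod (\<Sum>a\<le>2 * M. of_real (?w a) * f a (2 * M - a))"
      using P0(2)[of M] by (simp add: norm_mult)
    also have "\<dots> \<le> ?P M * (\<Sum>a\<le>2 * M. \<bar>?w a\<bar> * (\<epsilon> (2 * M) / C0))"
    proof (intro mult_left_mono sum_norm_le)
      fix a assume a: "a \<in> {..2 * M}"
      let ?R = "?P a * ?P (2 * M - a)"
      have R: "C0 * C0 \<le> ?R" using C0 by (intro mult_mono) (auto intro: less_imp_le P0)
      then have Rpos: "0 < ?R" using C0(1) by (meson mult_pos_pos order_less_le_trans)
      have "C0 \<le> sqrt ?R" using R C0(1) by (intro real_le_rsqrt) (simp add: power2_eq_square)
      have "cmod (f a (2 * M - a)) = cmod (e a (2 * M - a)) / ?R"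
        unfolding f_def norm_divide norm_of_real using Rpos by simp
      also have "\<dots> \<le> \<epsilon> (2 * M) * sqrt ?R / ?R"
        using bound[of a "2 * M - a"] a Rpos by (intro divide_right_mono) auto
      also have "\<dots> = \<epsilon> (2 * M) / sqrt ?R"
      proof -
        have "x * s / (s * s) = x / s" for x s :: real by simp
        from this[of "\<epsilon> (2 * M)" "sqrt ?R"] show ?thesis using Rpos by simp
      qed
      also have "\<dots> \<le> \<epsilon> (2 * M) / C0"
        using \<open>C0 \<le> sqrt ?R\<close> C0(1) \<epsilon>0[of "2 * M"] Rpos by (intro divide_left_mono) auto
      finally show "norm (of_real (?w a) * f a (2 * M - a)) \<le> \<bar>?w a\<bar> * (\<epsilon> (2 * M) / C0)"
        unfolding norm_mult norm_of_real by (rule mult_left_mono) simp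
    qed (use P0 in \<open>auto intro: less_imp_le\<close>)
    also have "\<dots> = ?P M * ((\<Sum>a\<le>2 * M. \<bar>?w a\<bar>) * (\<epsilon> (2 * M) / C0))"
      by (simp only: sum_distrib_right)
    also have "\<dots> \<le> C1 * ((4 / (1 - \<bar>q\<bar>)) * (\<epsilon> (2 * M) / C0))"
    proof (intro mult_mono)
      have "(\<Sum>a\<le>2 * M. \<bar>?w a\<bar>) \<le>
          (\<Sum>a\<le>2 * M. \<bar>theta q (int M - int a)\<bar> + \<bar>theta q ((int M - 1) - int a)\<bar>)"
        by (intro sum_mono) (auto simp: algebra_simps)
      also have "\<dots> \<le> 2 / (1 - \<bar>q\<bar>) + 2 / (1 - \<bar>q\<bar>)"
        unfolding sum.distrib by (intro add_mono theta_sum_le q)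
      finally show "(\<Sum>a\<le>2 * M. \<bar>?w a\<bar>) \<le> 4 / (1 - \<bar>q\<bar>)" by simp
    qed (use q C0 C1 C1pos \<epsilon>0 in \<open>auto intro!: mult_nonneg_nonneg sum_nonneg divide_nonneg_nonneg\<close>)
    also have "\<dots> = S * \<epsilon> (2 * M)" by (simp add: S_def mult_ac)
    finally show ?thesis .
  qed
  have "(\<lambda>M. S * \<epsilon> (2 * M)) \<longlonglongrightarrow> S * 0"
    by (intro tendsto_intros LIMSEQ_subseq_LIMSEQ[OF lim, unfolded o_def]) (simp add: strict_mono_def)
  then have "\<delta> * (2 * cmod (f 0 0)) \<le> S * 0"
    by (rule LIMSEQ_le_const) (use main in auto)
  then have "cmod (f 0 0) \<le> 0" using \<delta>(1) by (simp add: mult_le_0_iff)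
  then show ?thesis by (simp add: f_def)
qed

section \<open>Vectors on which the left and the right field operator agree\<close>

text \<open>The q-integer [m]_q, written as a sum to avoid a division by
  \<open>1 - q\<close>.\<close>

definition q_number :: "real \<Rightarrow> nat \<Rightarrow> real" where
  "q_number q m = (\<Sum>j<m. q ^ j)"

lemma q_number_simps: "q_number q 0 = 0" "q_number q (Suc m) = 1 + q * q_number q m"
  by (simp_all add: q_number_def sum.lessThan_Suc_shift sum_distrib_left del: sum.lessThan_Suc)

lemma q_number_eq: "(1 - q) * q_number q m = 1 - q ^ m"
  by (simp add: q_number_def one_diff_power_eq)

lemma create_delta: "create i (delta u) = delta (i # u)"
  by (auto simp: fun_eq_iff create_eq delta_def)

lemma delta_append: "delta (p @ u) = foldr create p (delta u)"
  by (induction p) (simp_all flip: create_delta)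

lemma delta_replicate: "delta (replicate m i @ u) = (create i ^^ m) (delta u)"
  by (induction m) (simp_all flip: create_delta)

lemma ann_delta_Nil: "ann Q i (delta []) = (\<lambda>_. 0)"
  by (auto simp: fun_eq_iff ann_eq_sum delta_def)

context mixed_q begin

text \<open>The iterated commutation relation. The truncated \<open>m - 1\<close> at
  \<open>m = 0\<close> is harmless, since its coefficient is then 0.\<close>

lemma ann_create_power:
  "ann Q i ((create i ^^ m) f) = (\<lambda>w. of_real (q_number (Q $ i $ i) m) * (create i ^^ (m - 1)) f w +
     of_real ((Q $ i $ i) ^ m) * (create i ^^ m) (ann Q i f) w)"
proof (induction m)
  case (Suc m)
  have "(create i ^^ m) f w = create i ((create i ^^ (m - 1)) f) w" if "m \<noteq> 0" for w
    using that by (cases m) auto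
  then show ?case
    by (cases "m = 0")
      (simp_all add: ann_create Suc.IH create_add create_scale q_number_simps fun_eq_iff algebra_simps)
qed (simp add: q_number_simps)

lemma create_power_Fock: "f \<in> \<F> \<Longrightarrow> (create i ^^ m) f \<in> \<F>"
  by (induction m) (auto simp: create_Fock)

lemma foldr_create_Fock: "f \<in> \<F> \<Longrightarrow> foldr create p f \<in> \<F>"
  by (induction p) (auto simp: create_Fock)

lemma q_number_pos: "0 \<le> q_number (Q $ i $ i) m"
proof -
  have "\<bar>Q $ i $ i\<bar> ^ m \<le> 1" using Q_abs_less[of i i] by (intro power_le_one) auto
  then have "0 \<le> (1 - Q $ i $ i) * q_number (Q $ i $ i) m"
    unfolding q_number_eq using abs_ge_self[of "(Q $ i $ i) ^ m"] by (simp add: power_abs)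
  then show ?thesis using range[of i i] by (simp add: zero_le_mult_iff)
qed

text \<open>The squared norm grows at most like the q-factorial, and the factor
  \<open>(1 - Q $ i $ i) ^ m\<close> turns the q-factorial into \<open>q_poch\<close>. The estimate
  \<open>create_bound ^ m\<close> would lose an exponential factor whenever
  \<open>(1 - Q $ i $ i) * create_bound > 1\<close>.\<close>

lemma create_power_vnorm:
  "\<exists>C\<ge>0. \<forall>m. \<forall>f\<in>\<F>. (1 - Q $ i $ i) ^ m * (fnorm ((create i ^^ m) f))\<^sup>2 \<le>
     C * q_poch (Q $ i $ i) m * (fnorm f)\<^sup>2"
proof -
  let ?q = "Q $ i $ i" and ?k = create_bound
  have q: "\<bar>?q\<bar> < 1" by (rule Q_abs_less)
  \<comment> \<open>One factor per creation: the q-integer is the main term of the commutation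
    relation, and the summand with \<open>create_bound\<close> covers the cross term, which decays
    geometrically in \<open>j\<close>.\<close>
  define N where "N m = (\<Prod>j<m. q_number ?q (Suc j) + \<bar>?q\<bar> ^ Suc j * ?k)" for m
  have N0: "0 \<le> N m" for m
    unfolding N_def using q_number_pos create_bound_pos by (intro prod_nonneg) (auto intro!: add_nonneg_nonneg)
  have NB: "(fnorm ((create i ^^ m) f))\<^sup>2 \<le> N m * (fnorm f)\<^sup>2" if "f \<in> \<F>" for m f
    using that
  proof (induction m arbitrary: f)
    case (Suc m)
    define g where "g = (create i ^^ m) f"
    define h where "h = (create i ^^ m) (ann Q i f)"
    have gF: "g \<in> \<F>" and hF: "h \<in> \<F>" using Suc.prems by (auto simp: g_def h_def create_power_Fock ann_Fock)
    have g: "(fnorm g)\<^sup>2 \<le> N m * (fnorm f)\<^sup>2" unfolding g_def by (rule Suc.IH[OF Suc.prems])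
    have "(fnorm h)\<^sup>2 \<le> N m * (fnorm (ann Q i f))\<^sup>2"
      unfolding h_def by (rule Suc.IH[OF ann_Fock[OF Suc.prems]])
    also have "\<dots> \<le> N m * (?k * (fnorm f)\<^sup>2)"
    proof (intro mult_left_mono N0)
      have "(fnorm (ann Q i f))\<^sup>2 \<le> (sqrt ?k * fnorm f)\<^sup>2"
        using ann_vnorm[OF Suc.prems] ann_Fock[OF Suc.prems] by (intro power_mono) auto
      then show "(fnorm (ann Q i f))\<^sup>2 \<le> ?k * (fnorm f)\<^sup>2"
        using create_bound_pos by (simp add: power_mult_distrib)
    qed
    finally have h: "(fnorm h)\<^sup>2 \<le> ?k * (N m * (fnorm f)\<^sup>2)" by (simp add: mult_ac)
    have "(fnorm (create i h))\<^sup>2 \<le> (sqrt ?k * fnorm h)\<^sup>2"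
      using create_vnorm[OF hF] create_Fock[OF hF] by (intro power_mono) auto
    also have "\<dots> = ?k * (fnorm h)\<^sup>2" using create_bound_pos by (simp add: power_mult_distrib)
    also have "\<dots> \<le> ?k * (?k * (N m * (fnorm f)\<^sup>2))"
      using h create_bound_pos by (intro mult_left_mono) auto
    finally have ch: "(fnorm (create i h))\<^sup>2 \<le> ?k\<^sup>2 * (N m * (fnorm f)\<^sup>2)"
      by (simp add: power2_eq_square mult_ac)
    \<comment> \<open>Cauchy-Schwarz: one factor \<open>sqrt create_bound\<close> comes from the
      annihilation inside \<open>h\<close>, where the induction hypothesis is used for
      \<open>ann Q i f\<close>, and one from the outer \<open>create i\<close>.\<close>
    have "cmod (fip g (create i h)) \<le> ?k * (N m * (fnorm f)\<^sup>2)"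
    proof (rule power2_le_imp_le)
      have "(cmod (fip g (create i h)))\<^sup>2 \<le> (fnorm g)\<^sup>2 * (fnorm (create i h))\<^sup>2"
        using fock.cauchy_schwarz[OF gF create_Fock[OF hF]] gF create_Fock[OF hF] by (simp add: fock.vnorm_sq)
      also have "\<dots> \<le> (N m * (fnorm f)\<^sup>2) * (?k\<^sup>2 * (N m * (fnorm f)\<^sup>2))"
        using g ch N0 by (intro mult_mono) auto
      also have "\<dots> = (?k * (N m * (fnorm f)\<^sup>2))\<^sup>2" by (simp add: power2_eq_square mult_ac)
      finally show "(cmod (fip g (create i h)))\<^sup>2 \<le> (?k * (N m * (fnorm f)\<^sup>2))\<^sup>2" .
    qed (use N0 create_bound_pos in simp)
    then have "\<bar>?q ^ Suc m * Re (fip g (create i h))\<bar> \<le> \<bar>?q\<bar> ^ Suc m * (?k * (N m * (fnorm f)\<^sup>2))"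
      unfolding abs_mult power_abs using abs_Re_le_cmod[of "fip g (create i h)"] by (intro mult_left_mono) auto
    then have r: "?q ^ Suc m * Re (fip g (create i h)) \<le> \<bar>?q\<bar> ^ Suc m * (?k * (N m * (fnorm f)\<^sup>2))"
      by (simp only: abs_le_iff)
    have "fip (create i g) (create i g) = fip g (ann Q i ((create i ^^ Suc m) f))"
      using gF create_Fock[OF gF] by (simp add: fip_create g_def)
    also have "ann Q i ((create i ^^ Suc m) f) =
        (\<lambda>w. of_real (q_number ?q (Suc m)) * g w + of_real (?q ^ Suc m) * create i h w)"
      unfolding ann_create_power by (simp add: g_def h_def)
    also have "fip g \<dots> = of_real (q_number ?q (Suc m)) * fip g g + of_real (?q ^ Suc m) * fip g (create i h)"
      using gF create_Fock[OF hF]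
      by (simp add: fock.form_add_right fock.form_scale_right fock.scale_mem del: power_Suc)
    finally have "(fnorm (create i g))\<^sup>2 =
        q_number ?q (Suc m) * (fnorm g)\<^sup>2 + ?q ^ Suc m * Re (fip g (create i h))"
      using gF create_Fock[OF gF] fock.form_self[OF gF] by (simp add: fock.vnorm_sq del: power_Suc)
    also have "\<dots> \<le> q_number ?q (Suc m) * (N m * (fnorm f)\<^sup>2) +
        \<bar>?q\<bar> ^ Suc m * (?k * (N m * (fnorm f)\<^sup>2))"
      by (intro add_mono mult_left_mono g r q_number_pos)
    also have "\<dots> = N (Suc m) * (fnorm f)\<^sup>2"
      by (simp add: N_def algebra_simps del: power_Suc)
    finally show ?case by (simp add: g_def)
  qed (simp add: N_def)
  \<comment> \<open>Chosen so that the error summand, multiplied by \<open>1 - ?q\<close>, is at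
    most \<open>a * \<bar>?q\<bar> ^ j * (1 - ?q ^ Suc j)\<close>; this uses
    \<open>1 - \<bar>?q\<bar> \<le> 1 - ?q ^ Suc j\<close>.\<close>
  define a where "a = (1 - ?q) * ?k * \<bar>?q\<bar> / (1 - \<bar>?q\<bar>)"
  have a0: "0 \<le> a" unfolding a_def using q create_bound_pos by auto
  have NP: "(1 - ?q) ^ m * N m \<le> exp (a / (1 - \<bar>?q\<bar>)) * q_poch ?q m" for m
  proof -
    have "(1 - ?q) ^ m * N m = (\<Prod>j<m. (1 - ?q) * (q_number ?q (Suc j) + \<bar>?q\<bar> ^ Suc j * ?k))"
      by (simp add: N_def prod.distrib)
    also have "\<dots> \<le> (\<Prod>j<m. (1 + a * \<bar>?q\<bar> ^ j) * (1 - ?q ^ Suc j))"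
    proof (intro prod_mono conjI)
      fix j
      show "0 \<le> (1 - ?q) * (q_number ?q (Suc j) + \<bar>?q\<bar> ^ Suc j * ?k)"
        using q q_number_pos[of i "Suc j"] create_bound_pos by (intro mult_nonneg_nonneg add_nonneg_nonneg) auto
      have "?q ^ Suc j \<le> \<bar>?q\<bar> ^ Suc j" using abs_ge_self[of "?q ^ Suc j"] by (simp add: power_abs del: power_Suc)
      also have "\<dots> \<le> \<bar>?q\<bar>" using q power_le_one[of "\<bar>?q\<bar>" j] mult_left_mono[of "\<bar>?q\<bar> ^ j" 1 "\<bar>?q\<bar>"] by simp
      finally have le: "1 - \<bar>?q\<bar> \<le> 1 - ?q ^ Suc j" by simp
      have "(1 - ?q) * ?k * \<bar>?q\<bar> = a * (1 - \<bar>?q\<bar>)" using q by (simp add: a_def)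
      also have "\<dots> \<le> a * (1 - ?q ^ Suc j)" using le a0 by (rule mult_left_mono)
      finally have "(1 - ?q) * ?k * \<bar>?q\<bar> * \<bar>?q\<bar> ^ j \<le> a * (1 - ?q ^ Suc j) * \<bar>?q\<bar> ^ j"
        by (rule mult_right_mono) simp
      then show "(1 - ?q) * (q_number ?q (Suc j) + \<bar>?q\<bar> ^ Suc j * ?k) \<le> (1 + a * \<bar>?q\<bar> ^ j) * (1 - ?q ^ Suc j)"
        unfolding distrib_left q_number_eq by (simp add: algebra_simps)
    qed
    also have "\<dots> = (\<Prod>j<m. 1 + a * \<bar>?q\<bar> ^ j) * q_poch ?q m"
      by (simp add: prod.distrib q_poch_def)
    also have "\<dots> \<le> exp (a / (1 - \<bar>?q\<bar>)) * q_poch ?q m"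
      using a0 q q_poch_pos[OF q, of m] by (intro mult_right_mono prod_upper_bound) auto
    finally show ?thesis .
  qed
  show ?thesis
  proof (intro exI[of _ "exp (a / (1 - \<bar>?q\<bar>))"] conjI allI ballI)
    fix m f assume f: "f \<in> \<F>"
    have "(1 - ?q) ^ m * (fnorm ((create i ^^ m) f))\<^sup>2 \<le> (1 - ?q) ^ m * (N m * (fnorm f)\<^sup>2)"
      using NB[OF f, of m] q by (intro mult_left_mono) auto
    also have "\<dots> = ((1 - ?q) ^ m * N m) * (fnorm f)\<^sup>2" by simp
    also have "\<dots> \<le> (exp (a / (1 - \<bar>?q\<bar>)) * q_poch ?q m) * (fnorm f)\<^sup>2"
      by (intro mult_right_mono NP) simp
    finally show "(1 - ?q) ^ m * (fnorm ((create i ^^ m) f))\<^sup>2 \<le>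
      exp (a / (1 - \<bar>?q\<bar>)) * q_poch ?q m * (fnorm f)\<^sup>2" .
  qed simp
qed

section \<open>Words padded on both sides with the letter i\<close>

abbreviation padded :: "'n \<Rightarrow> nat \<Rightarrow> 'n list \<Rightarrow> nat \<Rightarrow> 'n list" where
  "padded i m w k \<equiv> replicate m i @ w @ replicate k i"

text \<open>The estimate for powers is used for the left padding and, after reversal of the word,
  for the right padding. Only one component of \<open>\<xi>\<close> meets the word; keeping its norm
  in the bound provides the decay in \<open>m + k\<close>.\<close>

lemma padded_bound:
  "\<exists>C\<ge>0. \<forall>m k \<xi>. \<xi> \<in> \<F> \<longrightarrow> sqrt (1 - Q $ i $ i) ^ (m + k) * cmod (fip \<xi> (delta (padded i m w k))) \<le>
     C * fnorm (component (m + length w + k) \<xi>) * sqrt (q_poch (Q $ i $ i) m * q_poch (Q $ i $ i) k)"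
proof -
  let ?q = "Q $ i $ i"
  let ?P = "q_poch ?q"
  have q: "\<bar>?q\<bar> < 1" by (rule Q_abs_less)
  obtain C where C0: "C \<ge> 0" and C: "\<And>m f. f \<in> \<F> \<Longrightarrow>
      (1 - ?q) ^ m * (fnorm ((create i ^^ m) f))\<^sup>2 \<le> C * ?P m * (fnorm f)\<^sup>2"
    using create_power_vnorm[of i] by blast
  show ?thesis
  proof (intro exI[of _ "C * fnorm (delta (rev w))"] conjI allI impI)
    show "0 \<le> C * fnorm (delta (rev w))" using C0 by simp
    fix m k \<xi> assume \<xi>: "\<xi> \<in> \<F>"
    let ?d = "delta (padded i m w k)" and ?n = "m + length w + k"
    have zero: "lip n \<xi> ?d = 0" if "n \<noteq> ?n" for n
    proof -
      have "lip n \<xi> ?d = lip n \<xi> (\<lambda>_. 0)"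
        using that by (intro level_ip_cong) (auto simp: delta_def)
      then show ?thesis using level_ip_cnj[of n \<xi> "\<lambda>_. 0"] level.form_zero by simp
    qed
    have "fip \<xi> ?d = lip ?n \<xi> ?d"
      unfolding ip_Fock by (subst suminf_finite[of "{?n}"]) (auto simp: zero)
    then have eq: "fip \<xi> ?d = fip (component ?n \<xi>) ?d" by (simp only: component_fip)
    have rep: "(1 - ?q) ^ k * (fnorm (delta (w @ replicate k i)))\<^sup>2 \<le>
        C * ?P k * (fnorm (delta (rev w)))\<^sup>2"
    proof -
      have "fnorm (delta (w @ replicate k i)) = fnorm (delta (replicate k i @ rev w))"
        using vnorm_reflect[of "delta (w @ replicate k i)"] by (simp add: reflect_delta)
      then show ?thesis using C[of "delta (rev w)" k] by (simp add: delta_replicate)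
    qed
    have P: "0 < ?P m" "0 < ?P k" using q_poch_pos[OF q] by auto
    have q0: "0 \<le> 1 - ?q" using q by simp
    have "(sqrt (1 - ?q) ^ (m + k) * fnorm ?d)\<^sup>2 = (1 - ?q) ^ (m + k) * (fnorm ?d)\<^sup>2"
    proof -
      have "(sqrt (1 - ?q) ^ (m + k))\<^sup>2 = (sqrt (1 - ?q) ^ 2) ^ (m + k)"
        by (simp only: power_mult[symmetric] mult.commute)
      then show ?thesis using q0 by (simp only: power_mult_distrib real_sqrt_pow2)
    qed
    also have "\<dots> = (1 - ?q) ^ k * ((1 - ?q) ^ m * (fnorm ?d)\<^sup>2)"
      by (simp add: power_add mult_ac)
    also have "\<dots> \<le> (1 - ?q) ^ k * (C * ?P m * (fnorm (delta (w @ replicate k i)))\<^sup>2)"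
      using C[of "delta (w @ replicate k i)" m] q0 by (intro mult_left_mono) (auto simp: delta_replicate)
    also have "\<dots> = C * ?P m * ((1 - ?q) ^ k * (fnorm (delta (w @ replicate k i)))\<^sup>2)"
      by (simp add: mult_ac)
    also have "\<dots> \<le> C * ?P m * (C * ?P k * (fnorm (delta (rev w)))\<^sup>2)"
      using rep C0 P by (intro mult_left_mono) auto
    also have "\<dots> = (C * fnorm (delta (rev w)) * sqrt (?P m * ?P k))\<^sup>2"
      using P by (simp add: power_mult_distrib) (simp add: power2_eq_square mult_ac)
    finally have *: "sqrt (1 - ?q) ^ (m + k) * fnorm ?d \<le> C * fnorm (delta (rev w)) * sqrt (?P m * ?P k)"
      by (rule power2_le_imp_le) (use C0 P in auto)
    have "sqrt (1 - ?q) ^ (m + k) * cmod (fip \<xi> ?d) \<le>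
        sqrt (1 - ?q) ^ (m + k) * (fnorm (component ?n \<xi>) * fnorm ?d)"
      unfolding eq using q0 by (intro mult_left_mono fock.ip_le) auto
    also have "\<dots> = fnorm (component ?n \<xi>) * (sqrt (1 - ?q) ^ (m + k) * fnorm ?d)"
      by (simp add: mult_ac)
    also have "\<dots> \<le> fnorm (component ?n \<xi>) * (C * fnorm (delta (rev w)) * sqrt (?P m * ?P k))"
      using * by (intro mult_left_mono) auto
    finally show "sqrt (1 - ?q) ^ (m + k) * cmod (fip \<xi> ?d) \<le>
        C * fnorm (delta (rev w)) * fnorm (component ?n \<xi>) * sqrt (?P m * ?P k)"
      by (simp add: mult_ac)
  qed
qed

lemma foldr_create_add: "foldr create p (\<lambda>w. f w + g w) = (\<lambda>w. foldr create p f w + foldr create p g w)"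
  by (induction p) (simp_all add: create_add)

lemma foldr_create_scale: "foldr create p (\<lambda>w. c * f w) = (\<lambda>w. c * foldr create p f w)"
  by (induction p) (simp_all add: create_scale)

text \<open>The terms in which the annihilation operator removes a letter of \<open>w\<close> vanish by assumption.\<close>

lemma fip_ann_past:
  assumes \<xi>: "\<xi> \<in> \<F>"
    and removed: "\<And>v. \<lbrakk>length v < length w; filter (\<lambda>j. j \<noteq> i) v = filter (\<lambda>j. j \<noteq> i) w\<rbrakk>
      \<Longrightarrow> fip \<xi> (delta (p @ v @ x)) = 0"
  shows "fip \<xi> (foldr create p (ann Q i (delta (w @ x)))) =
    of_real (prod_list (map (\<lambda>k. Q $ i $ k) w)) * fip \<xi> (foldr create (p @ w) (ann Q i (delta x)))"
  using removed
proof (induction w arbitrary: p)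
  case (Cons j w)
  have F: "foldr create (p @ [j]) (ann Q i (delta (w @ x))) \<in> \<F>" "foldr create p (delta (w @ x)) \<in> \<F>"
    by (simp_all add: foldr_create_Fock ann_Fock del: foldr_append)
  have "foldr create p (ann Q i (delta ((j # w) @ x))) =
      (\<lambda>v. (if i = j then 1 else 0) * foldr create p (delta (w @ x)) v +
        of_real (Q $ i $ j) * foldr create (p @ [j]) (ann Q i (delta (w @ x))) v)"
  proof -
    have "ann Q i (delta ((j # w) @ x)) =
        (\<lambda>v. (if i = j then 1 else 0) * delta (w @ x) v + of_real (Q $ i $ j) * create j (ann Q i (delta (w @ x))) v)"
      by (simp add: ann_create flip: create_delta)
    then show ?thesis by (simp only: foldr_create_add foldr_create_scale) simp
  qed
  moreover have "(if i = j then 1 else 0) * fip \<xi> (foldr create p (delta (w @ x))) = 0"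
    using Cons.prems[of w] by (auto simp: delta_append)
  ultimately have "fip \<xi> (foldr create p (ann Q i (delta ((j # w) @ x)))) =
      of_real (Q $ i $ j) * fip \<xi> (foldr create (p @ [j]) (ann Q i (delta (w @ x))))"
    using F \<xi> by (simp add: fock.form_add_right fock.form_scale_right fock.scale_mem del: foldr_append)
  also have "fip \<xi> (foldr create (p @ [j]) (ann Q i (delta (w @ x)))) =
      of_real (prod_list (map (\<lambda>k. Q $ i $ k) w)) * fip \<xi> (foldr create ((p @ [j]) @ w) (ann Q i (delta x)))"
  proof (rule Cons.IH)
    fix v assume "length v < length w" "filter (\<lambda>j. j \<noteq> i) v = filter (\<lambda>j. j \<noteq> i) w"
    then show "fip \<xi> (delta ((p @ [j]) @ v @ x)) = 0" using Cons.prems[of "j # v"] by simp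
  qed
  finally show ?case by simp
qed simp

lemma foldr_create_replicate: "foldr create (replicate m i) f = (create i ^^ m) f"
  by (induction m) simp_all

text \<open>The annihilation runs through three blocks. The two paddings give q-integers, the middle
  block contributes only its product of entries by \<open>fip_ann_past\<close>, and passing the left
  padding costs a power of \<open>Q $ i $ i\<close>.\<close>

lemma fip_ann_padded:
  assumes \<xi>: "\<xi> \<in> \<F>"
    and removed: "\<And>v. \<lbrakk>length v < length w; filter (\<lambda>j. j \<noteq> i) v = filter (\<lambda>j. j \<noteq> i) w\<rbrakk>
      \<Longrightarrow> fip \<xi> (delta (padded i m v k)) = 0"
  shows "fip \<xi> (ann Q i (delta (padded i m w k))) =
    of_real (q_number (Q $ i $ i) m) * fip \<xi> (delta (padded i (m - 1) w k)) +
    of_real ((Q $ i $ i) ^ m * prod_list (map (\<lambda>k. Q $ i $ k) w) * q_number (Q $ i $ i) k) *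
      fip \<xi> (delta (padded i m w (k - 1)))"
proof -
  let ?q = "Q $ i $ i" and ?d = "delta (w @ replicate k i)"
  have "ann Q i (delta (padded i m w k)) = (\<lambda>v. of_real (q_number ?q m) * delta (padded i (m - 1) w k) v +
      of_real (?q ^ m) * foldr create (replicate m i) (ann Q i ?d) v)"
    by (simp add: delta_replicate ann_create_power foldr_create_replicate)
  then have "fip \<xi> (ann Q i (delta (padded i m w k))) = of_real (q_number ?q m) * fip \<xi> (delta (padded i (m - 1) w k)) +
      of_real (?q ^ m) * fip \<xi> (foldr create (replicate m i) (ann Q i ?d))"
    using \<xi> by (simp add: fock.form_add_right fock.form_scale_right fock.scale_mem foldr_create_Fock ann_Fock
        create_power_Fock foldr_create_replicate)
  also have "fip \<xi> (foldr create (replicate m i) (ann Q i ?d)) = of_real (prod_list (map (\<lambda>k. Q $ i $ k) w)) *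
      fip \<xi> (foldr create (replicate m i @ w) (ann Q i (delta (replicate k i))))"
    by (rule fip_ann_past[OF \<xi> removed])
  also have "ann Q i (delta (replicate k i)) = (\<lambda>v. of_real (q_number ?q k) * delta (replicate (k - 1) i) v)"
  proof -
    have "(create i ^^ k) (\<lambda>_. 0) = (\<lambda>_. 0)" using foldr_create_scale[of "replicate k i" 0 "\<lambda>_. 0"]
      by (simp add: foldr_create_replicate)
    then show ?thesis
      using delta_replicate[of k i "[]"] delta_replicate[of "k - 1" i "[]"] ann_create_power[of i k "delta []"]
      by (simp add: ann_delta_Nil)
  qed
  also have "fip \<xi> (foldr create (replicate m i @ w) (\<lambda>v. of_real (q_number ?q k) * delta (replicate (k - 1) i) v)) =
      of_real (q_number ?q k) * fip \<xi> (delta (padded i m w (k - 1)))"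
    using \<xi> unfolding foldr_create_scale
    by (simp add: fock.form_scale_right foldr_create_Fock delta_append[symmetric] flip: foldr_append)
  finally show ?thesis by (simp add: mult_ac)
qed

lemma fip_field_delta:
  assumes "\<xi> \<in> \<F>"
  shows "fip (field i \<xi>) (delta u) = fip \<xi> (delta (i # u)) + fip \<xi> (ann Q i (delta u))"
  using assms by (simp add: fip_field) (simp add: field_def[abs_def] create_delta fock.form_add_right ann_Fock)

lemma fip_right_field_delta:
  assumes "\<xi> \<in> \<F>"
  shows "fip (right_field i \<xi>) (delta u) = fip \<xi> (delta (u @ [i])) + fip (reflect \<xi>) (ann Q i (delta (rev u)))"
proof -
  have "fip (right_field i \<xi>) (delta u) = fip (field i (reflect \<xi>)) (delta (rev u))"
    by (simp add: right_field_def fip_reflect_left reflect_delta)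
  also have "\<dots> = fip (reflect \<xi>) (delta (i # rev u)) + fip (reflect \<xi>) (ann Q i (delta (rev u)))"
    using assms by (simp add: fip_field_delta)
  also have "fip (reflect \<xi>) (delta (i # rev u)) = fip \<xi> (delta (u @ [i]))"
    by (simp add: fip_reflect_left reflect_delta)
  finally show ?thesis .
qed

lemma component_vnorm_tendsto:
  assumes "\<xi> \<in> \<F>"
  shows "(\<lambda>n. fnorm (component n \<xi>)) \<longlonglongrightarrow> 0"
proof -
  have "fip (component n \<xi>) (component n \<xi>) = lip n \<xi> \<xi>" for n
    unfolding component_fip component_def by (rule level_ip_cong) auto
  then have "(\<lambda>n. fnorm (component n \<xi>)) = (\<lambda>n. sqrt (lnorm2 n \<xi>))" by (simp add: vnorm_def)
  moreover have "(\<lambda>n. lnorm2 n \<xi>) \<longlonglongrightarrow> 0"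
    using assms by (intro summable_LIMSEQ_zero) (simp add: mem_Fock)
  then have "(\<lambda>n. sqrt (lnorm2 n \<xi>)) \<longlonglongrightarrow> sqrt 0" by (intro tendsto_intros)
  ultimately show ?thesis by simp
qed

lemma word_product_abs_less:
  assumes "w \<noteq> []"
  shows "\<bar>prod_list (map (\<lambda>k. Q $ i $ k) w)\<bar> < 1"
proof -
  have le: "\<bar>prod_list (map (\<lambda>k. Q $ i $ k) w)\<bar> \<le> 1" for w
  proof (induction w)
    case (Cons a w)
    then show ?case
      using mult_mono[OF less_imp_le[OF Q_abs_less[of i a]] Cons.IH] by (simp add: abs_mult)
  qed simp
  obtain j v where w: "w = j # v" using assms by (cases w) auto
  have "\<bar>prod_list (map (\<lambda>k. Q $ i $ k) w)\<bar> \<le> \<bar>Q $ i $ j\<bar> * 1"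
    unfolding w list.map prod_list.Cons abs_mult by (intro mult_left_mono le) simp
  then show ?thesis using Q_abs_less[of i j] by simp
qed

text \<open>The unpadded case, the one that the recurrence decides. Nonemptiness of \<open>w\<close>
  makes the product of its entries smaller than 1 in absolute value.\<close>

lemma fip_word_zero:
  assumes \<xi>: "\<xi> \<in> \<F>" "field i \<xi> = right_field i \<xi>"
    and w: "w \<noteq> []"
    and removed: "\<And>v m k. \<lbrakk>length v < length w; filter (\<lambda>j. j \<noteq> i) v = filter (\<lambda>j. j \<noteq> i) w\<rbrakk>
      \<Longrightarrow> fip \<xi> (delta (padded i m v k)) = 0"
  shows "fip \<xi> (delta w) = 0"
proof -
  let ?q = "Q $ i $ i"
  define c where "c = prod_list (map (\<lambda>k. Q $ i $ k) w)"
  \<comment> \<open>As \<open>t ^ 2 * q_number ?q m = 1 - ?q ^ m\<close>, scaling by powers of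
    \<open>t\<close> replaces the q-integers by the coefficients of
    \<open>theta_recurrence_zero\<close>. It is also the scaling of
    \<open>padded_bound\<close>.\<close>
  define t where "t = sqrt (1 - ?q)"
  define d where "d m k = fip \<xi> (delta (padded i m w k))" for m k
  define e where "e m k = of_real (t ^ (m + k)) * d m k" for m k
  have q: "\<bar>?q\<bar> < 1" by (rule Q_abs_less)
  have t: "t * t = 1 - ?q" "0 \<le> t" using q by (simp_all add: t_def)
  have left: "fip \<xi> (ann Q i (delta (padded i m w k))) =
    of_real (q_number ?q m) * d (m - 1) k + of_real (?q ^ m * c * q_number ?q k) * d m (k - 1)" for m k
    unfolding d_def c_def by (rule fip_ann_padded[OF \<xi>(1) removed])
  \<comment> \<open>The left formula for the reversed word and the reflected vector;
    \<open>m\<close> and \<open>k\<close> exchange their roles while the product over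
    \<open>w\<close> is the same.\<close>
  have right: "fip (reflect \<xi>) (ann Q i (delta (rev (padded i m w k)))) =
    of_real (q_number ?q k) * d m (k - 1) + of_real (?q ^ k * c * q_number ?q m) * d (m - 1) k" for m k
  proof -
    have "fip (reflect \<xi>) (ann Q i (delta (padded i k (rev w) m))) =
      of_real (q_number ?q k) * fip (reflect \<xi>) (delta (padded i (k - 1) (rev w) m)) +
      of_real (?q ^ k * prod_list (map (\<lambda>k. Q $ i $ k) (rev w)) * q_number ?q m) *
        fip (reflect \<xi>) (delta (padded i k (rev w) (m - 1)))"
    proof (rule fip_ann_padded)
      fix v assume v: "length v < length (rev w)" "filter (\<lambda>j. j \<noteq> i) v = filter (\<lambda>j. j \<noteq> i) (rev w)"
      have "filter (\<lambda>j. j \<noteq> i) (rev v) = filter (\<lambda>j. j \<noteq> i) w"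
        using arg_cong[OF v(2), of rev] by (simp add: rev_filter)
      then show "fip (reflect \<xi>) (delta (padded i k v m)) = 0"
        using v(1) removed[of "rev v" m k] by (simp add: fip_reflect_left reflect_delta)
    qed (simp add: \<xi>)
    moreover have "prod_list (map (\<lambda>k. Q $ i $ k) (rev w)) = c"
      by (simp add: c_def rev_map[symmetric])
    ultimately show ?thesis by (simp add: fip_reflect_left reflect_delta d_def)
  qed
  have drec: "d (Suc m) k - d m (Suc k) =
      of_real (q_number ?q k * (1 - c * ?q ^ m)) * d m (k - 1) -
      of_real (q_number ?q m * (1 - c * ?q ^ k)) * d (m - 1) k" for m k
  proof -
    have "d (Suc m) k + fip \<xi> (ann Q i (delta (padded i m w k))) =
        fip (field i \<xi>) (delta (padded i m w k))"
      using fip_field_delta[OF \<xi>(1), of i "padded i m w k"] by (simp add: d_def)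
    also have "\<dots> = d m (Suc k) + fip (reflect \<xi>) (ann Q i (delta (rev (padded i m w k))))"
      unfolding \<xi>(2) fip_right_field_delta[OF \<xi>(1)]
      by (simp add: d_def replicate_append_same)
    finally show ?thesis unfolding left right by (simp add: algebra_simps)
  qed
  have tq: "t ^ 2 * q_number ?q m = 1 - ?q ^ m" for m
    using t q_number_eq[of ?q m] by (simp add: power2_eq_square)
  obtain C where C: "C \<ge> 0" "\<And>m k. t ^ (m + k) * cmod (d m k) \<le>
      C * fnorm (component (m + length w + k) \<xi>) * sqrt (q_poch ?q m * q_poch ?q k)"
    using padded_bound[of i w] \<xi>(1) unfolding d_def t_def by blast
  define \<epsilon> where "\<epsilon> n = C * fnorm (component (n + length w) \<xi>)" for n
  have "e 0 0 = 0"
  proof (rule theta_recurrence_zero[OF q, where c = c and e = e and \<epsilon> = \<epsilon>])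
    show "\<bar>c\<bar> < 1" unfolding c_def by (rule word_product_abs_less[OF w])
    show "e (Suc m) k - e m (Suc k) =
      (if k = 0 then 0 else of_real ((1 - ?q ^ k) * (1 - c * ?q ^ m)) * e m (k - 1)) -
      (if m = 0 then 0 else of_real ((1 - ?q ^ m) * (1 - c * ?q ^ k)) * e (m - 1) k)" for m k
    proof -
      have "e (Suc m) k - e m (Suc k) = of_real (t ^ Suc (m + k)) * (d (Suc m) k - d m (Suc k))"
        by (simp add: e_def algebra_simps)
      also have "\<dots> = of_real (t ^ Suc (m + k) * q_number ?q k * (1 - c * ?q ^ m)) * d m (k - 1) -
          of_real (t ^ Suc (m + k) * q_number ?q m * (1 - c * ?q ^ k)) * d (m - 1) k"
        unfolding drec by (simp add: algebra_simps)
      also have "of_real (t ^ Suc (m + k) * q_number ?q k * (1 - c * ?q ^ m)) * d m (k - 1) =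
          (if k = 0 then 0 else of_real ((1 - ?q ^ k) * (1 - c * ?q ^ m)) * e m (k - 1))"
      proof (cases k)
        case (Suc l)
        have "t ^ Suc (m + k) * q_number ?q k = t ^ (m + l) * (t ^ 2 * q_number ?q k)"
          by (simp add: Suc power2_eq_square)
        then have "t ^ Suc (m + k) * q_number ?q k * (1 - c * ?q ^ m) =
            ((1 - ?q ^ k) * (1 - c * ?q ^ m)) * t ^ (m + l)"
          unfolding tq by (simp only: mult_ac)
        then show ?thesis by (simp only: e_def of_real_mult mult.assoc) (simp add: Suc)
      qed (simp add: q_number_simps)
      also have "of_real (t ^ Suc (m + k) * q_number ?q m * (1 - c * ?q ^ k)) * d (m - 1) k =
          (if m = 0 then 0 else of_real ((1 - ?q ^ m) * (1 - c * ?q ^ k)) * e (m - 1) k)"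
      proof (cases m)
        case (Suc l)
        have "t ^ Suc (m + k) * q_number ?q m = t ^ (l + k) * (t ^ 2 * q_number ?q m)"
          by (simp add: Suc power2_eq_square)
        then have "t ^ Suc (m + k) * q_number ?q m * (1 - c * ?q ^ k) =
            ((1 - ?q ^ m) * (1 - c * ?q ^ k)) * t ^ (l + k)"
          unfolding tq by (simp only: mult_ac)
        then show ?thesis by (simp only: e_def of_real_mult mult.assoc) (simp add: Suc)
      qed (simp add: q_number_simps)
      finally show ?thesis .
    qed
    show "cmod (e m k) \<le> \<epsilon> (m + k) * sqrt (q_poch ?q m * q_poch ?q k)" for m k
    proof -
      have "cmod (e m k) = t ^ (m + k) * cmod (d m k)"
        using t by (simp add: e_def norm_mult norm_power)
      then show ?thesis using C(2)[of m k] by (simp add: \<epsilon>_def add_ac)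
    qed
    have "(\<lambda>n. C * fnorm (component (n + length w) \<xi>)) \<longlonglongrightarrow> C * 0"
      by (intro tendsto_intros LIMSEQ_ignore_initial_segment component_vnorm_tendsto \<xi>)
    then show "\<epsilon> \<longlonglongrightarrow> 0" by (simp add: \<epsilon>_def[abs_def])
  qed
  then show ?thesis by (simp add: e_def d_def)
qed

text \<open>The outer induction on \<open>w\<close> supplies the assumption on words with letters
  \<open>i\<close> removed. The inner one lowers \<open>m + k\<close>: a padding letter is moved
  onto \<open>\<xi>\<close> as a left or right field operator, and the annihilation terms have
  smaller padding or a shorter middle word.\<close>

lemma fip_padded_zero:
  assumes "\<xi> \<in> \<F>" "field i \<xi> = right_field i \<xi>" "\<not> set w \<subseteq> {i}"
  shows "fip \<xi> (delta (padded i m w k)) = 0"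
  using assms
proof (induction "length w" arbitrary: w \<xi> m k rule: less_induct)
  case less
  have IH: "fip \<xi> (delta (padded i m v k)) = 0"
    if \<xi>: "\<xi> \<in> \<F>" "field i \<xi> = right_field i \<xi>"
      and v: "length v < length w" "filter (\<lambda>j. j \<noteq> i) v = filter (\<lambda>j. j \<noteq> i) w" for v m k \<xi>
  proof (rule less.hyps[OF v(1) \<xi>])
    have "filter (\<lambda>j. j \<noteq> i) w \<noteq> []" using less.prems(3) by (auto simp: filter_empty_conv)
    then show "\<not> set v \<subseteq> {i}" unfolding v(2)[symmetric] by (auto simp: filter_empty_conv)
  qed
  have w: "w \<noteq> []" using less.prems(3) by auto
  show ?case
    using less.prems(1,2)
  proof (induction "m + k" arbitrary: m k \<xi> rule: less_induct)
    case (less m k)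
    have ann: "fip \<xi> (ann Q i (delta (padded i m' w k'))) = 0" if "m' + k' < m + k" for m' k'
      using that less.hyps[of "m' - 1" k' \<xi>] less.hyps[of m' "k' - 1" \<xi>] less.prems
      by (subst fip_ann_padded[OF less.prems(1)]) (auto simp: IH)
    have rann: "fip (reflect \<xi>) (ann Q i (delta (rev (padded i m' w k')))) = 0" if "m' + k' < m + k" for m' k'
    proof -
      have "fip (reflect \<xi>) (delta (padded i k' v m')) = 0"
        if v: "length v < length (rev w)" "filter (\<lambda>j. j \<noteq> i) v = filter (\<lambda>j. j \<noteq> i) (rev w)" for v
        using v(1) IH[OF less.prems, of "rev v" m' k'] arg_cong[OF v(2), of rev]
        by (simp add: rev_filter fip_reflect_left reflect_delta)
      then have "fip (reflect \<xi>) (ann Q i (delta (padded i k' (rev w) m'))) = 0"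
        using that less.hyps[of "m' - 1" k' \<xi>] less.hyps[of m' "k' - 1" \<xi>] less.prems
        by (subst fip_ann_padded) (auto simp: fip_reflect_left reflect_delta)
      then show ?thesis by simp
    qed
    \<comment> \<open>The field operator maps solutions to solutions because the left and right
      field operators commute; hence \<open>\<xi>\<close> must be arbitrary in both
      inductions.\<close>
    have inv: "field i \<xi> \<in> \<F>" "field i (field i \<xi>) = right_field i (field i \<xi>)"
      using field_Fock[OF less.prems(1)] arg_cong[OF less.prems(2), of "field i"]
        field_right_field[OF less.prems(1), of i i] by auto
    show ?case
    proof (cases m)
      case (Suc m')
      then show ?thesis
        using fip_field_delta[OF less.prems(1), of i "padded i m' w k"] ann[of m' k]
          less.hyps[of m' k "field i \<xi>"] inv by simp
    next
      case 0
      show ?thesis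
      proof (cases k)
        case (Suc k')
        have "fip (right_field i \<xi>) (delta (padded i 0 w k')) = 0"
          using less.hyps[of 0 k' "field i \<xi>"] inv 0 Suc less.prems(2) by simp
        then show ?thesis
          using fip_right_field_delta[OF less.prems(1), of i "padded i 0 w k'"] rann[of 0 k'] 0 Suc
          by (simp add: replicate_append_same)
      next
        case 0
        then show ?thesis
          using \<open>m = 0\<close> fip_word_zero[OF less.prems w] IH[OF less.prems] by simp
      qed
    qed
  qed
qed

text \<open>The symmetrizer only rearranges letters, so it respects the set of letters of a
  word.\<close>

lemma symmetrizer_support:
  assumes "length w = n" "\<not> set w \<subseteq> S" "\<And>v. \<not> set v \<subseteq> S \<Longrightarrow> g v = 0"
  shows "symmetrizer Q n g w = 0"
  unfolding symmetrizer_eq[OF assms(1)]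
proof (intro sum.neutral ballI)
  fix \<sigma> assume "\<sigma> \<in> {\<sigma>. \<sigma> permutes {..<n}}"
  then have \<sigma>: "\<sigma> permutes {..<n}" by simp
  have "set (permute_word w \<sigma>) = (\<lambda>p. w ! p) ` \<sigma> ` {..<n}"
    using assms(1) by (simp add: permute_word_def image_image atLeast0LessThan)
  also have "\<dots> = set w"
    unfolding permutes_image[OF \<sigma>] using assms(1) by (auto simp: set_conv_nth)
  finally show "of_real (crossings Q n w (\<lambda>a. a) (inv \<sigma>)) * g (permute_word w \<sigma>) = 0"
    using assms by simp
qed

text \<open>Orthogonality in the deformed inner product has to be turned into vanishing
  coefficients. The part \<open>f\<close> of \<open>\<xi>\<close> on words with another letter is
  orthogonal to \<open>\<xi>\<close>, and also to \<open>\<xi> - f\<close> because symmetrizers do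
  not mix the two kinds of words; hence it has norm 0.\<close>

lemma left_right_agree_support:
  assumes \<xi>: "\<xi> \<in> \<F>" "field i \<xi> = right_field i \<xi>" and w: "\<not> set w \<subseteq> {i}"
  shows "\<xi> w = 0"
proof -
  let ?n = "length w"
  define f where "f v = (if set v \<subseteq> {i} then 0 else \<xi> v)" for v
  have orth: "lip ?n (delta v) \<xi> = 0" if v: "length v = ?n" "\<not> set v \<subseteq> {i}" for v
  proof -
    have "component ?n (delta v) = delta v" using v by (auto simp: component_def delta_def fun_eq_iff)
    then have "lip ?n (delta v) \<xi> = fip (delta v) \<xi>" using component_fip[of ?n "delta v" \<xi>] by simp
    also have "\<dots> = 0"
      using fip_padded_zero[OF \<xi> v(2), of 0 0] fock.form_cnj[of \<xi> "delta v"] \<xi> by simp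
    finally show ?thesis .
  qed
  have "lip ?n f \<xi> = 0"
    unfolding level_ip_def tensor_ip_def
  proof (intro sum.neutral ballI)
    fix v :: "'n list" assume "v \<in> {v. length v = ?n}"
    then show "f v * cnj (symmetrizer Q ?n \<xi> v) = 0"
      using orth[of v] by (simp add: f_def lip_delta)
  qed
  moreover have "lip ?n f (\<lambda>v. \<xi> v - f v) = 0"
    unfolding level_ip_def tensor_ip_def
  proof (intro sum.neutral ballI)
    fix v :: "'n list" assume v: "v \<in> {v. length v = ?n}"
    show "f v * cnj (symmetrizer Q ?n (\<lambda>v. \<xi> v - f v) v) = 0"
    proof (cases "set v \<subseteq> {i}")
      case False
      then have "symmetrizer Q ?n (\<lambda>v. \<xi> v - f v) v = 0"
        using v by (intro symmetrizer_support[where S = "{i}"]) (auto simp: f_def)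
      then show ?thesis by simp
    qed (simp add: f_def)
  qed
  ultimately have "lip ?n f f = 0" by (simp add: level.form_diff_right)
  then have "f w = 0" by (intro level_ip_definite[of ?n]) auto
  then show ?thesis using w by (simp add: f_def)
qed

end

section \<open>Maximal abelian subalgebras and the centre\<close>

context mixed_q begin

text \<open>Both field operators send the vacuum to the basis vector of \<open>i\<close>, and
  \<open>x\<close> commutes with both, so both send \<open>x \<Omega>\<close> to the same
  vector.\<close>

lemma commuting_vacuum_support:
  assumes x: "x \<in> \<Gamma>" and comm: "x \<in> commutant Fock {q_gaussian Q i}" and w: "\<not> set w \<subseteq> {i}"
  shows "x \<Omega> w = 0"
proof (rule left_right_agree_support[OF _ _ w])
  have xB: "x \<in> fock.BO" using x \<Gamma>_bounded by auto
  show xO: "x \<Omega> \<in> \<F>" by (rule fock.bo_mem[OF xB delta_Fock])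
  have fO: "field i \<Omega> = delta [i]"
    by (simp add: field_def[abs_def] create_delta ann_delta_Nil)
  then have rO: "right_field i \<Omega> = delta [i]" by (simp add: right_field_def reflect_delta)
  have "field i (x \<Omega>) = x (delta [i])"
    using fock.commutantD[OF comm, of "q_gaussian Q i" \<Omega>] xO by (simp add: field_restrict fO)
  moreover have "right_field i (x \<Omega>) = x (delta [i])"
    using fock.commutantD[OF right_gaussian_commutant[of i] x, of \<Omega>] xO
    by (simp add: right_gaussian_def rO)
  ultimately show "field i (x \<Omega>) = right_field i (x \<Omega>)" by simp
qed

text \<open>The truncations of \<open>x \<Omega>\<close> have finite support on words in
  \<open>i\<close>, so they are attained exactly as \<open>a \<Omega>\<close> with \<open>a\<close>
  in the algebra of the single generator. They supply the approximation required by the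
  criterion.\<close>

lemma maximal_abelian_q_gaussian:
  "maximal_abelian_in Fock (vn_generated Fock {q_gaussian Q i}) \<Gamma>"
proof -
  let ?A = "vn_generated Fock {q_gaussian Q i}"
  have sub: "{q_gaussian Q i} \<subseteq> fock.BO" by (simp add: q_gaussian_bounded)
  have vN: "von_neumann_algebra Fock ?A" by (rule fock.von_neumann_vn_generated[OF sub])
  have A: "q_gaussian Q i \<in> ?A" using fock.vn_generated_superset[of "{q_gaussian Q i}"] by simp
  show ?thesis
  proof (rule fock.maximal_abelian_criterion[OF vN, where \<Omega> = \<Omega>])
    show "abelian Fock ?A"
      by (rule fock.abelian_vn_generated[OF sub]) (auto simp: adjoint_q_gaussian abelian_def)
    show "?A \<subseteq> \<Gamma>"
      unfolding mixed_q_gaussian_algebra_def by (rule fock.vn_generated_mono) auto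
    show "\<exists>a\<in>?A. fnorm (\<lambda>w. a \<Omega> w - x \<Omega> w) < e"
      if x: "x \<in> \<Gamma>" "x \<in> commutant Fock ?A" and e: "0 < e" for x and e :: real
    proof -
      have xO: "x \<Omega> \<in> \<F>" using x(1) \<Gamma>_bounded fock.bo_mem[OF _ delta_Fock] by auto
      have "x \<in> commutant Fock {q_gaussian Q i}" using x(2) A by (auto simp: commutant_def)
      then have supp: "x \<Omega> w = 0" if "\<not> set w \<subseteq> {i}" for w
        using commuting_vacuum_support[OF x(1) _ that] by simp
      have "\<forall>\<^sub>F N in sequentially. fnorm (\<lambda>w. x \<Omega> w - truncate N (x \<Omega>) w) < e"
        using order_tendstoD(2)[OF truncate_tendsto[OF xO] e] .
      then obtain N where N: "fnorm (\<lambda>w. x \<Omega> w - truncate N (x \<Omega>) w) < e"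
        by (auto simp: eventually_sequentially)
      have "\<exists>a\<in>?A. a \<Omega> = truncate N (x \<Omega>)"
      proof (rule op_vacuum_dense[where J = "{i}" and n = N])
        show "star_subalgebra Fock ?A" using vN by (simp add: von_neumann_algebra_def)
        show "op_one Fock \<in> ?A" by (rule fock.von_neumann_one[OF vN])
      qed (use A supp in \<open>auto simp: truncate_def\<close>)
      moreover have "fnorm (\<lambda>w. truncate N (x \<Omega>) w - x \<Omega> w) =
          fnorm (\<lambda>w. x \<Omega> w - truncate N (x \<Omega>) w)"
        using fock.vnorm_scale[OF fock.diff_mem[OF xO truncate_Fock], of "-1" N "x \<Omega>"] by simp
      ultimately show ?thesis using N by metis
    qed
  qed (use commutant_vacuum_total \<Gamma>_bounded in auto)
qed

text \<open>For a nonempty word take \<open>i\<close> different from its first letter: since a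
  central \<open>x\<close> commutes with the generator of \<open>i\<close>, the coefficient of
  \<open>x \<Omega>\<close> at this word vanishes. Thus \<open>x \<Omega>\<close> is a multiple of
  the vacuum, and \<open>x\<close> is scalar on the total set of vectors
  \<open>z \<Omega>\<close>.\<close>

lemma \<Gamma>_factor:
  assumes "CARD('n) \<ge> 2"
  shows "factor Fock \<Gamma>"
proof -
  have star: "star_subalgebra Fock \<Gamma>" using von_neumann_\<Gamma> by (simp add: von_neumann_algebra_def)
  have scalar: "\<exists>c. \<forall>z\<in>commutant Fock \<Gamma>. x (z \<Omega>) = (\<lambda>w. c * z \<Omega> w)"
    if x: "x \<in> \<Gamma>" "x \<in> commutant Fock \<Gamma>" for x
  proof (intro exI ballI)
    fix z assume z: "z \<in> commutant Fock \<Gamma>"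
    have "x \<Omega> w = x \<Omega> [] * \<Omega> w" for w
    proof (cases w)
      case (Cons k v)
      have "card {k} \<noteq> CARD('n)" using assms by simp
      then have "{k} \<noteq> UNIV" by metis
      then obtain i where i: "i \<noteq> k" by auto
      have "q_gaussian Q i \<in> \<Gamma>"
        using fock.vn_generated_superset[of "range (q_gaussian Q)"]
        by (auto simp: mixed_q_gaussian_algebra_def)
      then have "x \<in> commutant Fock {q_gaussian Q i}" using x(2) by (auto simp: commutant_def)
      then have "x \<Omega> w = 0" using i by (intro commuting_vacuum_support[OF x(1)]) (auto simp: Cons)
      then show ?thesis by (simp add: Cons delta_def)
    qed (simp add: delta_def)
    then have "x \<Omega> = (\<lambda>w. x \<Omega> [] * \<Omega> w)" by (rule ext)
    then have "z (x \<Omega>) = (\<lambda>w. x \<Omega> [] * z \<Omega> w)"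
      using fock.bo_scale[of z \<Omega> "x \<Omega> []"] z by (simp add: commutant_def)
    then show "x (z \<Omega>) = (\<lambda>w. x \<Omega> [] * z \<Omega> w)"
      using fock.commutantD[OF z x(1) delta_Fock] by simp
  qed
  have "\<exists>c. x = op_scale Fock c (op_one Fock)" if x: "x \<in> \<Gamma>" "x \<in> commutant Fock \<Gamma>" for x
  proof -
    have xB: "x \<in> fock.BO" using x \<Gamma>_bounded by auto
    \<comment> \<open>The scalar is computed for the adjoint, which lands in the second argument
      when \<open>x f\<close> is paired with \<open>z \<Omega>\<close>. Totality then determines
      \<open>x f\<close> for every \<open>f\<close>.\<close>
    have "op_adjoint Fock x \<in> \<Gamma>" using star x(1) by (simp add: star_subalgebra_def)
    then obtain c where c: "\<And>z. z \<in> commutant Fock \<Gamma> \<Longrightarrow> op_adjoint Fock x (z \<Omega>) = (\<lambda>w. c * z \<Omega> w)"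
      using scalar fock.commutant_adjoint[OF star x(2)] by blast
    have "x = op_scale Fock (cnj c) (op_one Fock)"
    proof (rule fock.op_eqI[OF xB fock.op_scale_bo[OF fock.op_one_bo]])
      fix f assume f: "f \<in> \<F>"
      have "(\<lambda>w. x f w - cnj c * f w) = (\<lambda>_. 0)"
      proof (rule commutant_vacuum_total)
        show "(\<lambda>w. x f w - cnj c * f w) \<in> \<F>"
          by (intro fock.diff_mem fock.scale_mem f fock.bo_mem[OF xB])
        fix z assume z: "z \<in> commutant Fock \<Gamma>"
        then have zO: "z \<Omega> \<in> \<F>" by (auto simp: commutant_def fock.bo_mem)
        have "fip (x f) (z \<Omega>) = cnj c * fip f (z \<Omega>)"
          using f zO by (simp add: fock.op_adjoint_ip[OF xB] c[OF z] fock.form_scale_right)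
        then show "fip (\<lambda>w. x f w - cnj c * f w) (z \<Omega>) = 0"
          using f zO by (simp add: fock.form_diff fock.form_scale fock.scale_mem fock.bo_mem[OF xB])
      qed
      then show "x f = op_scale Fock (cnj c) (op_one Fock) f"
        using f by (simp add: fock.op_apply fun_eq_iff)
    qed
    then show ?thesis by blast
  qed
  moreover have "op_scale Fock c (op_one Fock) \<in> \<Gamma>" for c
    using star fock.von_neumann_one[OF von_neumann_\<Gamma>] by (simp add: star_subalgebra_def)
  moreover have "op_scale Fock c (op_one Fock) \<in> commutant Fock \<Gamma>" for c
  proof (rule fock.commutantI[OF fock.op_scale_bo[OF fock.op_one_bo] \<Gamma>_bounded])
    fix B f assume "B \<in> \<Gamma>" "f \<in> \<F>"
    then show "op_scale Fock c (op_one Fock) (B f) = B (op_scale Fock c (op_one Fock) f)"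
      using subsetD[OF \<Gamma>_bounded] by (simp add: fock.op_apply fock.bo_mem fock.bo_scale)
  qed
  ultimately show ?thesis using von_neumann_\<Gamma> by (auto simp: factor_def)
qed

end

theorem theorem3:
  fixes Q :: "real^'n^'n"
  assumes symmetric: "\<And>i j. Q $ i $ j = Q $ j $ i"
    and range: "\<And>i j. -1 < Q $ i $ j \<and> Q $ i $ j < 1"
  shows "(\<forall>i. maximal_abelian_in (Q_Fock Q) (vn_generated (Q_Fock Q) {q_gaussian Q i})
            (mixed_q_gaussian_algebra Q)) \<and>
         (CARD('n) \<ge> 2 \<longrightarrow> factor (Q_Fock Q) (mixed_q_gaussian_algebra Q))"
proof -
  interpret mixed_q Q by unfold_locales (rule symmetric, rule range)
  show ?thesis using maximal_abelian_q_gaussian \<Gamma>_factor by blast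
qed

end
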